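(* Let $d\ge3$, let $h$ be as in the context, let $\lambda>0$ be given, suppose $\lim_{v\to\infty}\frac{h(v)}{v}<\infty$, and let $\mathbf y$ be a cavitating solution for the stretch $\lambda$. Then $$\frac{d}{dt}E[\mathbf y,B](t)>0$$ for every $t>0$ and every open ball $B\subset\mathbb{R}^d$ containing the whole wave fan $\{|\mathbf x|\le\sigma t\}$ at time $t$.
   Context: Material. Let $d\ge3$ and let $h:(0,\infty)\to[0,\infty)$ be three times differentiable with $h''>0$, $h'''<0$, $\lim_{v\to0}h(v)=\lim_{v\to\infty}h(v)=\infty$. $H>0$ denotes the unique number with $h'(H)=0$. For $\mathbf F\in\mathbb{R}^{d\times d}$ with $\det\mathbf F>0$, $W(\mathbf F)=\frac12\sum_{i=1}^d\lambda_i^2+h\big(\prod_{i=1}^d\lambda_i\big)$, where $\lambda_1,\dots,\lambda_d$ are the eigenvalues of $\sqrt{\mathbf F\mathbf F^T}$. Cavitating solution (of K.A. Pericak-Spector and S. Spector) for the stretch $\lambda>0$: $\mathbf y(\mathbf x,t)=w(|\mathbf x|,t)\frac{\mathbf x}{|\mathbf x|}$, $w(R,t)=t\,r(R/t)$ for $t>0$, where for some $\sigma>0$ (the shock speed) the function $r:[0,\infty)\to(0,\infty)$ is continuous, $r(0)>0$, $r(s)=\lambda s$ for $s\ge\sigma$, $r$ is $C^2$ on $(0,\sigma)$ and $C^1$ up to $\sigma$ from the left. With $v(s)=r'(s)(r(s)/s)^{d-1}$, $P_1=r'+(r/s)^{d-1}h'(v)$, $P_2=\frac rs+r'(r/s)^{d-2}h'(v)$: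 (i) $s^2r''=\frac{d}{ds}P_1+\frac{d-1}{s}(P_1-P_2)$ on $(0,\sigma)$; (ii) $\sigma^2(\lambda-r'(\sigma-))=\lambda+\lambda^{d-1}h'(\lambda^d)-P_1(\sigma-)$; (iii) the Cauchy stress vanishes at the cavity surface, i.e. $v(s)\to H$ as $s\to0^+$. Known properties of this solution, which may be used: $H\le v\le\lambda^d$; $r'\ge0$ is strictly increasing on $(0,\sigma]$ and $r'(\sigma-)<\lambda$; $v$ is strictly increasing on $(0,\sigma)$; $r(s)>\lambda s>s\,r'(s)$ for $0<s<\sigma$. $\mathbf y$ is extended by $\lambda\mathbf x$ for $t\le0$. Averaging and energy. Let $\phi\in C_c^\infty(\mathbb{R})$ with $\phi\ge0$, $\phi(-x)=\phi(x)$, $\int\phi=1$, $\operatorname{supp}\phi\subset[-1,1]$, $\phi(0)>0$; $\phi_n(R)=n\phi(nR)$. Set $w^n(R,t)=\int_0^\infty[\phi_n(R-\tilde R)-\phi_n(R+\tilde R)]w(\tilde R,t)\,d\tilde R$, $\mathbf y^n(\mathbf x,t)=w^n(|\mathbf x|,t)\frac{\mathbf x}{|\mathbf x|}$, and $$E[\mathbf y,B](t):=\lim_{n\to\infty}\int_B\tfrac12|\mathbf y^n_t(\mathbf x,t)|^2+W(\nabla\mathbf y^n(\mathbf x,t))\,d\mathbf x .$$ *)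

theory Defs
  imports "HOL-Analysis.Analysis"
begin

section \<open>Material\<close>

text \<open>Functions on the half lines $(0,\infty)$ and $[0,\infty)$ are total functions on the reals
  whose values outside the half line are never used.\<close>

definition admissible_h :: "(real \<Rightarrow> real) \<Rightarrow> bool" where
  "admissible_h h \<longleftrightarrow>
     (\<forall>v>0. 0 \<le> h v) \<and>
     (\<forall>v>0. h differentiable (at v) \<and> deriv h differentiable (at v)
            \<and> (deriv ^^ 2) h differentiable (at v)) \<and>
     (\<forall>v>0. (deriv ^^ 2) h v > 0 \<and> (deriv ^^ 3) h v < 0) \<and>
     filterlim h at_top (at_right 0) \<and> filterlim h at_top at_top"

definition h_min :: "(real \<Rightarrow> real) \<Rightarrow> real" where
  "h_min h = (THE H. H > 0 \<and> deriv h H = 0)"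

text \<open>The positive semidefinite symmetric square root of a matrix of the form $F F^T$.\<close>

definition psd_sqrt :: "real^'d^'d \<Rightarrow> real^'d^'d" where
  "psd_sqrt A = (THE S. transpose S = S \<and> (\<forall>x. 0 \<le> x \<bullet> (S *v x)) \<and> S ** S = A)"

definition eigenspace :: "real^'d^'d \<Rightarrow> real \<Rightarrow> (real^'d) set" where
  "eigenspace A \<mu> = {x. A *v x = \<mu> *\<^sub>R x}"

definition eigenvalues :: "real^'d^'d \<Rightarrow> real set" where
  "eigenvalues A = {\<mu>. \<exists>x. x \<noteq> 0 \<and> A *v x = \<mu> *\<^sub>R x}"

text \<open>Eigenvalues are counted with their (geometric) multiplicity, which for the symmetric matrix
  under the square root is the algebraic one. Only matrices with positive determinant
  are meaningful arguments.\<close>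

definition stored_energy :: "(real \<Rightarrow> real) \<Rightarrow> real^'d^'d \<Rightarrow> real" where
  "stored_energy h F = (let S = psd_sqrt (F ** transpose F) in
     1/2 * (\<Sum>\<mu>\<in>eigenvalues S. real (dim (eigenspace S \<mu>)) * \<mu>\<^sup>2)
     + h (\<Prod>\<mu>\<in>eigenvalues S. \<mu> ^ dim (eigenspace S \<mu>)))"

section \<open>The cavitating solution\<close>

definition spec_vol :: "nat \<Rightarrow> (real \<Rightarrow> real) \<Rightarrow> real \<Rightarrow> real" where
  "spec_vol d r s = deriv r s * (r s / s) ^ (d - 1)"

definition stress1 :: "nat \<Rightarrow> (real \<Rightarrow> real) \<Rightarrow> (real \<Rightarrow> real) \<Rightarrow> real \<Rightarrow> real" where
  "stress1 d h r s = deriv r s + (r s / s) ^ (d - 1) * deriv h (spec_vol d r s)"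

definition stress2 :: "nat \<Rightarrow> (real \<Rightarrow> real) \<Rightarrow> (real \<Rightarrow> real) \<Rightarrow> real \<Rightarrow> real" where
  "stress2 d h r s = r s / s + deriv r s * (r s / s) ^ (d - 2) * deriv h (spec_vol d r s)"

text \<open>The last three conjuncts are the equation of motion in the fan, the Rankine-Hugoniot condition
  at the shock, and the vanishing of the Cauchy stress at the cavity surface.\<close>

definition cavitating_profile ::
    "nat \<Rightarrow> (real \<Rightarrow> real) \<Rightarrow> real \<Rightarrow> real \<Rightarrow> (real \<Rightarrow> real) \<Rightarrow> bool" where
  "cavitating_profile d h lam \<sigma> r \<longleftrightarrow>
     0 < \<sigma> \<and> continuous_on {0..} r \<and> (\<forall>s\<ge>0. 0 < r s) \<and>
     (\<forall>s\<ge>\<sigma>. r s = lam * s) \<and>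
     r differentiable_on {0<..<\<sigma>} \<and> deriv r differentiable_on {0<..<\<sigma>} \<and>
     continuous_on {0<..<\<sigma>} (deriv (deriv r)) \<and>
     (\<exists>a. (deriv r \<longlongrightarrow> a) (at_left \<sigma>)) \<and>
     (\<forall>s\<in>{0<..<\<sigma>}. s\<^sup>2 * deriv (deriv r) s =
        deriv (stress1 d h r) s + real (d - 1) / s * (stress1 d h r s - stress2 d h r s)) \<and>
     \<sigma>\<^sup>2 * (lam - Lim (at_left \<sigma>) (deriv r)) =
       lam + lam ^ (d - 1) * deriv h (lam ^ d) - Lim (at_left \<sigma>) (stress1 d h r) \<and>
     (spec_vol d r \<longlongrightarrow> h_min h) (at_right 0)"

text \<open>The properties of the solution of Pericak-Spector and Spector that are taken as known.\<close>

definition known_properties ::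
    "nat \<Rightarrow> (real \<Rightarrow> real) \<Rightarrow> real \<Rightarrow> real \<Rightarrow> (real \<Rightarrow> real) \<Rightarrow> bool" where
  "known_properties d h lam \<sigma> r \<longleftrightarrow>
     (\<forall>s\<in>{0<..<\<sigma>}. h_min h \<le> spec_vol d r s \<and> spec_vol d r s \<le> lam ^ d) \<and>
     (\<forall>s\<in>{0<..<\<sigma>}. 0 \<le> deriv r s \<and> deriv r s < Lim (at_left \<sigma>) (deriv r)) \<and>
     strict_mono_on {0<..<\<sigma>} (deriv r) \<and> Lim (at_left \<sigma>) (deriv r) < lam \<and>
     strict_mono_on {0<..<\<sigma>} (spec_vol d r) \<and>
     (\<forall>s\<in>{0<..<\<sigma>}. r s > lam * s \<and> lam * s > s * deriv r s)"

text \<open>The radial motion with amplitude \<open>w\<close>; note that \<open>sgn x\<close> is \<open>x / norm x\<close>, and \<open>0\<close> at the origin.\<close>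

definition radial_motion :: "(real \<Rightarrow> real \<Rightarrow> real) \<Rightarrow> real^'d \<Rightarrow> real \<Rightarrow> real^'d" where
  "radial_motion w x t = w (norm x) t *\<^sub>R sgn x"

definition cavitating_motion :: "real \<Rightarrow> (real \<Rightarrow> real) \<Rightarrow> real^'d \<Rightarrow> real \<Rightarrow> real^'d" where
  "cavitating_motion lam r = radial_motion (\<lambda>R t. if 0 < t then t * r (R / t) else lam * R)"

section \<open>Averaging and energy\<close>

definition averaging_kernel :: "(real \<Rightarrow> real) \<Rightarrow> bool" where
  "averaging_kernel \<phi> \<longleftrightarrow>
     (\<forall>k x. (deriv ^^ k) \<phi> differentiable (at x)) \<and>
     (\<forall>x. 0 \<le> \<phi> x) \<and> (\<forall>x. \<phi> (- x) = \<phi> x) \<and> (LINT x|lborel. \<phi> x) = 1 \<and>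
     closure {x. \<phi> x \<noteq> 0} \<subseteq> {-1..1} \<and> 0 < \<phi> 0"

text \<open>The amplitude \<open>w\<close> of a radial motion, recovered from the motion. It is unspecified
  for \<open>R = 0\<close>, a null set in the integral below.\<close>

definition amplitude :: "(real^'d \<Rightarrow> real \<Rightarrow> real^'d) \<Rightarrow> real \<Rightarrow> real \<Rightarrow> real" where
  "amplitude y R t = (THE a. \<forall>x. norm x = R \<longrightarrow> y x t = a *\<^sub>R sgn x)"

definition scaled_kernel :: "(real \<Rightarrow> real) \<Rightarrow> nat \<Rightarrow> real \<Rightarrow> real" where
  "scaled_kernel \<phi> n R = real n * \<phi> (real n * R)"

definition averaged_amplitude ::
    "(real \<Rightarrow> real) \<Rightarrow> nat \<Rightarrow> (real \<Rightarrow> real \<Rightarrow> real) \<Rightarrow> real \<Rightarrow> real \<Rightarrow> real" where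
  "averaged_amplitude \<phi> n w R t =
     (LINT \<rho>:{0..}|lborel. (scaled_kernel \<phi> n (R - \<rho>) - scaled_kernel \<phi> n (R + \<rho>)) * w \<rho> t)"

definition averaged_motion ::
    "(real \<Rightarrow> real) \<Rightarrow> nat \<Rightarrow> (real^'d \<Rightarrow> real \<Rightarrow> real^'d) \<Rightarrow> real^'d \<Rightarrow> real \<Rightarrow> real^'d" where
  "averaged_motion \<phi> n y = radial_motion (averaged_amplitude \<phi> n (amplitude y))"

definition energy_density ::
    "(real \<Rightarrow> real) \<Rightarrow> (real^'d \<Rightarrow> real \<Rightarrow> real^'d) \<Rightarrow> real \<Rightarrow> real^'d \<Rightarrow> real" where
  "energy_density h y t x =
     1/2 * (norm (vector_derivative (y x) (at t)))\<^sup>2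
     + stored_energy h (jacobian (\<lambda>z. y z t) (at x))"

definition approx_energy ::
    "(real \<Rightarrow> real) \<Rightarrow> (real \<Rightarrow> real) \<Rightarrow> (real^'d \<Rightarrow> real \<Rightarrow> real^'d) \<Rightarrow> (real^'d) set
     \<Rightarrow> real \<Rightarrow> nat \<Rightarrow> real" where
  "approx_energy h \<phi> y B t n = (LINT x:B|lborel. energy_density h (averaged_motion \<phi> n y) t x)"

definition energy ::
    "(real \<Rightarrow> real) \<Rightarrow> (real \<Rightarrow> real) \<Rightarrow> (real^'d \<Rightarrow> real \<Rightarrow> real^'d) \<Rightarrow> (real^'d) set
     \<Rightarrow> real \<Rightarrow> real" where
  "energy h \<phi> y B t = lim (approx_energy h \<phi> y B t)"

text \<open>Since \<open>lim\<close> and the integral are total, this says that the integrals and the limit in the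
  definition of the energy exist. The averages are indexed by \<open>n \<ge> 1\<close>.\<close>

definition energy_exists ::
    "(real \<Rightarrow> real) \<Rightarrow> (real \<Rightarrow> real) \<Rightarrow> (real^'d \<Rightarrow> real \<Rightarrow> real^'d) \<Rightarrow> (real^'d) set
     \<Rightarrow> real \<Rightarrow> bool" where
  "energy_exists h \<phi> y B t \<longleftrightarrow>
     (\<forall>n\<ge>1. set_integrable lborel B (energy_density h (averaged_motion \<phi> n y) t)) \<and>
     convergent (approx_energy h \<phi> y B t)"

end

theory Submission
  imports Defs
begin

text \<open>
  The averaged energy splits into the energy of the fan and a contribution of the opening cavity. With
  $L=\lim h(v)/v$, the averages stretch the cavity of radius $t\,r(0)$ to a small ball with large volume ratio, at
  cost $L\,\omega\,(t\,r(0))^d$ in the limit, $\omega$ being the volume of the unit ball. By self-similarity the energy in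
  the ball is therefore $\mathrm{const}+\omega\,C\,t^d$, and integrating the conservation law for the energy over the fan
  gives, with the Rankine-Hugoniot condition and $v_\pm$ the specific volumes at the shock,
  \[C=\sigma^d\Big[\frac12(v_+-v_-)(h'(v_+)+h'(v_-))-(h(v_+)-h(v_-))\Big]+L\,r(0)^d.\]
  Convexity bounds the bracket below by $-\frac12(v_+-v_-)h'(v_+)$, whereas $r(0)^d\ge\sigma^d(v_+-v_-)$ and
  $L\ge h'(v_+)>0$; hence $C>0$.
\<close>

section \<open>Stored energy of radial deformations\<close>

text \<open>Dominated convergence fails at the cavity: on the ball of radius 1/n the averages have
  stretches up to order n, so v reaches order n^d and the stored energy keeps a fixed mass there,
  although the integrand tends to the fan density almost everywhere. Writing h(v) = L v + (h(v) - L
  v) isolates this mass. The linear part is a null Lagrangian: its integral depends on boundary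
  values only, and the averaged map, having no hole, counts the cavity volume as well. The remainder
  is o(v) for large v, and the quadratic terms are of order n^2 on a volume of order n^(-d) with d
  \<ge> 3; neither concentrates. But the remainder is controlled only for v bounded away from 0,
  where h blows up. Hence a lower bound on the averaged volume ratio, uniform in n, is needed; it is
  the delicate estimate, since the average of a product is not the product of averages. Subtracting
  the density of the outer state confines all integrands to a neighbourhood of the fan, so that B
  need not be centred at the origin.\<close>

lemma has_derivative_radial:
  fixes x :: "'a::real_inner"
  assumes "x \<noteq> 0" and f: "(f has_real_derivative D) (at (norm x))"
  shows "((\<lambda>z. f (norm z) *\<^sub>R sgn z) has_derivative
    (\<lambda>v. (f (norm x) / norm x) *\<^sub>R v + ((D - f (norm x) / norm x) * (sgn x \<bullet> v)) *\<^sub>R sgn x)) (at x)"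
proof -
  have n: "norm x \<noteq> 0" using assms by simp
  have nd: "(norm has_derivative (\<lambda>v. v \<bullet> sgn x)) (at x)"
    by (rule has_derivative_norm) fact
  have fn: "((\<lambda>z. f (norm z)) has_derivative (\<lambda>v. D * (v \<bullet> sgn x))) (at x)"
    using has_derivative_compose[OF nd f[unfolded has_field_derivative_def]] by simp
  have A: "((\<lambda>z. f (norm z) *\<^sub>R (inverse (norm z) *\<^sub>R z)) has_derivative
     (\<lambda>v. f (norm x) *\<^sub>R (inverse (norm x) *\<^sub>R v + (- (inverse (norm x) * (v \<bullet> sgn x) * inverse (norm x))) *\<^sub>R x)
       + (D * (v \<bullet> sgn x)) *\<^sub>R (inverse (norm x) *\<^sub>R x))) (at x)"
    by (rule has_derivative_eq_rhs, (rule derivative_intros fn nd n)+) simp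
  have B: "f (norm z) *\<^sub>R (inverse (norm z) *\<^sub>R z) = f (norm z) *\<^sub>R sgn z" for z
    by (simp add: sgn_div_norm)
  have C: "f (norm x) *\<^sub>R (inverse (norm x) *\<^sub>R v + (- (inverse (norm x) * (v \<bullet> sgn x) * inverse (norm x))) *\<^sub>R x)
       + (D * (v \<bullet> sgn x)) *\<^sub>R (inverse (norm x) *\<^sub>R x)
     = (f (norm x) / norm x) *\<^sub>R v + ((D - f (norm x) / norm x) * (sgn x \<bullet> v)) *\<^sub>R sgn x" for v
  proof -
    have e: "f (norm x) * (- (inverse (norm x) * (v \<bullet> sgn x) * inverse (norm x))) + (D * (v \<bullet> sgn x)) * inverse (norm x)
      = ((D - f (norm x) / norm x) * (sgn x \<bullet> v)) * inverse (norm x)"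
      using n by (simp add: inner_commute field_simps)
    show ?thesis
      by (simp only: scaleR_add_right scaleR_scaleR sgn_div_norm[of x] e[symmetric, unfolded sgn_div_norm] add.assoc
          scaleR_add_left[symmetric]) (simp add: divide_inverse sgn_div_norm)
  qed
  show ?thesis by (rule has_derivative_eq_rhs[OF A[unfolded B] ext[OF C]])
qed

text \<open>$S+\mu$ is injective, hence $(S+\mu)(S-\mu)x=0$ forces $Sx=\mu x$.\<close>

lemma psd_eigenvector_of_square:
  fixes S :: "real^'d^'d"
  assumes psd: "\<And>x. 0 \<le> x \<bullet> (S *v x)" and "0 < \<mu>" and sq: "S *v (S *v x) = (\<mu>\<^sup>2) *\<^sub>R x"
  shows "S *v x = \<mu> *\<^sub>R x"
proof -
  define y where "y = S *v x - \<mu> *\<^sub>R x"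
  have "S *v y = - \<mu> *\<^sub>R y"
    unfolding y_def by (simp add: matrix_vector_mult_diff_distrib matrix_vector_mult_scaleR sq
        power2_eq_square algebra_simps)
  then have "\<mu> * (y \<bullet> y) \<le> 0" using psd[of y] by simp
  then have "y \<bullet> y \<le> 0" using \<open>0 < \<mu>\<close> by (simp add: mult_le_0_iff)
  then have "y = 0" using inner_gt_zero_iff[of y] by linarith
  then show ?thesis by (simp add: y_def)
qed

text \<open>The shape of every radial gradient: stretch \<open>\<beta>\<close> along the axis
  \<open>n\<close> and \<open>\<alpha>\<close> on its orthogonal complement. Describing the matrix
  by its action on vectors avoids entries and bases.\<close>

locale axial_matrix =
  fixes F :: "real^'d^'d" and n :: "real^'d" and \<alpha> \<beta> :: real
  assumes n: "norm n = 1" and pos: "0 < \<alpha>" "0 < \<beta>"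
    and F: "\<And>v. F *v v = \<alpha> *\<^sub>R v + ((\<beta> - \<alpha>) * (n \<bullet> v)) *\<^sub>R n"
begin

lemma n_inner: "n \<bullet> n = 1"
  using n by (simp add: norm_eq_1)

lemma n_nonzero: "n \<noteq> 0"
  using n by auto

lemma F_axis: "F *v n = \<beta> *\<^sub>R n"
  by (simp add: F n_inner algebra_simps)

lemma F_orth: "n \<bullet> v = 0 \<Longrightarrow> F *v v = \<alpha> *\<^sub>R v"
  by (simp add: F)

lemma F_sym: "transpose F = F"
proof -
  have "x \<bullet> (transpose F *v y) = x \<bullet> (F *v y)" for x y
  proof -
    have "x \<bullet> (transpose F *v y) = y \<bullet> (F *v x)"
      by (simp only: transpose_matrix_vector inner_commute[of x] dot_lmul_matrix)
    then show ?thesis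
      by (simp add: F inner_add_right inner_commute)
  qed
  then have "transpose F *v y = F *v y" for y
    by (metis vector_eq_ldot)
  then show ?thesis
    by (simp add: matrix_eq)
qed

lemma F_psd: "0 \<le> x \<bullet> (F *v x)"
proof -
  have "(n \<bullet> x)\<^sup>2 \<le> x \<bullet> x"
    using Cauchy_Schwarz_ineq[of n x] by (simp add: n_inner)
  then have "\<alpha> * (n \<bullet> x)\<^sup>2 \<le> \<alpha> * (x \<bullet> x)" using pos by simp
  moreover have "0 \<le> \<beta> * (n \<bullet> x)\<^sup>2" using pos by simp
  moreover have "x \<bullet> (F *v x) = \<alpha> * (x \<bullet> x) + (\<beta> - \<alpha>) * (n \<bullet> x)\<^sup>2"
    by (simp add: F inner_add_right inner_commute power2_eq_square)
  ultimately show ?thesis by (simp add: algebra_simps)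
qed

text \<open>Uniqueness needs no spectral theorem: the square of any other root scales the axis by
  \<open>\<beta>\<close> squared and its complement by \<open>\<alpha>\<close> squared, positivity
  passes the square roots to the root itself, and axis and complement span the space.\<close>

lemma psd_sqrt_F: "psd_sqrt (F ** transpose F) = F"
  unfolding psd_sqrt_def
proof (rule the_equality)
  show "transpose F = F \<and> (\<forall>x. 0 \<le> x \<bullet> (F *v x)) \<and> F ** F = F ** transpose F"
    by (simp add: F_sym F_psd)
next
  fix S :: "real^'d^'d"
  assume S: "transpose S = S \<and> (\<forall>x. 0 \<le> x \<bullet> (S *v x)) \<and> S ** S = F ** transpose F"
  have SS: "S *v (S *v v) = F *v (F *v v)" for v
    using S by (simp add: matrix_vector_mul_assoc F_sym)
  have axis: "S *v n = \<beta> *\<^sub>R n"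
    by (rule psd_eigenvector_of_square)
      (use S pos in \<open>auto simp: SS F_axis matrix_vector_mult_scaleR power2_eq_square\<close>)
  have orth: "S *v v = \<alpha> *\<^sub>R v" if "n \<bullet> v = 0" for v
    by (rule psd_eigenvector_of_square)
      (use S pos that in \<open>auto simp: SS F_orth matrix_vector_mult_scaleR power2_eq_square\<close>)
  have "S *v v = F *v v" for v
  proof -
    have "S *v v = S *v ((v - (n \<bullet> v) *\<^sub>R n) + (n \<bullet> v) *\<^sub>R n)" by simp
    also have "\<dots> = \<alpha> *\<^sub>R (v - (n \<bullet> v) *\<^sub>R n) + (n \<bullet> v) *\<^sub>R (\<beta> *\<^sub>R n)"
      by (subst matrix_vector_right_distrib, subst orth)
        (simp_all add: axis matrix_vector_mult_scaleR inner_diff_right n_inner)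
    also have "\<dots> = F *v v" by (simp add: F algebra_simps)
    finally show ?thesis .
  qed
  then show "S = F" by (simp add: matrix_eq)
qed

text \<open>Pairing the eigenvalue equation with \<open>n\<close> gives (\<open>\<beta>\<close> -
  \<open>\<mu>\<close>)(n . x) = 0, and the equation itself makes (\<open>\<mu>\<close> -
  \<open>\<alpha>\<close>) x a multiple of \<open>n\<close>.\<close>

lemma eigenvector_cases:
  assumes "F *v x = \<mu> *\<^sub>R x"
  shows "(\<mu> = \<alpha> \<and> \<mu> = \<beta>) \<or> (\<mu> = \<alpha> \<and> n \<bullet> x = 0) \<or> (\<mu> = \<beta> \<and> x = (n \<bullet> x) *\<^sub>R n) \<or> x = 0"
proof -
  have e: "\<alpha> *\<^sub>R x + ((\<beta> - \<alpha>) * (n \<bullet> x)) *\<^sub>R n = \<mu> *\<^sub>R x" using assms F by simp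
  then have "n \<bullet> (\<alpha> *\<^sub>R x + ((\<beta> - \<alpha>) * (n \<bullet> x)) *\<^sub>R n) = n \<bullet> (\<mu> *\<^sub>R x)" by simp
  then have 1: "(\<beta> - \<mu>) * (n \<bullet> x) = 0" by (simp add: inner_add_right n_inner algebra_simps)
  have 2: "(\<mu> - \<alpha>) *\<^sub>R x = ((\<beta> - \<alpha>) * (n \<bullet> x)) *\<^sub>R n" using e by (simp add: algebra_simps)
  show ?thesis
  proof (cases "n \<bullet> x = 0")
    case True
    then show ?thesis using 2 by auto
  next
    case False
    then have "\<mu> = \<beta>" using 1 by simp
    show ?thesis
    proof (cases "\<mu> = \<alpha>")
      case False
      have "(\<mu> - \<alpha>) *\<^sub>R x = (\<mu> - \<alpha>) *\<^sub>R ((n \<bullet> x) *\<^sub>R n)" using 2 \<open>\<mu> = \<beta>\<close> by simp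
      then have "x = (n \<bullet> x) *\<^sub>R n" using False by (subst (asm) scaleR_cancel_left) simp
      then show ?thesis using \<open>\<mu> = \<beta>\<close> by blast
    qed (use \<open>\<mu> = \<beta>\<close> in simp)
  qed
qed

lemma stored_energy_axial:
  assumes d: "2 \<le> CARD('d)"
  shows "stored_energy h F = 1/2 * (\<beta>\<^sup>2 + real (CARD('d) - 1) * \<alpha>\<^sup>2) + h (\<beta> * \<alpha> ^ (CARD('d) - 1))"
proof -
  have dh: "dim {x. n \<bullet> x = 0} = CARD('d) - 1"
    using dim_hyperplane[OF n_nonzero] by simp
  then have "\<not> {x. n \<bullet> x = 0} \<subseteq> {0}"
    using d by (simp flip: dim_eq_0)
  \<comment> \<open>A nonzero vector orthogonal to the axis is what makes \<open>\<alpha>\<close> an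
    eigenvalue; the hyperplane contains one because the dimension is at least 2.\<close>
  then obtain e where e: "e \<noteq> 0" "n \<bullet> e = 0" by auto
  have cards: "CARD('d) = Suc (CARD('d) - 1)" using d by simp
  show ?thesis
  \<comment> \<open>The eigenvalues form a set, so equal stretches collapse to one eigenvalue whose
    eigenspace is everything; its dimension then supplies the full multiplicity.\<close>
  proof (cases "\<alpha> = \<beta>")
    case True
    have ev: "eigenvalues F = {\<alpha>}"
      unfolding eigenvalues_def using eigenvector_cases F_axis n_nonzero True by (auto simp: F)
    have es: "eigenspace F \<beta> = UNIV"
      unfolding eigenspace_def by (auto simp: F True)
    have "dim (UNIV :: (real^'d) set) = CARD('d)" by (simp add: dim_UNIV)
    then show ?thesis
      unfolding stored_energy_def Let_def psd_sqrt_F ev using True cards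
      by (simp add: es of_nat_diff algebra_simps power_Suc[symmetric] del: power_Suc)
  next
    case False
    have ev: "eigenvalues F = {\<alpha>, \<beta>}"
      unfolding eigenvalues_def using eigenvector_cases F_axis n_nonzero F_orth e by auto
    have ea: "eigenspace F \<alpha> = {x. n \<bullet> x = 0}"
      unfolding eigenspace_def using eigenvector_cases[of _ \<alpha>] F_orth False by fastforce
    have eb: "eigenspace F \<beta> = span {n}"
    proof -
      have "x \<in> span {n}" if ev: "F *v x = \<beta> *\<^sub>R x" for x
      proof -
        consider "x = (n \<bullet> x) *\<^sub>R n" | "x = 0" using eigenvector_cases[OF ev] False by blast
        then show ?thesis unfolding span_singleton by cases (metis rangeI, metis rangeI scaleR_zero_left)
      qed
      moreover have "F *v x = \<beta> *\<^sub>R x" if "x \<in> span {n}" for x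
        using that by (auto simp: span_singleton F_axis matrix_vector_mult_scaleR)
      ultimately show ?thesis unfolding eigenspace_def by blast
    qed
    have "dim (span {n}) = 1" using n_nonzero by simp
    then show ?thesis
      unfolding stored_energy_def Let_def psd_sqrt_F ev using False
      by (simp add: ea eb dh algebra_simps)
  qed
qed

end

lemma stored_energy_radial:
  fixes x :: "real^'d"
  assumes "2 \<le> CARD('d)" "x \<noteq> 0" "(f has_real_derivative D) (at (norm x))" "0 < D" "0 < f (norm x)"
  shows "stored_energy h (jacobian (\<lambda>z. f (norm z) *\<^sub>R sgn z) (at x)) =
    1/2 * (D\<^sup>2 + real (CARD('d) - 1) * (f (norm x) / norm x)\<^sup>2) + h (D * (f (norm x) / norm x) ^ (CARD('d) - 1))"
proof -
  note der = has_derivative_radial[OF assms(2,3)]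
  interpret axial_matrix "jacobian (\<lambda>z. f (norm z) *\<^sub>R sgn z) (at x)" "sgn x" "f (norm x) / norm x" D
  proof
    show "norm (sgn x) = 1" using assms by (simp add: norm_sgn)
    show "jacobian (\<lambda>z. f (norm z) *\<^sub>R sgn z) (at x) *v v =
       (f (norm x) / norm x) *\<^sub>R v + ((D - f (norm x) / norm x) * (sgn x \<bullet> v)) *\<^sub>R sgn x" for v
      using has_derivative_unique[OF der jacobian_works[THEN iffD1, OF differentiableI[OF der]]]
      by (rule fun_cong[symmetric])
  qed (use assms in auto)
  show ?thesis by (rule stored_energy_axial) fact
qed

section \<open>Polar coordinates for radial integrands\<close>

text \<open>Cutting off at radius \<open>K\<close> makes both measures finite on half lines, so they
  are determined by their values on \<open>{x<..}\<close>. There one has the volume of a spherical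
  shell, the other the integral of the derivative of the ball volume.\<close>

lemma polar_measure:
  assumes "0 \<le> K"
  shows "distr (density lborel (indicator (cball 0 K))) borel (norm :: 'a::euclidean_space \<Rightarrow> real) =
    density lborel (\<lambda>R. ennreal (indicator {0..K} R * (DIM('a) * unit_ball_vol DIM('a) * R ^ (DIM('a) - 1))))"
    (is "?M = ?N")
proof (rule measure_eqI_lessThan)
  let ?V = "unit_ball_vol DIM('a)" and ?d = "DIM('a)"
  have d: "?d > 0" by simp
  have cball_meas[measurable]: "cball (0::'a) K \<in> sets borel" by simp
  show "sets ?M = sets borel" "sets ?N = sets borel" by auto
  have M: "emeasure ?M {x<..} = ennreal (if x < K then ?V * (K ^ ?d - (max 0 x) ^ ?d) else 0)" for x
  proof -
    have "emeasure ?M {x<..} = emeasure (density lborel (indicator (cball 0 K))) {z::'a. x < norm z}"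
      by (subst emeasure_distr) (auto intro!: arg_cong2[where f=emeasure] borel_measurable_indicator)
    also have "\<dots> = emeasure lborel (cball 0 K \<inter> {z::'a. x < norm z})"
      by (subst emeasure_density) (auto simp: indicator_inter_arith[symmetric] borel_measurable_indicator simp flip: nn_integral_indicator)
    also have "\<dots> = ennreal (if x < K then ?V * (K ^ ?d - (max 0 x) ^ ?d) else 0)"
    proof (cases "x < K")
      case False
      then have "cball 0 K \<inter> {z::'a. x < norm z} = {}" by auto
      then show ?thesis using False by simp
    next
      case True
      show ?thesis
      proof (cases "x < 0")
        case True
        then have "x < norm z" for z :: 'a by (meson less_le_trans norm_ge_zero)
        then have "cball 0 K \<inter> {z::'a. x < norm z} = cball 0 K" by auto
        then show ?thesis using True \<open>x < K\<close> assms d by (simp add: emeasure_cball max_def)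
      next
        case False
        have "cball 0 K \<inter> {z::'a. x < norm z} = cball 0 K - cball 0 x" by auto
        moreover have "emeasure lborel (cball (0::'a) K - cball 0 x) = emeasure lborel (cball (0::'a) K) - emeasure lborel (cball (0::'a) x)"
          using True False assms by (intro emeasure_Diff) (auto simp: emeasure_cball)
        ultimately show ?thesis using False True assms
          by (simp add: emeasure_cball ennreal_minus algebra_simps max_def)
      qed
    qed
    finally show ?thesis .
  qed
  show "emeasure ?M {x<..} < \<infinity>" for x by (simp add: M)
  show "emeasure ?M {x<..} = emeasure ?N {x<..}" for x
  proof -
    have "emeasure ?N {x<..} = (\<integral>\<^sup>+ R. ennreal (indicator {0..K} R * (?d * ?V * R ^ (?d - 1))) * indicator {x<..} R \<partial>lborel)"
      by (subst emeasure_density) auto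
    also have "\<dots> = (\<integral>\<^sup>+ R. ennreal (?d * ?V * R ^ (?d - 1)) * indicator {max 0 x..K} R \<partial>lborel)"
    proof (rule nn_integral_cong_AE, rule AE_mp[OF AE_lborel_singleton[of x] AE_I2], rule impI)
      fix R assume "R \<noteq> x"
      then show "ennreal (indicator {0..K} R * (?d * ?V * R ^ (?d - 1))) * indicator {x<..} R =
          ennreal (?d * ?V * R ^ (?d - 1)) * indicator {max 0 x..K} R"
        by (cases "0 \<le> R \<and> R \<le> K \<and> x < R") (auto simp: indicator_def)
    qed
    also have "\<dots> = ennreal (if x < K then ?V * (K ^ ?d - (max 0 x) ^ ?d) else 0)"
    proof (cases "x < K")
      case False
      have "(\<integral>\<^sup>+ R. ennreal (?d * ?V * R ^ (?d - 1)) * indicator {max 0 x..K} R \<partial>lborel) = (\<integral>\<^sup>+ R. 0 \<partial>(lborel::real measure))"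
      proof (rule nn_integral_cong_AE, rule AE_mp[OF AE_lborel_singleton[of K] AE_I2], rule impI)
        fix R assume "R \<noteq> K"
        then have "R \<notin> {max 0 x..K}" using False by auto
        then show "ennreal (?d * ?V * R ^ (?d - 1)) * indicator {max 0 x..K} R = 0" by simp
      qed
      then show ?thesis using False by simp
    next
      case True
      have "(\<integral>\<^sup>+ R. ennreal (?d * ?V * R ^ (?d - 1)) * indicator {max 0 x..K} R \<partial>lborel) = ennreal (?V * K ^ ?d - ?V * (max 0 x) ^ ?d)"
      proof (rule nn_integral_FTC_Icc)
        show "((\<lambda>R. ?V * R ^ ?d) has_real_derivative real ?d * ?V * R ^ (?d - 1)) (at R)" for R
          by (rule derivative_eq_intros refl)+ simp
        show "0 \<le> real ?d * ?V * R ^ (?d - 1)" if "R \<in> {max 0 x..K}" for R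
          using that by simp
      qed (use True assms in auto)
      then show ?thesis using True by (simp add: algebra_simps)
    qed
    finally show ?thesis by (simp add: M)
  qed
qed

lemma integral_polar:
  fixes f :: "real \<Rightarrow> real"
  assumes [measurable]: "f \<in> borel_measurable borel" and "0 \<le> K"
  shows "(LINT x:cball (0::'a::euclidean_space) K|lborel. f (norm x)) =
    DIM('a) * unit_ball_vol DIM('a) * (LINT R:{0..K}|lborel. R ^ (DIM('a) - 1) * f R)"
proof -
  have "(LINT x:cball (0::'a) K|lborel. f (norm x)) = integral\<^sup>L (density lborel (indicator (cball (0::'a) K))) (\<lambda>x. f (norm x))"
    unfolding set_lebesgue_integral_def
    by (subst integral_density[symmetric]) (auto simp: ennreal_indicator intro!: borel_measurable_indicator)
  also have "\<dots> = integral\<^sup>L (distr (density lborel (indicator (cball 0 K))) borel (norm :: 'a \<Rightarrow> real)) f"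
    by (rule integral_distr[symmetric]) auto
  also have "\<dots> = (LINT R|lborel. (indicator {0..K} R * (DIM('a) * unit_ball_vol DIM('a) * R ^ (DIM('a) - 1))) *\<^sub>R f R)"
    unfolding polar_measure[OF assms(2)] 
    by (rule integral_density) (auto simp: indicator_def)
  also have "\<dots> = (LINT R|lborel. (DIM('a) * unit_ball_vol DIM('a)) * (indicator {0..K} R *\<^sub>R (R ^ (DIM('a) - 1) * f R)))"
    by (simp add: mult_ac)
  finally show ?thesis
    unfolding set_lebesgue_integral_def by simp
qed

section \<open>Averaging kernels\<close>

text \<open>The Lipschitz bound dominates the difference quotients by a multiple of |k|, so the
  integrand has to be differentiable only at the one point x and only for almost every u. This
  tolerates the kink of the motion at the shock.\<close>

lemma leibniz_lipschitz:
  fixes k :: "'a \<Rightarrow> real" and f :: "real \<Rightarrow> 'a \<Rightarrow> real"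
  assumes S: "open S" "x \<in> S"
    and int: "\<And>y. y \<in> S \<Longrightarrow> integrable M (\<lambda>u. k u * f y u)"
    and k: "integrable M k"
    and lip: "\<And>y u. y \<in> S \<Longrightarrow> \<bar>f y u - f x u\<bar> \<le> C * \<bar>y - x\<bar>"
    and der: "AE u in M. ((\<lambda>y. f y u) has_real_derivative f' u) (at x)"
    and meas[measurable]: "f' \<in> borel_measurable M"
  shows "((\<lambda>y. LINT u|M. k u * f y u) has_real_derivative (LINT u|M. k u * f' u)) (at x)"
  unfolding has_field_derivative_iff tendsto_at_iff_sequentially o_def
proof (intro allI impI)
  fix X :: "nat \<Rightarrow> real"
  assume X: "\<forall>i. X i \<in> UNIV - {x}" "X \<longlonglongrightarrow> x"
  have "\<forall>\<^sub>F i in sequentially. X i \<in> S"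
    using X(2) S by (simp add: tendsto_def)
  then obtain N where N: "\<And>i. N \<le> i \<Longrightarrow> X i \<in> S"
    by (auto simp: eventually_sequentially)
  define Y where "Y i = X (i + N)" for i
  have Y: "Y i \<in> S" "Y i \<noteq> x" for i using N X(1) by (auto simp: Y_def)
  have Yl: "Y \<longlonglongrightarrow> x" unfolding Y_def using X(2) by (rule LIMSEQ_ignore_initial_segment)
  have eq: "((LINT u|M. k u * f (Y i) u) - (LINT u|M. k u * f x u)) / (Y i - x) =
     (LINT u|M. k u * f (Y i) u / (Y i - x) - k u * f x u / (Y i - x))" for i
    using int[OF Y(1)] int[OF S(2)] by (simp add: diff_divide_distrib)
  have "(\<lambda>i. LINT u|M. k u * f (Y i) u / (Y i - x) - k u * f x u / (Y i - x)) \<longlonglongrightarrow> (LINT u|M. k u * f' u)"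
  proof (rule integral_dominated_convergence[where w="\<lambda>u. C * \<bar>k u\<bar>"])
    show "(\<lambda>u. k u * f' u) \<in> borel_measurable M" using k by measurable
    show "(\<lambda>u. k u * f (Y i) u / (Y i - x) - k u * f x u / (Y i - x)) \<in> borel_measurable M" for i
      using int[OF Y(1), of i] int[OF S(2)] by measurable
    show "integrable M (\<lambda>u. C * \<bar>k u\<bar>)" using k by simp
    show "AE u in M. (\<lambda>i. k u * f (Y i) u / (Y i - x) - k u * f x u / (Y i - x)) \<longlonglongrightarrow> k u * f' u"
      using der
    proof eventually_elim
      case (elim u)
      have "(\<lambda>i. (f (Y i) u - f x u) / (Y i - x)) \<longlonglongrightarrow> f' u"
        using elim Y Yl unfolding has_field_derivative_iff tendsto_at_iff_sequentially o_def by auto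
      then have "(\<lambda>i. k u * ((f (Y i) u - f x u) / (Y i - x))) \<longlonglongrightarrow> k u * f' u"
        by (intro tendsto_intros)
      then show ?case by (simp add: diff_divide_distrib algebra_simps)
    qed
    show "AE u in M. norm (k u * f (Y i) u / (Y i - x) - k u * f x u / (Y i - x)) \<le> C * \<bar>k u\<bar>" for i
    proof (rule AE_I2)
      fix u
      have "\<bar>f (Y i) u - f x u\<bar> / \<bar>Y i - x\<bar> \<le> C"
        using lip[OF Y(1), of i u] Y(2)[of i] by (simp add: field_simps)
      then have "\<bar>k u\<bar> * (\<bar>f (Y i) u - f x u\<bar> / \<bar>Y i - x\<bar>) \<le> \<bar>k u\<bar> * C"
        by (rule mult_left_mono) simp
      moreover have "k u * f (Y i) u / (Y i - x) - k u * f x u / (Y i - x) = k u * ((f (Y i) u - f x u) / (Y i - x))"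
        by (simp add: diff_divide_distrib algebra_simps)
      ultimately show "norm (k u * f (Y i) u / (Y i - x) - k u * f x u / (Y i - x)) \<le> C * \<bar>k u\<bar>"
        by (simp add: abs_mult mult.commute)
    qed
  qed
  then have "(\<lambda>i. ((LINT u|M. k u * f (Y i) u) - (LINT u|M. k u * f x u)) / (Y i - x)) \<longlonglongrightarrow> (LINT u|M. k u * f' u)"
    by (simp add: eq)
  then show "(\<lambda>i. ((LINT u|M. k u * f (X i) u) - (LINT u|M. k u * f x u)) / (X i - x)) \<longlonglongrightarrow> (LINT u|M. k u * f' u)"
    unfolding Y_def by (rule LIMSEQ_offset)
qed

section \<open>Integrals against the kernel\<close>

locale mollifier =
  fixes \<phi> :: "real \<Rightarrow> real"
  assumes kernel: "averaging_kernel \<phi>"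
begin

lemma isCont_kernel: "isCont \<phi> u"
proof -
  have "(deriv ^^ 0) \<phi> differentiable (at u)"
    using kernel unfolding averaging_kernel_def by blast
  then show ?thesis by (simp add: differentiable_imp_continuous_within)
qed

lemma measurable_kernel[measurable]: "\<phi> \<in> borel_measurable borel"
  by (intro borel_measurable_continuous_onI continuous_at_imp_continuous_on ballI isCont_kernel)

lemma kernel_nonneg[simp]: "0 \<le> \<phi> u"
  by (rule kernel[unfolded averaging_kernel_def, THEN conjunct2, THEN conjunct1, rule_format])

lemma kernel_minus[simp]: "\<phi> (- u) = \<phi> u"
  by (rule kernel[unfolded averaging_kernel_def, THEN conjunct2, THEN conjunct2, THEN conjunct1, rule_format])

lemma integral_kernel: "(LINT u|lborel. \<phi> u) = 1"
  by (rule kernel[unfolded averaging_kernel_def, THEN conjunct2, THEN conjunct2, THEN conjunct2, THEN conjunct1])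

lemma integrable_kernel: "integrable lborel \<phi>"
  using integral_kernel not_integrable_integral_eq[of lborel \<phi>] by (cases "integrable lborel \<phi>") auto

lemma kernel_zero: "1 < \<bar>u\<bar> \<Longrightarrow> \<phi> u = 0"
proof (rule ccontr)
  assume u: "1 < \<bar>u\<bar>" "\<phi> u \<noteq> 0"
  have "u \<in> closure {x. \<phi> x \<noteq> 0}" by (rule subsetD[OF closure_subset]) (simp add: u)
  moreover have "closure {x. \<phi> x \<noteq> 0} \<subseteq> {-1..1}" by (rule kernel[unfolded averaging_kernel_def, THEN conjunct2, THEN conjunct2, THEN conjunct2, THEN conjunct2, THEN conjunct1])
  ultimately have "u \<in> {-1..1}" by (rule subsetD[rotated])
  then show False using u by auto
qed

lemma kernel_pos: "0 < \<phi> 0"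
  by (rule kernel[unfolded averaging_kernel_def, THEN conjunct2, THEN conjunct2, THEN conjunct2, THEN conjunct2, THEN conjunct2])

lemma kernel_bounded: obtains M where "0 < M" "\<And>u. \<phi> u \<le> M"
proof -
  have "compact (\<phi> ` {-1..1})"
    by (intro compact_continuous_image continuous_at_imp_continuous_on ballI isCont_kernel compact_Icc)
  then obtain M where M: "\<forall>y\<in>\<phi> ` {-1..1}. norm y \<le> M"
    using compact_imp_bounded bounded_iff by metis
  show ?thesis
  proof
    show "0 < \<bar>M\<bar> + 1" by simp
    show "\<phi> u \<le> \<bar>M\<bar> + 1" for u
    proof (cases "\<bar>u\<bar> \<le> 1")
      case True
      then have "norm (\<phi> u) \<le> M" using M by (auto simp: abs_le_iff)
      then show ?thesis by simp
    qed (simp add: kernel_zero)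
  qed
qed

lemma integrable_kernel_times:
  assumes [measurable]: "f \<in> borel_measurable borel" and C: "\<And>u. \<bar>u\<bar> \<le> 1 \<Longrightarrow> \<bar>f u\<bar> \<le> C"
  shows "integrable lborel (\<lambda>u. \<phi> u * f u)"
proof (rule Bochner_Integration.integrable_bound)
  show "integrable lborel (\<lambda>u. C * \<phi> u)" using integrable_kernel by simp
  show "AE u in lborel. norm (\<phi> u * f u) \<le> norm (C * \<phi> u)"
  proof (rule AE_I2)
    fix u
    show "norm (\<phi> u * f u) \<le> norm (C * \<phi> u)"
    proof (cases "\<bar>u\<bar> \<le> 1")
      case True
      then have "\<phi> u * \<bar>f u\<bar> \<le> \<phi> u * C" using C by (intro mult_left_mono) auto
      moreover have "0 \<le> C" using C[OF True] by linarith
      ultimately show ?thesis by (simp add: abs_mult mult.commute)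
    qed (simp add: kernel_zero)
  qed
qed measurable

lemma kernel_integral_le:
  assumes [measurable]: "f \<in> borel_measurable borel" "g \<in> borel_measurable borel"
    and C: "\<And>u. \<bar>u\<bar> \<le> 1 \<Longrightarrow> \<bar>f u\<bar> \<le> C" "\<And>u. \<bar>u\<bar> \<le> 1 \<Longrightarrow> \<bar>g u\<bar> \<le> D"
    and le: "\<And>u. \<bar>u\<bar> \<le> 1 \<Longrightarrow> f u \<le> g u"
  shows "(LINT u|lborel. \<phi> u * f u) \<le> (LINT u|lborel. \<phi> u * g u)"
proof (rule integral_mono)
  show "\<phi> u * f u \<le> \<phi> u * g u" for u
    by (cases "\<bar>u\<bar> \<le> 1") (auto intro: mult_left_mono le simp: kernel_zero)
qed (auto intro!: integrable_kernel_times C)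

lemma kernel_integral_cong:
  assumes "\<And>u. \<bar>u\<bar> \<le> 1 \<Longrightarrow> f u = g u"
  shows "(LINT u|lborel. \<phi> u * f u) = (LINT u|lborel. \<phi> u * g u)"
proof (rule Bochner_Integration.integral_cong)
  show "\<phi> u * f u = \<phi> u * g u" for u
    by (cases "\<bar>u\<bar> \<le> 1") (auto simp: assms kernel_zero)
qed simp

lemma kernel_integral_const: "(LINT u|lborel. \<phi> u * c) = c"
  using integral_kernel by simp

lemma kernel_integral_bounds:
  assumes f: "f \<in> borel_measurable borel"
    and C: "\<And>u. \<bar>u\<bar> \<le> 1 \<Longrightarrow> a \<le> f u" "\<And>u. \<bar>u\<bar> \<le> 1 \<Longrightarrow> f u \<le> b"
  shows "a \<le> (LINT u|lborel. \<phi> u * f u)" "(LINT u|lborel. \<phi> u * f u) \<le> b"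
proof -
  have b: "\<bar>f u\<bar> \<le> max \<bar>a\<bar> \<bar>b\<bar>" if "\<bar>u\<bar> \<le> 1" for u using C[OF that] by linarith
  show "a \<le> (LINT u|lborel. \<phi> u * f u)"
    using kernel_integral_le[of "\<lambda>_. a" f "\<bar>a\<bar>", OF _ f _ b C(1)] by (simp add: integral_kernel)
  show "(LINT u|lborel. \<phi> u * f u) \<le> b"
    using kernel_integral_le[of f "\<lambda>_. b" _ "\<bar>b\<bar>", OF f _ b _ C(2)] by (simp add: integral_kernel)
qed

lemma kernel_integral_odd:
  assumes "\<And>u. f (- u) = - f u"
  shows "(LINT u|lborel. \<phi> u * f u) = 0"
proof -
  have "(LINT u|lborel. \<phi> u * f u) = (LINT u|lborel. \<phi> (0 + (-1) * u) * f (0 + (-1) * u))"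
    by (subst lborel_integral_real_affine[of "-1" _ 0]) auto
  then show ?thesis by (simp add: assms)
qed

lemma kernel_integral_tendsto:
  assumes [measurable]: "\<And>n. f n \<in> borel_measurable borel"
    and C: "\<And>n u. 1 \<le> n \<Longrightarrow> \<bar>u\<bar> \<le> 1 \<Longrightarrow> \<bar>f n u\<bar> \<le> C"
    and lim: "\<And>u. (\<lambda>n. f n u) \<longlonglongrightarrow> c"
  shows "(\<lambda>n::nat. LINT u|lborel. \<phi> u * f n u) \<longlonglongrightarrow> c"
proof -
  \<comment> \<open>The bound \<open>C\<close> is available from index 1 on only, hence the detour
    through \<open>Suc n\<close>.\<close>
  have "(\<lambda>n. LINT u|lborel. \<phi> u * f (Suc n) u) \<longlonglongrightarrow> (LINT u|lborel. \<phi> u * c)"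
  proof (rule integral_dominated_convergence)
    show "integrable lborel (\<lambda>u. C * \<phi> u)" using integrable_kernel by simp
    show "AE u in lborel. (\<lambda>n. \<phi> u * f (Suc n) u) \<longlonglongrightarrow> \<phi> u * c"
      by (intro AE_I2 tendsto_intros LIMSEQ_Suc[OF lim])
    show "AE u in lborel. norm (\<phi> u * f (Suc n) u) \<le> C * \<phi> u" for n
    proof (rule AE_I2)
      fix u
      show "norm (\<phi> u * f (Suc n) u) \<le> C * \<phi> u"
      proof (cases "\<bar>u\<bar> \<le> 1")
        case True
        then have "\<phi> u * \<bar>f (Suc n) u\<bar> \<le> \<phi> u * C" using C by (intro mult_left_mono) auto
        then show ?thesis by (simp add: abs_mult mult.commute)
      qed (simp add: kernel_zero)
    qed
  qed measurable
  then show ?thesis unfolding kernel_integral_const by (rule LIMSEQ_imp_Suc)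
qed

text \<open>Two quantities for lower bounds uniform in the scale: a core on which the kernel is at
  least half its central value, and the mass \<open>m\<close> of the kernel on u \<le>
  -\<open>\<delta>\<close>. In an average over R - u/N this mass looks outward by at least
  \<open>\<delta>\<close>/N, which is what increasing functions require. It is positive because
  [-2\<open>\<delta>\<close>, -\<open>\<delta>\<close>] lies in the core.\<close>

lemma kernel_mass:
  obtains \<delta> m where "0 < \<delta>" "\<delta> \<le> 1/2" "\<And>u. \<bar>u\<bar> \<le> 2 * \<delta> \<Longrightarrow> \<phi> 0 / 2 \<le> \<phi> u"
    "0 < m" "m \<le> 1" "m = (LINT u|lborel. \<phi> u * indicator {..-\<delta>} u)"
proof -
  obtain e where e: "0 < e" "\<And>u. \<bar>u\<bar> < e \<Longrightarrow> \<bar>\<phi> u - \<phi> 0\<bar> < \<phi> 0 / 2"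
    using isCont_kernel[of 0] kernel_pos unfolding continuous_at_eps_delta
    by (metis diff_zero dist_real_def half_gt_zero)
  define \<delta> where "\<delta> = min (1/2) (e / 4)"
  have d: "0 < \<delta>" "\<delta> \<le> 1/2" "2 * \<delta> < e" using e(1) by (auto simp: \<delta>_def min_def)
  have low: "\<phi> 0 / 2 \<le> \<phi> u" if "\<bar>u\<bar> \<le> 2 * \<delta>" for u
    using e(2)[of u] that d by linarith
  let ?m = "LINT u|lborel. \<phi> u * indicator {..-\<delta>} u"
  have "(LINT u|lborel. \<phi> 0 / 2 * indicator {-2*\<delta>..-\<delta>} u) \<le> ?m"
  proof (rule integral_mono)
    show "integrable lborel (\<lambda>u. \<phi> 0 / 2 * indicator {-2*\<delta>..-\<delta>} u)"
      by (intro integrable_mult_right integrable_real_indicator) (auto simp: emeasure_lborel_Icc_eq)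
    show "integrable lborel (\<lambda>u. \<phi> u * indicator {..-\<delta>} u)"
      by (rule integrable_kernel_times[where C=1]) (auto simp: indicator_def)
    show "\<phi> 0 / 2 * indicator {-2*\<delta>..-\<delta>} u \<le> \<phi> u * indicator {..-\<delta>} u" for u :: real
      using low[of u] d by (auto simp: indicator_def)
  qed
  moreover have "(LINT u|lborel. \<phi> 0 / 2 * indicator {-2*\<delta>..-\<delta>} u) = \<phi> 0 / 2 * \<delta>"
    using d by simp
  moreover have "0 < \<phi> 0 / 2 * \<delta>" using d kernel_pos by simp
  ultimately have "0 < ?m" by linarith
  moreover have "?m \<le> 1"
    by (rule kernel_integral_bounds(2)[where a=0]) (auto simp: indicator_def)
  ultimately show ?thesis by (intro that[OF d(1,2) low _ _ refl])
qed

lemma kernel_integral_mass_bound: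
  assumes f[measurable]: "f \<in> borel_measurable borel"
    and C: "\<And>u. \<bar>u\<bar> \<le> 1 \<Longrightarrow> f u \<le> C" and nn: "\<And>u. \<bar>u\<bar> \<le> 1 \<Longrightarrow> 0 \<le> f u"
    and low: "\<And>u. \<bar>u\<bar> \<le> 1 \<Longrightarrow> u \<le> -\<delta> \<Longrightarrow> y \<le> f u"
  shows "(LINT u|lborel. \<phi> u * indicator {..-\<delta>} u) * y \<le> (LINT u|lborel. \<phi> u * f u)"
proof -
  have "(LINT u|lborel. \<phi> u * (indicator {..-\<delta>} u * y)) \<le> (LINT u|lborel. \<phi> u * f u)"
  proof (rule kernel_integral_le)
    fix u :: real assume u: "\<bar>u\<bar> \<le> 1"
    show "\<bar>indicator {..-\<delta>} u * y\<bar> \<le> \<bar>y\<bar>" by (simp add: indicator_def)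
    show "\<bar>f u\<bar> \<le> C" using C[OF u] nn[OF u] by simp
    show "indicator {..-\<delta>} u * y \<le> f u"
      using low[OF u] nn[OF u] by (cases "u \<le> -\<delta>") auto
  qed measurable
  moreover have "(LINT u|lborel. \<phi> u * (indicator {..-\<delta>} u * y)) = (LINT u|lborel. (\<phi> u * indicator {..-\<delta>} u) * y)"
    by (simp add: mult.assoc)
  ultimately show ?thesis by (simp only: integral_mult_left_zero)
qed

text \<open>The averaged sign is twice the distribution function of the kernel minus one, and the
  kernel is continuous.\<close>

lemma kernel_integral_sgn_has_derivative:
  "((\<lambda>x. LINT u|lborel. \<phi> u * sgn (x - u)) has_real_derivative 2 * \<phi> x) (at x)"
proof -
  \<comment> \<open>Large enough that [-b, b] contains the support of the kernel and has x in its
    interior.\<close>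
  define b where "b = \<bar>x\<bar> + 2"
  have ci: "continuous_on {-b..b} \<phi>"
    by (intro continuous_at_imp_continuous_on ballI isCont_kernel)
  have "((\<lambda>y. integral {-b..y} \<phi>) has_real_derivative \<phi> x) (at x within {-b..b})"
    by (rule integral_has_real_derivative[OF ci]) (auto simp: b_def)
  moreover have "at x within {-b..b} = at x"
    by (rule at_within_Icc_at) (auto simp: b_def)
  ultimately have 1: "((\<lambda>y. 2 * integral {-b..y} \<phi> - 1) has_real_derivative 2 * \<phi> x) (at x)"
    by (auto intro!: derivative_eq_intros)
  have eq: "(LINT u|lborel. \<phi> u * sgn (y - u)) = 2 * integral {-b..y} \<phi> - 1" if "y \<in> {-b<..<b}" for y
  proof -
    have si: "set_integrable lborel {-b..y} \<phi>"
      unfolding set_integrable_def using integrable_kernel by (intro integrable_mult_indicator) auto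
    have "(LINT u|lborel. \<phi> u * sgn (y - u)) = (LINT u|lborel. 2 * (indicator {-b..y} u *\<^sub>R \<phi> u) - \<phi> u)"
    proof (rule integral_cong_AE)
      show "AE u in lborel. \<phi> u * sgn (y - u) = 2 * (indicator {-b..y} u *\<^sub>R \<phi> u) - \<phi> u"
      proof (rule AE_mp[OF AE_lborel_singleton[of y] AE_I2], rule impI)
        fix u assume "u \<noteq> y"
        then show "\<phi> u * sgn (y - u) = 2 * (indicator {-b..y} u *\<^sub>R \<phi> u) - \<phi> u"
          using that kernel_zero[of u] by (auto simp: indicator_def b_def sgn_real_def)
      qed
    qed measurable
    also have "\<dots> = 2 * (LINT u:{-b..y}|lborel. \<phi> u) - 1"
      using si integrable_kernel integral_kernel
      by (simp add: set_integrable_def set_lebesgue_integral_def)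
    also have "(LINT u:{-b..y}|lborel. \<phi> u) = integral {-b..y} \<phi>"
      by (rule set_borel_integral_eq_integral(2)[OF si])
    finally show ?thesis .
  qed
  have o: "open {-b<..<b}" "x \<in> {-b<..<b}" by (auto simp: b_def)
  show ?thesis
    by (rule has_field_derivative_transform_within_open[OF 1 o]) (simp add: eq)
qed

text \<open>Convolution with the scaled kernel after the substitution u = N (R - x). The weight no
  longer depends on the scale, so one fixed integrable function dominates for all N.\<close>

definition avg :: "real \<Rightarrow> (real \<Rightarrow> real) \<Rightarrow> real \<Rightarrow> real" where
  "avg N f R = (LINT u|lborel. \<phi> u * f (R - u / N))"

lemma measurable_avg:
  assumes [measurable]: "f \<in> borel_measurable borel"
  shows "avg N f \<in> borel_measurable borel"
  unfolding avg_def by measurable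

lemma avg_bounds:
  assumes "0 < N" and [measurable]: "f \<in> borel_measurable borel"
    and C: "\<And>x. \<bar>R - x\<bar> \<le> 1 / N \<Longrightarrow> a \<le> f x" "\<And>x. \<bar>R - x\<bar> \<le> 1 / N \<Longrightarrow> f x \<le> b"
  shows "a \<le> avg N f R" "avg N f R \<le> b"
proof -
  have b: "\<bar>R - (R - u / N)\<bar> \<le> 1 / N" if "\<bar>u\<bar> \<le> 1" for u
    using that \<open>0 < N\<close> by (simp add: field_simps)
  have m: "(\<lambda>u. f (R - u / N)) \<in> borel_measurable borel" by measurable
  show "a \<le> avg N f R" "avg N f R \<le> b"
    unfolding avg_def by (rule kernel_integral_bounds[OF m C(1)[OF b] C(2)[OF b]]; assumption)+
qed

lemma avg_const:
  assumes "0 < N" and "\<And>x. \<bar>R - x\<bar> \<le> 1 / N \<Longrightarrow> f x = c"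
  shows "avg N f R = c"
proof -
  have "avg N f R = (LINT u|lborel. \<phi> u * c)"
    unfolding avg_def by (intro kernel_integral_cong assms(2)) (use assms(1) in \<open>simp add: field_simps\<close>)
  then show ?thesis by (simp add: integral_kernel)
qed

lemma avg_tendsto:
  assumes [measurable]: "f \<in> borel_measurable borel" and "isCont f R"
    and C: "\<And>x. \<bar>R - x\<bar> \<le> 1 \<Longrightarrow> \<bar>f x\<bar> \<le> C"
  shows "(\<lambda>n. avg (real n) f R) \<longlonglongrightarrow> f R"
  unfolding avg_def
proof (rule kernel_integral_tendsto)
  show "\<bar>f (R - u / real n)\<bar> \<le> C" if "1 \<le> n" "\<bar>u\<bar> \<le> 1" for n u
    using that by (intro C) (simp add: field_simps)
  show "(\<lambda>n. f (R - u / real n)) \<longlonglongrightarrow> f R" for u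
  proof (rule isCont_tendsto_compose[OF assms(2)])
    have "(\<lambda>n. R - u / real n) \<longlonglongrightarrow> R - 0"
      by (intro tendsto_intros lim_const_over_n)
    then show "(\<lambda>n. R - u / real n) \<longlonglongrightarrow> R" by simp
  qed
qed measurable

text \<open>Only the part of the kernel that looks outward by at least \<open>\<delta>\<close>/N is
  kept; elsewhere nonnegativity of f suffices.\<close>

lemma avg_mass_bound:
  assumes "0 < N" and [measurable]: "f \<in> borel_measurable borel"
    and C: "\<And>x. \<bar>R - x\<bar> \<le> 1 / N \<Longrightarrow> f x \<le> C" and nn: "\<And>x. \<bar>R - x\<bar> \<le> 1 / N \<Longrightarrow> 0 \<le> f x"
    and low: "\<And>x. R + \<delta> / N \<le> x \<Longrightarrow> y \<le> f x"
  shows "(LINT u|lborel. \<phi> u * indicator {..-\<delta>} u) * y \<le> avg N f R"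
  unfolding avg_def
proof (rule kernel_integral_mass_bound)
  show "y \<le> f (R - u / N)" if "u \<le> -\<delta>" for u
  proof (rule low)
    have "\<delta> / N \<le> (- u) / N" using that \<open>0 < N\<close> by (intro divide_right_mono) auto
    then show "R + \<delta> / N \<le> R - u / N" by simp
  qed
next
  fix u :: real assume "\<bar>u\<bar> \<le> 1"
  then have "\<bar>R - (R - u / N)\<bar> \<le> 1 / N" using \<open>0 < N\<close> by (simp add: field_simps)
  then show "f (R - u / N) \<le> C" "0 \<le> f (R - u / N)" by (rule C, rule nn)
qed measurable

lemma avg_has_derivative:
  assumes "0 < N" and [measurable]: "f \<in> borel_measurable borel" "f' \<in> borel_measurable borel"
    and lip: "\<And>x y. \<bar>f x - f y\<bar> \<le> C * \<bar>x - y\<bar>"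
    and der: "\<And>x. x \<notin> X \<Longrightarrow> (f has_real_derivative f' x) (at x)" and "finite X"
  shows "(avg N f has_real_derivative avg N f' R) (at R)"
  unfolding avg_def
proof (rule leibniz_lipschitz[where S=UNIV and C=C])
  show "integrable lborel (\<lambda>u. \<phi> u * f (y - u / N))" for y
  proof (rule integrable_kernel_times)
    fix u :: real assume "\<bar>u\<bar> \<le> 1"
    then have "\<bar>u\<bar> / N \<le> 1 / N" using \<open>0 < N\<close> by (simp add: field_simps)
    have C0: "0 \<le> C" using lip[of 1 0] abs_ge_zero[of "f 1 - f 0"] by simp
    have "\<bar>f (y - u / N) - f y\<bar> \<le> C * \<bar>y - u / N - y\<bar>" by (rule lip)
    also have "\<dots> \<le> C * (1 / N)"
      using \<open>\<bar>u\<bar> / N \<le> 1 / N\<close> \<open>0 < N\<close> C0 by (intro mult_left_mono) auto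
    finally show "\<bar>f (y - u / N)\<bar> \<le> \<bar>f y\<bar> + C * (1 / N)" by linarith
  qed measurable
  show "\<bar>f (y - u / N) - f (R - u / N)\<bar> \<le> C * \<bar>y - R\<bar>" for y u
    using lip[of "y - u / N" "R - u / N"] by simp
  \<comment> \<open>The exceptional points of \<open>f\<close> correspond to finitely many values of
    the integration variable, a null set.\<close>
  have "finite ((\<lambda>z. N * (R - z)) ` X)" using assms by simp
  then have "AE u in lborel. u \<notin> (\<lambda>z. N * (R - z)) ` X"
    by (intro AE_not_in finite_imp_null_set_lborel)
  then show "AE u in lborel. ((\<lambda>y. f (y - u / N)) has_real_derivative f' (R - u / N)) (at R)"
  proof eventually_elim
    case (elim u)
    then have "R - u / N \<notin> X" using \<open>0 < N\<close> by (auto simp: image_iff field_simps)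
    then show ?case using DERIV_shift[of f "f' (R - u / N)" R "- (u / N)"] der by simp
  qed
qed (use integrable_kernel in auto)

end

text \<open>The derivative may be missing at finitely many points, such as the shock, so the
  increment is bounded by integration. On the exceptional set \<open>f'\<close> is replaced by the
  bound itself, which leaves the integral unchanged.\<close>

lemma piecewise_mvt_bounds:
  fixes f f' :: "real \<Rightarrow> real"
  assumes "x \<le> y" "continuous_on {x..y} f" "finite X"
    and der: "\<And>z. z \<in> {x<..<y} - X \<Longrightarrow> (f has_real_derivative f' z) (at z)"
    and bounds: "\<And>z. z \<in> {x<..<y} - X \<Longrightarrow> a \<le> f' z" "\<And>z. z \<in> {x<..<y} - X \<Longrightarrow> f' z \<le> b"
  shows "a * (y - x) \<le> f y - f x" "f y - f x \<le> b * (y - x)"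
proof -
  have i: "(f' has_integral f y - f x) {x..y}"
    using assms(1,2,3) der
    by (intro fundamental_theorem_of_calculus_interior_strong[of X])
      (auto simp: has_real_derivative_iff_has_vector_derivative)
  have "negligible (X \<union> {x, y})" using assms(3) by (simp add: negligible_finite)
  note sp = has_integral_spike[OF this _ i]
  have "((\<lambda>z. if z \<in> X \<union> {x,y} then a else f' z) has_integral f y - f x) {x..y}"
    by (rule sp) auto
  note fa = this
  have ia: "((\<lambda>z. a) has_integral a * (y - x)) {x..y}"
    using has_integral_const_real[of a x y] assms(1) by (simp add: mult.commute)
  show "a * (y - x) \<le> f y - f x"
    by (rule has_integral_le[OF ia fa]) (use bounds in auto)
  have "((\<lambda>z. if z \<in> X \<union> {x,y} then b else f' z) has_integral f y - f x) {x..y}"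
    by (rule sp) auto
  note fb = this
  have ib: "((\<lambda>z. b) has_integral b * (y - x)) {x..y}"
    using has_integral_const_real[of b x y] assms(1) by (simp add: mult.commute)
  show "f y - f x \<le> b * (y - x)"
    by (rule has_integral_le[OF fb ib]) (use bounds in auto)
qed

section \<open>Profiles and their odd extension\<close>

text \<open>\<open>q\<close> is the derivative of \<open>r\<close>, continued by its constant value \<open>lam\<close> through the shock; this makes it
  monotone, hence measurable, and defined everywhere.\<close>

locale radial_profile =
  fixes r q :: "real \<Rightarrow> real" and lam \<sigma> H :: real and d :: nat
  assumes d: "3 \<le> d" and lam: "0 < lam" and sig: "0 < \<sigma>" and H: "0 < H"
    and r_cont: "continuous_on {0..} r"
    and r_pos: "\<And>s. 0 \<le> s \<Longrightarrow> 0 < r s"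
    and r_outer: "\<And>s. \<sigma> \<le> s \<Longrightarrow> r s = lam * s"
    and r_deriv: "\<And>s. 0 < s \<Longrightarrow> s \<noteq> \<sigma> \<Longrightarrow> (r has_real_derivative q s) (at s)"
    and q_mono: "mono q"
    and q_outer: "\<And>s. \<sigma> \<le> s \<Longrightarrow> q s = lam"
    and q_cont: "\<And>s. 0 < s \<Longrightarrow> s \<noteq> \<sigma> \<Longrightarrow> isCont q s"
    and q_nonneg: "\<And>s. 0 \<le> q s"
    and vol_lower: "\<And>s. 0 < s \<Longrightarrow> H \<le> q s * (r s / s) ^ (d - 1)"
    and tangent: "\<And>s. 0 < s \<Longrightarrow> s * q s \<le> r s"
begin

lemma q_le: "q s \<le> lam"
  using monoD[OF q_mono, of s "max s \<sigma>"] q_outer[of "max s \<sigma>"] by simp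

lemma q_pos: "0 < s \<Longrightarrow> 0 < q s"
  using vol_lower[of s] H q_nonneg[of s] by (cases "q s = 0") auto

lemma q_measurable[measurable]: "q \<in> borel_measurable borel"
  by (rule borel_measurable_mono[OF q_mono])

lemma r_increment:
  assumes "0 \<le> x" "x \<le> y"
  shows "0 \<le> r y - r x" "r y - r x \<le> lam * (y - x)"
proof -
  have c: "continuous_on {x..y} r"
    by (rule continuous_on_subset[OF r_cont]) (use assms in auto)
  have D: "(r has_real_derivative q z) (at z)" if "z \<in> {x<..<y} - {\<sigma>}" for z
    using that assms by (intro r_deriv) auto
  show "0 \<le> r y - r x" "r y - r x \<le> lam * (y - x)"
    using piecewise_mvt_bounds[where X="{\<sigma>}", OF assms(2) c _ D q_nonneg q_le] by auto
qed

lemma r_upper: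
  assumes "0 \<le> s" shows "r s \<le> lam * max \<sigma> s"
  using r_increment(1)[of s "max \<sigma> s"] r_outer[of "max \<sigma> s"] assms by simp

text \<open>The radial velocity: \<open>p (R / t)\<close> is the time derivative of t r(R/t) away
  from the shock.\<close>

definition p :: "real \<Rightarrow> real" where "p s = r s - s * q s"

lemma p_nonneg: "0 < s \<Longrightarrow> 0 \<le> p s"
  using tangent[of s] by (simp add: p_def)

lemma p_outer: "\<sigma> \<le> s \<Longrightarrow> p s = 0"
  by (simp add: p_def q_outer r_outer)

lemma p_le:
  assumes "0 < s" shows "p s \<le> lam * \<sigma>"
proof (cases "s < \<sigma>")
  case True
  then have "r s \<le> lam * \<sigma>" using r_upper[of s] assms by simp
  moreover have "0 \<le> s * q s" using assms q_nonneg by simp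
  ultimately show ?thesis by (simp add: p_def)
qed (use sig lam in \<open>simp add: p_outer\<close>)

lemma r_abs_continuous: "0 < t \<Longrightarrow> continuous_on UNIV (\<lambda>x. r (\<bar>x\<bar> / t))"
  by (rule continuous_on_compose2[OF r_cont]) (auto intro!: continuous_intros)

lemma r_abs_measurable[measurable]: "0 < t \<Longrightarrow> (\<lambda>x. r (\<bar>x\<bar> / t)) \<in> borel_measurable borel"
  by (intro borel_measurable_continuous_onI r_abs_continuous)

text \<open>Averaging with the kernel $\phi_n(R-\rho)-\phi_n(R+\rho)$ on the half line is convolution of the odd
  extension with $\phi_n$.\<close>

definition W :: "real \<Rightarrow> real \<Rightarrow> real" where
  "W t x = sgn x * (t * r (\<bar>x\<bar> / t))"

lemma W_measurable[measurable]: "0 < t \<Longrightarrow> W t \<in> borel_measurable borel"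
  unfolding W_def by measurable

lemma W_minus: "W t (- x) = - W t x"
  by (simp add: W_def sgn_minus)

lemma W_eq: "0 < x \<Longrightarrow> W t x = t * r (x / t)"
  by (simp add: W_def)

lemma W_outer: "0 < t \<Longrightarrow> \<sigma> * t \<le> x \<Longrightarrow> W t x = lam * x"
  using sig by (subst W_eq) (auto simp: r_outer field_simps intro: less_le_trans[OF mult_pos_pos])

lemma W_nonneg: "0 < t \<Longrightarrow> 0 \<le> x \<Longrightarrow> 0 \<le> W t x"
  using r_pos[of "\<bar>x\<bar> / t"] by (auto simp: W_def sgn_real_def)

lemma W_abs_le: "0 < t \<Longrightarrow> \<bar>x\<bar> \<le> K \<Longrightarrow> \<bar>W t x\<bar> \<le> t * (lam * max \<sigma> (K / t))"
proof -
  assume t: "0 < t" and x: "\<bar>x\<bar> \<le> K"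
  have "r (\<bar>x\<bar> / t) \<le> lam * max \<sigma> (\<bar>x\<bar> / t)" using t by (intro r_upper) auto
  also have "\<dots> \<le> lam * max \<sigma> (K / t)"
    using x t lam by (intro mult_left_mono max.mono divide_right_mono) auto
  finally have *: "t * r (\<bar>x\<bar> / t) \<le> t * (lam * max \<sigma> (K / t))" using t by simp
  have "\<bar>W t x\<bar> \<le> \<bar>t * r (\<bar>x\<bar> / t)\<bar>"
    by (auto simp: W_def abs_mult sgn_real_def)
  also have "\<dots> = t * r (\<bar>x\<bar> / t)" using t r_pos[of "\<bar>x\<bar> / t"] by simp
  finally show ?thesis using * by linarith
qed

text \<open>Removing the jump at the cavity leaves a Lipschitz function, to which dominated convergence applies.\<close>

definition Wc :: "real \<Rightarrow> real \<Rightarrow> real" where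
  "Wc t x = t * r (max x 0 / t) - t * r (max (- x) 0 / t)"

lemma W_decomp: "W t x = t * r 0 * sgn x + Wc t x"
  by (cases "x < 0"; cases "x = 0") (auto simp: W_def Wc_def max_def)

text \<open>A step from x to y splits into its parts on the two sides of the origin. On each part
  the profile increases with slope at most \<open>lam\<close>, and the two lengths add up to |x -
  y|.\<close>

lemma Wc_lip:
  assumes "0 < t" shows "\<bar>Wc t x - Wc t y\<bar> \<le> lam * \<bar>x - y\<bar>"
proof -
  have mono: "0 \<le> t * r (max b 0 / t) - t * r (max a 0 / t)
      \<and> t * r (max b 0 / t) - t * r (max a 0 / t) \<le> lam * (max b 0 - max a 0)" if "a \<le> b" for a b
  proof -
    have "max a 0 / t \<le> max b 0 / t" using that assms by (intro divide_right_mono) auto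
    moreover have "0 \<le> max a 0 / t" using assms by simp
    ultimately have *: "0 \<le> r (max b 0 / t) - r (max a 0 / t)"
        "r (max b 0 / t) - r (max a 0 / t) \<le> lam * (max b 0 / t - max a 0 / t)"
      using r_increment by blast+
    have "t * (r (max b 0 / t) - r (max a 0 / t)) \<le> t * (lam * (max b 0 / t - max a 0 / t))"
      using *(2) assms by (intro mult_left_mono) auto
    also have "\<dots> = lam * (max b 0 - max a 0)" using assms by (simp add: field_simps)
    finally have "t * (r (max b 0 / t) - r (max a 0 / t)) \<le> lam * (max b 0 - max a 0)" .
    moreover have "0 \<le> t * (r (max b 0 / t) - r (max a 0 / t))" using *(1) assms by simp
    ultimately show ?thesis by (simp add: right_diff_distrib)
  qed
  have main: "\<bar>Wc t x - Wc t y\<bar> \<le> lam * \<bar>x - y\<bar>" if "x \<le> y" for x y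
  proof -
    have e: "max y 0 - max x 0 + (max (- x) 0 - max (- y) 0) = y - x" by (simp add: max_def)
    have "lam * (max y 0 - max x 0) + lam * (max (- x) 0 - max (- y) 0) = lam * (y - x)"
      by (simp only: distrib_left[symmetric] e)
    moreover have "\<bar>x - y\<bar> = y - x" using that by simp
    ultimately show ?thesis
      using mono[OF that] mono[of "-y" "-x"] that unfolding Wc_def abs_le_iff by simp
  qed
  show ?thesis
    using main[of x y] main[of y x] by (cases "x \<le> y") (auto simp: abs_minus_commute)
qed

lemma Wc_isCont: "0 < t \<Longrightarrow> isCont (Wc t) x"
  unfolding continuous_at_eps_delta
proof (intro allI impI)
  fix e :: real assume "0 < t" "0 < e"
  have "\<bar>Wc t y - Wc t x\<bar> < e" if "\<bar>y - x\<bar> < e / lam" for y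
  proof -
    have "lam * \<bar>y - x\<bar> < e" using that lam by (simp add: field_simps)
    then show ?thesis using Wc_lip[OF \<open>0 < t\<close>, of y x] by linarith
  qed
  then show "\<exists>d>0. \<forall>x'. dist x' x < d \<longrightarrow> dist (Wc t x') (Wc t x) < e"
    using \<open>0 < e\<close> lam by (intro exI[of _ "e / lam"]) (auto simp: dist_real_def)
qed

lemma Wc_measurable[measurable]: "0 < t \<Longrightarrow> Wc t \<in> borel_measurable borel"
  by (intro borel_measurable_continuous_onI continuous_at_imp_continuous_on ballI Wc_isCont)

lemma scaled_r_deriv:
  assumes "0 < t" "0 < x" "x \<noteq> \<sigma> * t"
  shows "((\<lambda>x. t * r (x / t)) has_real_derivative q (x / t)) (at x)"
proof -
  have "(r has_real_derivative q (x / t)) (at (x / t))"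
    using assms by (intro r_deriv) (auto simp: field_simps)
  then have "((\<lambda>x. r (x / t)) has_real_derivative q (x / t) * (1 / t)) (at x)"
    by (rule DERIV_chain2) (rule DERIV_cdivide[OF DERIV_ident])
  then have "((\<lambda>x. t * r (x / t)) has_real_derivative t * (q (x / t) * (1 / t))) (at x)"
    by (rule DERIV_cmult)
  then show ?thesis using assms by simp
qed

lemma Wc_deriv:
  assumes "0 < t" "x \<notin> {0, \<sigma> * t, - (\<sigma> * t)}"
  shows "(Wc t has_real_derivative q (\<bar>x\<bar> / t)) (at x)"
proof (cases "0 < x")
  case True
  have "((\<lambda>x. t * r (x / t) - t * r 0) has_real_derivative q (x / t)) (at x)"
  proof -
    have "x \<noteq> \<sigma> * t" using assms(2) by simp
    from DERIV_diff[OF scaled_r_deriv[OF assms(1) True this] DERIV_const] show ?thesis by simp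
  qed
  moreover have "open {0::real<..}" "x \<in> {0<..}" using True by auto
  ultimately have "(Wc t has_real_derivative q (x / t)) (at x)"
    by (rule has_field_derivative_transform_within_open) (auto simp: Wc_def)
  then show ?thesis using True by simp
next
  case False
  then have neg: "0 < - x" "- x \<noteq> \<sigma> * t" using assms(2) by auto
  have "((\<lambda>y. t * r ((- y) / t)) has_real_derivative q (- x / t) * (- 1)) (at x)"
    by (rule DERIV_chain2[where g=uminus and x=x, OF scaled_r_deriv[OF assms(1) neg]])
      (auto intro!: derivative_eq_intros)
  then have "((\<lambda>y. t * r 0 - t * r ((- y) / t)) has_real_derivative q (- x / t)) (at x)"
    using DERIV_diff[OF DERIV_const[of "t * r 0"], of "\<lambda>y. t * r ((- y) / t)" "q (- x / t) * (- 1)"] by simp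
  moreover have "open {..<0::real}" "x \<in> {..<0}" using neg by auto
  ultimately have "(Wc t has_real_derivative q (- x / t)) (at x)"
    by (rule has_field_derivative_transform_within_open) (auto simp: Wc_def)
  then show ?thesis using neg by simp
qed

lemma W_isCont: "0 < t \<Longrightarrow> x \<noteq> 0 \<Longrightarrow> isCont (W t) x"
  unfolding W_decomp[abs_def] by (intro continuous_intros Wc_isCont) auto

text \<open>The space derivative of \<open>Wc\<close>, away from the origin and the shock, and the
  time derivative of \<open>W\<close>, away from the shock; the first is even and the second odd in
  x.\<close>

definition Wq :: "real \<Rightarrow> real \<Rightarrow> real" where "Wq t x = q (\<bar>x\<bar> / t)"
definition Wp :: "real \<Rightarrow> real \<Rightarrow> real" where "Wp t x = sgn x * p (\<bar>x\<bar> / t)"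

lemma Wq_measurable[measurable]: "Wq t \<in> borel_measurable borel"
  unfolding Wq_def by measurable

lemma Wp_measurable[measurable]: "0 < t \<Longrightarrow> Wp t \<in> borel_measurable borel"
  unfolding Wp_def p_def by measurable

lemma Wq_isCont: "0 < t \<Longrightarrow> 0 < x \<Longrightarrow> x \<noteq> \<sigma> * t \<Longrightarrow> isCont (Wq t) x"
  unfolding Wq_def
  by (rule isCont_o2[of x "\<lambda>x. \<bar>x\<bar> / t" q]) (auto intro!: continuous_intros q_cont simp: field_simps)

lemma p_isCont: "0 < s \<Longrightarrow> s \<noteq> \<sigma> \<Longrightarrow> isCont p s"
  unfolding p_def by (intro continuous_intros q_cont DERIV_isCont[OF r_deriv])

lemma Wp_isCont: "0 < t \<Longrightarrow> 0 < x \<Longrightarrow> x \<noteq> \<sigma> * t \<Longrightarrow> isCont (Wp t) x"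
  unfolding Wp_def
  by (intro continuous_intros isCont_o2[of x "\<lambda>x. \<bar>x\<bar> / t" p] p_isCont) (auto simp: field_simps)

lemma Wq_bounds: "0 \<le> Wq t x" "Wq t x \<le> lam"
  by (auto simp: Wq_def q_nonneg q_le)

lemma Wp_abs_le: "0 < t \<Longrightarrow> \<bar>Wp t x\<bar> \<le> lam * \<sigma>"
proof (cases "x = 0")
  case False
  assume "0 < t"
  then have "0 < \<bar>x\<bar> / t" using False by simp
  then show ?thesis using p_nonneg[of "\<bar>x\<bar> / t"] p_le[of "\<bar>x\<bar> / t"]
    by (auto simp: Wp_def abs_mult sgn_real_def)
qed (use lam sig in \<open>simp add: Wp_def\<close>)

lemma W_time_deriv:
  assumes "0 < t" "x \<notin> {\<sigma> * t, - (\<sigma> * t)}"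
  shows "((\<lambda>t. W t x) has_real_derivative Wp t x) (at t)"
proof (cases "x = 0")
  case True
  then show ?thesis by (simp add: W_def Wp_def)
next
  case False
  have s: "0 < \<bar>x\<bar> / t" "\<bar>x\<bar> / t \<noteq> \<sigma>" using assms False by (auto simp: field_simps abs_if split: if_splits)
  have "((\<lambda>t. r (\<bar>x\<bar> / t)) has_real_derivative q (\<bar>x\<bar> / t) * (- \<bar>x\<bar> / t\<^sup>2)) (at t)"
    by (rule DERIV_chain2[where f=r and g="\<lambda>t. \<bar>x\<bar> / t" and x=t, OF r_deriv[OF s]])
      (use assms in \<open>auto intro!: derivative_eq_intros simp: power2_eq_square\<close>)
  then have "((\<lambda>t. sgn x * (t * r (\<bar>x\<bar> / t))) has_real_derivative
      sgn x * (r (\<bar>x\<bar> / t) + t * (q (\<bar>x\<bar> / t) * (- \<bar>x\<bar> / t\<^sup>2)))) (at t)"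
    by (auto intro!: derivative_eq_intros)
  moreover have "r (\<bar>x\<bar> / t) + t * (q (\<bar>x\<bar> / t) * (- \<bar>x\<bar> / t\<^sup>2)) = p (\<bar>x\<bar> / t)"
    using assms(1) by (simp add: p_def power2_eq_square field_simps)
  ultimately show ?thesis by (simp add: W_def Wp_def)
qed

text \<open>A fixed point x meets the shock at the single time |x| / \<open>\<sigma>\<close>, the
  only exceptional point of the mean value bound; at all other times the speed is at most
  \<open>lam * \<sigma>\<close>.\<close>

lemma W_time_lip:
  assumes "0 < s" "0 < t" shows "\<bar>W s x - W t x\<bar> \<le> lam * \<sigma> * \<bar>s - t\<bar>"
proof -
  have main: "\<bar>W s x - W t x\<bar> \<le> lam * \<sigma> * \<bar>s - t\<bar>" if "0 < s" "s \<le> t" for s t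
  proof -
    have W0: "continuous_on {s..t} (\<lambda>t. W t x)"
      unfolding W_def
      by (intro continuous_intros continuous_on_compose2[OF r_cont]) (use that in auto)
    have D: "((\<lambda>t. W t x) has_real_derivative Wp u x) (at u)" if "u \<in> {s<..<t} - {\<bar>x\<bar> / \<sigma>}" for u
    proof (rule W_time_deriv)
      show "0 < u" using that \<open>0 < s\<close> by simp
      then have "0 < \<sigma> * u" using sig by simp
      moreover have "\<bar>x\<bar> \<noteq> \<sigma> * u" using that sig by auto
      ultimately show "x \<notin> {\<sigma> * u, - (\<sigma> * u)}" by auto
    qed
    have B: "- (lam * \<sigma>) \<le> Wp u x" "Wp u x \<le> lam * \<sigma>" if "u \<in> {s<..<t} - {\<bar>x\<bar> / \<sigma>}" for u
      using Wp_abs_le[of u x] that \<open>0 < s\<close> by (auto simp: abs_le_iff)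
    show ?thesis
      using piecewise_mvt_bounds[where X="{\<bar>x\<bar> / \<sigma>}", OF that(2) W0 _ D B] that by (simp add: abs_le_iff)
  qed
  show ?thesis
    using main[of s t] main[of t s] assms by (cases "s \<le> t") (auto simp: abs_minus_commute)
qed

end

section \<open>Averaged profiles\<close>

text \<open>The numbers \<open>\<delta>\<close> and \<open>m\<close> are those provided by
  \<open>kernel_mass\<close>; fixing them here makes all lower bounds below share them.\<close>

locale averaged_profile = mollifier \<phi> + radial_profile r q lam \<sigma> H d
  for \<phi> r q lam \<sigma> H d +
  fixes \<delta> m :: real
  assumes delta: "0 < \<delta>" "\<delta> \<le> 1/2" and core: "\<And>u. \<bar>u\<bar> \<le> 2 * \<delta> \<Longrightarrow> \<phi> 0 / 2 \<le> \<phi> u"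
    and m: "0 < m" "m \<le> 1" and m_eq: "m = (LINT u|lborel. \<phi> u * indicator {..-\<delta>} u)"
begin

definition wn :: "real \<Rightarrow> real \<Rightarrow> real \<Rightarrow> real" where "wn N t R = avg N (W t) R"

text \<open>The first summand is the averaged jump $2w(0,t)$ of the odd extension: the opening cavity.\<close>

definition dwn :: "real \<Rightarrow> real \<Rightarrow> real \<Rightarrow> real" where
  "dwn N t R = 2 * (t * r 0) * N * \<phi> (N * R) + avg N (Wq t) R"

definition tn :: "real \<Rightarrow> real \<Rightarrow> real \<Rightarrow> real" where "tn N t R = avg N (Wp t) R"

lemma wn_measurable[measurable]: "0 < t \<Longrightarrow> wn N t \<in> borel_measurable borel"
  unfolding wn_def[abs_def] by (rule measurable_avg) measurable

lemma dwn_measurable[measurable]: "dwn N t \<in> borel_measurable borel"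
  unfolding dwn_def[abs_def]
  by (intro borel_measurable_add measurable_avg) measurable

lemma tn_measurable[measurable]: "0 < t \<Longrightarrow> tn N t \<in> borel_measurable borel"
  unfolding tn_def[abs_def] by (rule measurable_avg) measurable

lemma shift_near: "0 < N \<Longrightarrow> \<bar>u\<bar> \<le> 1 \<Longrightarrow> \<bar>R - u / N\<bar> \<le> \<bar>R\<bar> + 1 / N" for N u R :: real
proof -
  assume "0 < N" "\<bar>u\<bar> \<le> 1"
  then have "\<bar>u / N\<bar> \<le> 1 / N" by (simp add: field_simps)
  then show ?thesis by linarith
qed

text \<open>By \<open>W_decomp\<close> the average is the jump times the averaged sign, whose
  derivative is twice the rescaled kernel, plus the average of a Lipschitz function, where the
  derivative passes under the integral.\<close>

lemma wn_deriv:
  assumes N: "0 < N" and t: "0 < t"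
  shows "(wn N t has_real_derivative dwn N t R) (at R)"
proof -
  have eq: "wn N t R = t * r 0 * (LINT u|lborel. \<phi> u * sgn (N * R - u)) + avg N (Wc t) R" for R
  proof -
    have sg: "sgn (R - u / N) = sgn (N * R - u)" for u
    proof -
      have "N * R - u = N * (R - u / N)" using N by (simp add: field_simps)
      then show ?thesis using N by (simp add: sgn_mult)
    qed
    have i1: "integrable lborel (\<lambda>u. \<phi> u * sgn (N * R - u))"
      by (rule integrable_kernel_times[where C=1]) (auto simp: sgn_real_def)
    have i2: "integrable lborel (\<lambda>u. \<phi> u * Wc t (R - u / N))"
    proof (rule integrable_kernel_times)
      fix u :: real assume u: "\<bar>u\<bar> \<le> 1"
      have "Wc t 0 = 0" by (simp add: Wc_def)
      then have "\<bar>Wc t (R - u / N)\<bar> \<le> lam * \<bar>R - u / N\<bar>"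
        using Wc_lip[OF t, of "R - u / N" 0] by simp
      also have "\<dots> \<le> lam * (\<bar>R\<bar> + 1 / N)"
        using shift_near[OF N u, of R] lam by (intro mult_left_mono) auto
      finally show "\<bar>Wc t (R - u / N)\<bar> \<le> lam * (\<bar>R\<bar> + 1 / N)" .
    qed (use t in measurable)
    have "wn N t R = (LINT u|lborel. t * r 0 * (\<phi> u * sgn (N * R - u)) + \<phi> u * Wc t (R - u / N))"
      unfolding wn_def avg_def W_decomp sg by (simp add: algebra_simps)
    also have "\<dots> = t * r 0 * (LINT u|lborel. \<phi> u * sgn (N * R - u)) + avg N (Wc t) R"
      using i1 i2 by (simp add: avg_def)
    finally show ?thesis .
  qed
  have c: "((\<lambda>R. LINT u|lborel. \<phi> u * sgn (N * R - u)) has_real_derivative 2 * \<phi> (N * R) * N) (at R)"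
    by (rule DERIV_chain2[where g="\<lambda>R. N * R", OF kernel_integral_sgn_has_derivative])
      (auto intro!: derivative_eq_intros)
  have a: "(avg N (Wc t) has_real_derivative avg N (Wq t) R) (at R)"
    by (rule avg_has_derivative[where X="{0, \<sigma> * t, - (\<sigma> * t)}", OF N _ _ Wc_lip[OF t]])
      (use t in \<open>auto simp: Wq_def intro!: Wc_deriv\<close>)
  have "((\<lambda>R. t * r 0 * (LINT u|lborel. \<phi> u * sgn (N * R - u)) + avg N (Wc t) R)
     has_real_derivative t * r 0 * (2 * \<phi> (N * R) * N) + avg N (Wq t) R) (at R)"
    by (rule DERIV_add[OF DERIV_cmult[OF c] a])
  then show ?thesis
    unfolding eq[abs_def, symmetric] dwn_def by (simp add: mult_ac)
qed

text \<open>Averaging the odd extension closes the cavity. Hence w/R is a value of the derivative,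
  by the mean value theorem, and stays bounded for each fixed scale.\<close>

lemma wn_0: "wn N t 0 = 0"
  unfolding wn_def avg_def
  by (rule kernel_integral_odd) (metis W_minus diff_0 minus_divide_left minus_minus)

text \<open>At a fixed point the odd extension is Lipschitz in time, even though it jumps in space
  at the origin, so no concentrated term arises. The two values of u at which the shock is met form
  a null set.\<close>

lemma wn_time_deriv:
  assumes N: "0 < N" and t: "0 < t"
  shows "((\<lambda>t. wn N t R) has_real_derivative tn N t R) (at t)"
  unfolding wn_def tn_def avg_def
proof (rule leibniz_lipschitz[where S="{0<..}" and C="lam * \<sigma>"])
  show "integrable lborel (\<lambda>u. \<phi> u * W s (R - u / N))" if "s \<in> {0<..}" for s
    by (rule integrable_kernel_times[OF _ W_abs_le[where K="\<bar>R\<bar> + 1 / N"]])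
      (use that shift_near[OF N] in auto)
  show "\<bar>W s (R - u / N) - W t (R - u / N)\<bar> \<le> lam * \<sigma> * \<bar>s - t\<bar>" if "s \<in> {0<..}" for s u
    using W_time_lip that t by simp
  have "finite ((\<lambda>z. N * (R - z)) ` {\<sigma> * t, - (\<sigma> * t)})" by simp
  then have "AE u in lborel. u \<notin> (\<lambda>z. N * (R - z)) ` {\<sigma> * t, - (\<sigma> * t)}"
    by (intro AE_not_in finite_imp_null_set_lborel)
  then show "AE u in lborel. ((\<lambda>s. W s (R - u / N)) has_real_derivative Wp t (R - u / N)) (at t)"
  proof eventually_elim
    case (elim u)
    have "u = N * (R - (R - u / N))" using N by simp
    then have "R - u / N \<notin> {\<sigma> * t, - (\<sigma> * t)}" using elim by blast
    then show ?case by (rule W_time_deriv[OF t])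
  qed
  show "(\<lambda>u. Wp t (R - u / N)) \<in> borel_measurable lborel" using t by measurable
qed (use t integrable_kernel in auto)

lemma tn_abs_le: "0 < N \<Longrightarrow> 0 < t \<Longrightarrow> \<bar>tn N t R\<bar> \<le> lam * \<sigma>"
  unfolding tn_def abs_le_iff
  using avg_bounds[of N "Wp t" R "- (lam * \<sigma>)" "lam * \<sigma>"] Wp_abs_le[of t]
  by (auto simp: abs_le_iff minus_le_iff)

lemma avg_Wq_le: "0 < N \<Longrightarrow> avg N (Wq t) R \<le> lam"
  by (rule avg_bounds(2)[where a=0]) (auto simp: Wq_bounds)

lemma dwn_far:
  assumes "0 < N" "1 / N < R" shows "dwn N t R = avg N (Wq t) R"
proof -
  have "1 < N * R" using assms by (simp add: field_simps)
  then show ?thesis by (simp add: dwn_def kernel_zero)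
qed

lemma dwn_far_le: "0 < N \<Longrightarrow> 1 / N < R \<Longrightarrow> dwn N t R \<le> lam"
  by (simp add: dwn_far avg_Wq_le)

lemma dwn_le:
  assumes "0 < N" "0 < t" and M: "\<And>u. \<phi> u \<le> M"
  shows "dwn N t R \<le> 2 * (t * r 0) * N * M + lam"
proof -
  have "2 * (t * r 0) * N * \<phi> (N * R) \<le> 2 * (t * r 0) * N * M"
    using assms r_pos[of 0] by (intro mult_left_mono M) auto
  then show ?thesis using avg_Wq_le[OF assms(1), of t R] by (simp add: dwn_def)
qed

text \<open>The jump term is dropped. The outward shift by \<open>\<delta>\<close>/N matters because
  \<open>q\<close> is known to be positive only at positive arguments, while R may be 0
  here.\<close>

lemma dwn_lower:
  assumes N: "0 < N" and t: "0 < t" and R: "0 \<le> R"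
  shows "m * q ((R + \<delta> / N) / t) \<le> dwn N t R"
proof -
  have "m * q ((R + \<delta> / N) / t) \<le> avg N (Wq t) R"
    unfolding m_eq
  proof (rule avg_mass_bound[OF N, where C=lam])
    show "q ((R + \<delta> / N) / t) \<le> Wq t x" if "R + \<delta> / N \<le> x" for x
      unfolding Wq_def using that t by (intro monoD[OF q_mono] divide_right_mono) auto
  qed (auto simp: Wq_bounds)
  moreover have "0 \<le> 2 * (t * r 0) * N * \<phi> (N * R)"
    using N t r_pos[of 0] by simp
  ultimately show ?thesis unfolding dwn_def by linarith
qed

lemma dwn_pos: "0 < N \<Longrightarrow> 0 < t \<Longrightarrow> 0 \<le> R \<Longrightarrow> 0 < dwn N t R"
proof -
  assume a: "0 < N" "0 < t" "0 \<le> R"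
  then have "0 < (R + \<delta> / N) / t" using delta by (simp add: add_nonneg_pos)
  then have "0 < m * q ((R + \<delta> / N) / t)" using q_pos m by simp
  then show ?thesis using dwn_lower[OF a] by linarith
qed

lemma wn_mvt:
  assumes "0 < N" "0 < t" "a < b"
  obtains z where "a < z" "z < b" "wn N t b - wn N t a = (b - a) * dwn N t z"
  using MVT2[of a b "wn N t" "dwn N t"] wn_deriv[OF assms(1,2)] assms(3) by blast

lemma wn_pos: "0 < N \<Longrightarrow> 0 < t \<Longrightarrow> 0 < R \<Longrightarrow> 0 < wn N t R"
  using wn_mvt[of N t 0 R] dwn_pos[of N t] wn_0[of N t]
  by (metis diff_zero less_eq_real_def mult_pos_pos)

lemma wn_mono:
  assumes "0 < N" "0 < t" "0 \<le> a" "a \<le> b" shows "wn N t a \<le> wn N t b"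
proof (cases "a = b")
  case False
  then obtain z where z: "a < z" "z < b" "wn N t b - wn N t a = (b - a) * dwn N t z"
    using wn_mvt[OF assms(1,2), of a b] assms(4) by auto
  have "0 < dwn N t z" using dwn_pos[OF assms(1,2), of z] z assms(3) by simp
  then have "0 \<le> (b - a) * dwn N t z" using z assms by simp
  then show ?thesis using z by simp
qed simp

lemma wn_slope_le:
  assumes "0 < N" "0 < t" "0 < R" and M: "\<And>u. \<phi> u \<le> M"
  shows "wn N t R / R \<le> 2 * (t * r 0) * N * M + lam"
proof -
  obtain z where z: "wn N t R - wn N t 0 = (R - 0) * dwn N t z"
    using wn_mvt[OF assms(1-3)] by blast
  then have "wn N t R / R = dwn N t z" using assms by (simp add: wn_0)
  then show ?thesis using dwn_le[OF assms(1,2) M] by simp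
qed

lemma wn_le:
  assumes "1 \<le> N" "0 < t" "0 \<le> R" "R \<le> K"
  shows "wn N t R \<le> t * (lam * max \<sigma> ((K + 1) / t))"
  unfolding wn_def
proof (rule avg_bounds(2))
  show N: "0 < N" using assms by simp
  show "W t \<in> borel_measurable borel" using assms by measurable
  fix x assume "\<bar>R - x\<bar> \<le> 1 / N"
  moreover have "1 / N \<le> 1" using assms by simp
  ultimately have "\<bar>x\<bar> \<le> K + 1" using assms by linarith
  from W_abs_le[OF assms(2) this]
  show "W t x \<le> t * (lam * max \<sigma> ((K + 1) / t))" "- (t * (lam * max \<sigma> ((K + 1) / t))) \<le> W t x" by (simp_all add: abs_le_iff)
qed

lemma W_mono: "0 < t \<Longrightarrow> 0 < x \<Longrightarrow> x \<le> y \<Longrightarrow> W t x \<le> W t y"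
  using r_increment(1)[of "x / t" "y / t"] by (simp add: W_eq divide_right_mono)

text \<open>From R = 1/N on, the averaging window stays in the region where the odd extension is
  nonnegative, so the outward part of the kernel alone gives the bound.\<close>

lemma wn_lower_far:
  assumes N: "0 < N" and t: "0 < t" and R: "1 / N \<le> R"
  shows "m * W t R \<le> wn N t R"
  unfolding wn_def m_eq
proof (rule avg_mass_bound[OF N])
  have R0: "0 < R" using N R by (meson less_le_trans zero_less_divide_1_iff)
  show "W t R \<le> W t x" if "R + \<delta> / N \<le> x" for x
  proof (rule W_mono[OF t R0])
    have "0 < \<delta> / N" using delta N by simp
    then show "R \<le> x" using that by linarith
  qed
  show "W t x \<le> t * (lam * max \<sigma> ((\<bar>R\<bar> + 1 / N) / t))" if "\<bar>R - x\<bar> \<le> 1 / N" for x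
  proof -
    have "\<bar>x\<bar> \<le> \<bar>R\<bar> + 1 / N" using that by linarith
    from W_abs_le[OF t this] show ?thesis by (rule order_trans[OF abs_ge_self])
  qed
  show "0 \<le> W t x" if "\<bar>R - x\<bar> \<le> 1 / N" for x
    using that R by (intro W_nonneg[OF t]) (simp add: abs_le_iff)
qed (use t in measurable)

text \<open>Up to 2 \<open>\<delta>\<close>/N the kernel is at least half its central value, and the
  averaged jump alone forces linear growth. Monotonicity extends the bound to 1/N, at the price of
  the factor 2 \<open>\<delta>\<close>.\<close>

lemma wn_lower_near:
  assumes N: "0 < N" and t: "0 < t" and R: "0 < R" "R \<le> 1 / N"
  shows "2 * \<delta> * (t * r 0 * \<phi> 0) * N * R \<le> wn N t R"
proof -
  let ?c = "t * r 0 * \<phi> 0"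
  have c: "0 < ?c" using t r_pos[of 0] kernel_pos by simp
  have near: "?c * N * x \<le> wn N t x" if x: "0 < x" "x \<le> 2 * \<delta> / N" for x
  proof -
    obtain z where z: "0 < z" "z < x" "wn N t x - wn N t 0 = (x - 0) * dwn N t z"
      using wn_mvt[OF N t x(1)] by blast
    have "N * z \<le> N * (2 * \<delta> / N)" using z x N by (intro mult_left_mono) auto
    then have "N * z \<le> 2 * \<delta>" using N by simp
    then have "\<phi> 0 / 2 \<le> \<phi> (N * z)" using z N by (intro core) simp
    then have "2 * (t * r 0) * N * (\<phi> 0 / 2) \<le> 2 * (t * r 0) * N * \<phi> (N * z)"
      using t r_pos[of 0] N by (intro mult_left_mono) auto
    moreover have "0 \<le> avg N (Wq t) z"
      by (rule avg_bounds(1)[OF N _ _ Wq_bounds(2)]) (auto simp: Wq_bounds)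
    moreover have "2 * (t * r 0) * N * (\<phi> 0 / 2) = ?c * N" by simp
    ultimately have "?c * N \<le> dwn N t z" unfolding dwn_def by linarith
    then have "x * (?c * N) \<le> x * dwn N t z" using x by (intro mult_left_mono) auto
    then show ?thesis using z by (simp add: wn_0 mult_ac)
  qed
  show ?thesis
  proof (cases "R \<le> 2 * \<delta> / N")
    case True
    have "(2 * \<delta>) * (?c * N * R) \<le> 1 * (?c * N * R)"
      using delta c N R by (intro mult_right_mono) auto
    then show ?thesis using near[OF R(1) True] by (simp add: mult.assoc)
  next
    case False
    have p: "0 < 2 * \<delta> / N" using delta N by simp
    have "N * R \<le> 1" using R N by (simp add: field_simps)
    then have "2 * \<delta> * ?c * (N * R) \<le> 2 * \<delta> * ?c * 1"
      using delta c by (intro mult_left_mono) auto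
    also have "\<dots> = ?c * N * (2 * \<delta> / N)" using N by simp
    also have "\<dots> \<le> wn N t (2 * \<delta> / N)" using near[OF p] by simp
    also have "\<dots> \<le> wn N t R" using False p by (intro wn_mono[OF N t]) auto
    finally show ?thesis by (simp add: mult.assoc)
  qed
qed

text \<open>The Jacobian determinant of the averaged motion: one radial and d - 1 tangential
  stretches.\<close>

definition vn :: "real \<Rightarrow> real \<Rightarrow> real \<Rightarrow> real" where
  "vn N t R = dwn N t R * (wn N t R / R) ^ (d - 1)"

text \<open>Near the cavity the averaged slope may be as small as $N^{-(d-1)}$, because $r'(s)\sim s^{d-1}$ there; this is
  compensated by $w^N/R\sim N$, and only here $\phi(0)>0$ enters.\<close>

lemma vn_lower:
  assumes t: "0 < t"
  obtains v where "0 < v" "\<And>N R. 1 \<le> N \<Longrightarrow> 0 < R \<Longrightarrow> v \<le> vn N t R"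
proof -
  define c where "c = 2 * \<delta> * (t * r 0 * \<phi> 0)"
  define B where "B = r (\<delta> / t)"
  \<comment> \<open>The first entry serves R \<ge> 1/N, where each of the d stretches loses a factor
    \<open>m\<close>. The second serves R < 1/N; it is free of N because the powers of N in the two
    estimates cancel.\<close>
  define v where "v = min (m ^ d * H) (m * H * (\<delta> / (t * B) * c) ^ (d - 1))"
  have cp: "0 < c" using t r_pos[of 0] kernel_pos delta by (simp add: c_def)
  have Bp: "0 < B" using t delta by (auto simp: B_def intro!: r_pos)
  have dd: "d = Suc (d - 1)" using d by simp
  have "0 < v" using m H cp Bp t delta by (simp add: v_def)
  moreover have "v \<le> vn N t R" if N1: "1 \<le> N" and R: "0 < R" for N R
  proof (cases "1 / N \<le> R")
    case True
    have N: "0 < N" using N1 by simp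
    have "q (R / t) \<le> q ((R + \<delta> / N) / t)"
      using delta N t by (intro monoD[OF q_mono] divide_right_mono) auto
    then have "m * q (R / t) \<le> m * q ((R + \<delta> / N) / t)" using m by simp
    also have "\<dots> \<le> dwn N t R" using dwn_lower[OF N t, of R] R by simp
    finally have 1: "m * q (R / t) \<le> dwn N t R" .
    have "m * W t R / R \<le> wn N t R / R"
      using wn_lower_far[OF N t True] R by (intro divide_right_mono) auto
    moreover have "W t R / R = r (R / t) / (R / t)" using R t by (simp add: W_eq)
    ultimately have 2: "m * (r (R / t) / (R / t)) \<le> wn N t R / R"
      by (metis times_divide_eq_right)
    have s: "0 < R / t" using R t by simp
    have rp: "0 < r (R / t)" using s by (intro r_pos) simp
    have "m ^ d * H \<le> m ^ d * (q (R / t) * (r (R / t) / (R / t)) ^ (d - 1))"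
      using vol_lower[OF s] m by (intro mult_left_mono) auto
    also have "\<dots> = (m * q (R / t)) * (m * (r (R / t) / (R / t))) ^ (d - 1)"
      by (subst dd) (simp only: power_mult_distrib power_Suc mult_ac)
    also have "\<dots> \<le> vn N t R"
      unfolding vn_def
      using 1 2 m s rp t q_nonneg[of "R / t"] dwn_pos[OF N t, of R] R
      by (intro mult_mono power_mono zero_le_power) auto
    finally show ?thesis by (simp add: v_def)
  next
    case False
    have N: "0 < N" using N1 by simp
    define s where "s = \<delta> / N / t"
    have s: "0 < s" using delta N t by (simp add: s_def)
    have "s \<le> \<delta> / t" using delta N1 t by (simp add: s_def divide_simps)
    then have rs: "0 < r s" "r s \<le> B"
      using r_pos[of s] r_increment(1)[of s "\<delta> / t"] s by (auto simp: B_def)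
    have "q s \<le> q ((R + \<delta> / N) / t)"
      unfolding s_def using R t by (intro monoD[OF q_mono] divide_right_mono) auto
    then have "m * q s \<le> m * q ((R + \<delta> / N) / t)" using m by simp
    also have "\<dots> \<le> dwn N t R" using dwn_lower[OF N t, of R] R by simp
    finally have 1: "m * q s \<le> dwn N t R" .
    have "c * N * R \<le> wn N t R"
      using wn_lower_near[OF N t R] False by (simp add: c_def)
    then have 2: "c * N \<le> wn N t R / R" using R by (simp add: field_simps)
    \<comment> \<open>The volume bound solved for \<open>q s\<close>, with \<open>r s\<close> at
      most \<open>B\<close>. Since \<open>s\<close> is proportional to 1/N, this produces the rate
      N^(-(d-1)).\<close>
    have "H \<le> q s * (r s / s) ^ (d - 1)" by (rule vol_lower[OF s])
    also have "\<dots> \<le> q s * (B / s) ^ (d - 1)"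
      using rs s q_nonneg[of s] by (intro mult_left_mono power_mono divide_right_mono) auto
    finally have "H * (s / B) ^ (d - 1) \<le> q s * (B / s) ^ (d - 1) * (s / B) ^ (d - 1)"
      using s Bp by (intro mult_right_mono) auto
    also have "\<dots> = q s" using s Bp by (simp add: mult.assoc power_mult_distrib[symmetric])
    finally have q: "H * (s / B) ^ (d - 1) \<le> q s" .
    have "m * H * (\<delta> / (t * B) * c) ^ (d - 1) = m * (H * (s / B) ^ (d - 1)) * (c * N) ^ (d - 1)"
      using N t Bp by (simp add: s_def power_mult_distrib[symmetric] mult.assoc)
    also have "\<dots> \<le> dwn N t R * (wn N t R / R) ^ (d - 1)"
    proof (intro mult_mono power_mono 2)
      show "m * (H * (s / B) ^ (d - 1)) \<le> dwn N t R"
        using mult_left_mono[OF q, of m] m 1 by linarith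
    qed (use cp N dwn_pos[OF N t, of R] R in auto)
    finally show ?thesis unfolding vn_def[symmetric] by (simp add: v_def)
  qed
  ultimately show ?thesis using that by blast
qed

text \<open>The kernel has mass one and, being even, vanishing first moment, so averaging reproduces
  constants and linear functions. At distance 1/N from the fan the averaged motion is therefore
  exactly the homogeneous one.\<close>

lemma outer:
  assumes N: "0 < N" and t: "0 < t" and R: "\<sigma> * t + 1 / N \<le> R"
  shows "dwn N t R = lam" "wn N t R = lam * R" "tn N t R = 0"
proof -
  have far: "\<sigma> \<le> \<bar>x\<bar> / t" "0 < x" "\<sigma> * t \<le> x" if "\<bar>R - x\<bar> \<le> 1 / N" for x
  proof -
    show 1: "\<sigma> * t \<le> x" using that R by linarith
    show 2: "0 < x" using 1 sig t by (meson less_le_trans mult_pos_pos)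
    show "\<sigma> \<le> \<bar>x\<bar> / t" using 1 2 t by (simp add: field_simps)
  qed
  have "0 < \<sigma> * t" using sig t by simp
  then have "1 / N < R" using R by linarith
  moreover have "avg N (Wq t) R = lam"
    by (rule avg_const[OF N]) (simp add: Wq_def q_outer far(1))
  ultimately show "dwn N t R = lam" using dwn_far[OF N] by simp
  show "tn N t R = 0"
    unfolding tn_def by (rule avg_const[OF N]) (simp add: Wp_def p_outer far(1))
  have "wn N t R = avg N (\<lambda>x. lam * x) R"
    unfolding wn_def avg_def
  proof (rule kernel_integral_cong)
    fix u :: real assume "\<bar>u\<bar> \<le> 1"
    then have "\<bar>R - (R - u / N)\<bar> \<le> 1 / N" using N by (simp add: field_simps)
    then show "W t (R - u / N) = lam * (R - u / N)" using far(3) t by (intro W_outer)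
  qed
  also have "\<dots> = (LINT u|lborel. lam * R * \<phi> u - lam / N * (\<phi> u * u))"
    unfolding avg_def by (simp add: algebra_simps)
  also have "\<dots> = lam * R - lam / N * (LINT u|lborel. \<phi> u * u)"
  proof -
    have "integrable lborel (\<lambda>u. \<phi> u * u)"
      by (rule integrable_kernel_times[where C=1]) auto
    then show ?thesis using integrable_kernel integral_kernel by simp
  qed
  also have "(LINT u|lborel. \<phi> u * u) = 0" by (rule kernel_integral_odd) simp
  finally show "wn N t R = lam * R" by simp
qed

text \<open>At a fixed R > 0 the jump term vanishes as soon as 1/n < R, so pointwise limits do not
  see the cavity at all; its energy has to be recovered from integrals.\<close>

lemma averages_tendsto:
  assumes t: "0 < t" and R: "0 < R" "R \<noteq> \<sigma> * t"
  shows "(\<lambda>n. wn (real n) t R) \<longlonglongrightarrow> t * r (R / t)"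
    "(\<lambda>n. dwn (real n) t R) \<longlonglongrightarrow> q (R / t)"
    "(\<lambda>n. tn (real n) t R) \<longlonglongrightarrow> p (R / t)"
proof -
  have "(\<lambda>n. wn (real n) t R) \<longlonglongrightarrow> W t R"
    unfolding wn_def
    by (rule avg_tendsto[OF _ W_isCont W_abs_le[OF t, where K="R + 1"]]) (use t R in auto)
  then show "(\<lambda>n. wn (real n) t R) \<longlonglongrightarrow> t * r (R / t)" using R by (simp add: W_eq)
  have "(\<lambda>n. tn (real n) t R) \<longlonglongrightarrow> Wp t R"
    unfolding tn_def by (rule avg_tendsto[OF _ Wp_isCont Wp_abs_le[OF t]]) (use t R in auto)
  then show "(\<lambda>n. tn (real n) t R) \<longlonglongrightarrow> p (R / t)" using R by (simp add: Wp_def)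
  have "(\<lambda>n. avg (real n) (Wq t) R) \<longlonglongrightarrow> Wq t R"
    by (rule avg_tendsto[OF _ Wq_isCont, where C=lam]) (use t R Wq_bounds in auto)
  moreover have "\<forall>\<^sub>F n in sequentially. avg (real n) (Wq t) R = dwn (real n) t R"
  proof -
    obtain k where k: "1 / R < real k" using reals_Archimedean2 by blast
    have "avg (real n) (Wq t) R = dwn (real n) t R" if "k \<le> n" for n
    proof (rule dwn_far[symmetric])
      have "1 / R < real n" using k that by (meson less_le_trans of_nat_mono)
      moreover have "0 < 1 / R" using R by simp
      ultimately show n: "0 < real n" by linarith
      show "1 / real n < R" using \<open>1 / R < real n\<close> n R by (simp add: field_simps)
    qed
    then show ?thesis by (auto simp: eventually_sequentially)
  qed
  ultimately show "(\<lambda>n. dwn (real n) t R) \<longlonglongrightarrow> q (R / t)"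
    using R by (auto simp: Wq_def elim: Lim_transform_eventually)
qed

end

section \<open>The limit of the averaged energy\<close>

text \<open>For large v this is the hypothesis on h(v)/v, and on the remaining compact interval
  continuity bounds the remainder. The lower end \<open>v0 > 0\<close> keeps away from the
  singularity of h at 0.\<close>

lemma sublinear_remainder_bound:
  fixes h :: "real \<Rightarrow> real"
  assumes cont: "continuous_on {0<..} h" and lim: "((\<lambda>v. h v / v) \<longlongrightarrow> L) at_top"
    and "0 < v0" "0 < \<epsilon>"
  obtains A where "0 \<le> A" "\<And>v. v0 \<le> v \<Longrightarrow> \<bar>h v - L * v\<bar> \<le> A + \<epsilon> * v"
proof -
  have "\<forall>\<^sub>F v in at_top. \<bar>h v / v - L\<bar> < \<epsilon>"
    using tendstoD[OF lim \<open>0 < \<epsilon>\<close>] by (simp add: dist_real_def)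
  then obtain V where V: "\<And>v. V \<le> v \<Longrightarrow> \<bar>h v / v - L\<bar> < \<epsilon>"
    by (auto simp: eventually_at_top_linorder)
  have "compact ((\<lambda>v. h v - L * v) ` {v0..max v0 V})"
    by (intro compact_continuous_image continuous_intros continuous_on_subset[OF cont])
      (use \<open>0 < v0\<close> in auto)
  then obtain A where A: "\<forall>y\<in>(\<lambda>v. h v - L * v) ` {v0..max v0 V}. norm y \<le> A"
    using compact_imp_bounded bounded_iff by metis
  have "\<bar>h v - L * v\<bar> \<le> \<bar>A\<bar> + \<epsilon> * v" if v: "v0 \<le> v" for v
  proof (cases "v \<le> max v0 V")
    case True
    then have "\<bar>h v - L * v\<bar> \<le> A" using A v by auto
    moreover have "0 \<le> \<epsilon> * v" using v assms by simp
    ultimately show ?thesis by linarith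
  next
    case False
    then have v': "V \<le> v" "0 < v" using v assms by auto
    have "h v - L * v = (h v / v - L) * v" using v' by (simp add: field_simps)
    then have "\<bar>h v - L * v\<bar> = \<bar>h v / v - L\<bar> * v" using v' by (simp add: abs_mult)
    also have "\<dots> \<le> \<epsilon> * v" using V[OF v'(1)] v' by (intro mult_right_mono) auto
    finally show ?thesis by linarith
  qed
  then show ?thesis using that[of "\<bar>A\<bar>"] by simp
qed

locale averaged_energy = averaged_profile \<phi> r q lam \<sigma> H d \<delta> m
  for \<phi> r q lam \<sigma> H d \<delta> m +
  fixes h :: "real \<Rightarrow> real" and L :: real
  assumes h_measurable[measurable]: "h \<in> borel_measurable borel"
    and h_cont: "continuous_on {0<..} h"
    and h_lim: "((\<lambda>v. h v / v) \<longlongrightarrow> L) at_top"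
begin

definition vol :: "real \<Rightarrow> real" where "vol s = q s * (r s / s) ^ (d - 1)"

definition density :: "real \<Rightarrow> real" where
  "density s = 1/2 * (p s)\<^sup>2 + 1/2 * ((q s)\<^sup>2 + real (d - 1) * (r s / s)\<^sup>2) + h (vol s)"

text \<open>The energy density of the homogeneous outer state.\<close>

definition Wlam :: real where
  "Wlam = 1/2 * (lam\<^sup>2 + real (d - 1) * lam\<^sup>2) + h (lam * lam ^ (d - 1))"

definition kin_el :: "real \<Rightarrow> real \<Rightarrow> real \<Rightarrow> real" where
  "kin_el N t R = 1/2 * (tn N t R)\<^sup>2 + 1/2 * ((dwn N t R)\<^sup>2 + real (d - 1) * (wn N t R / R)\<^sup>2)"

definition gn :: "real \<Rightarrow> real \<Rightarrow> real \<Rightarrow> real" where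
  "gn N t R = kin_el N t R + h (vn N t R)"

text \<open>The part \<open>L * v\<close> of the stored energy is split off: multiplied by $R^{d-1}$ it is the exact derivative
  $\frac Ld\,\partial_R (w^n)^d$, whose integral does not see the concentration at the cavity, while the remaining
  part does not concentrate.\<close>

definition Fn :: "real \<Rightarrow> real \<Rightarrow> real \<Rightarrow> real" where
  "Fn N t R = R ^ (d - 1) * (kin_el N t R + (h (vn N t R) - L * vn N t R) - Wlam)"

definition F :: "real \<Rightarrow> real \<Rightarrow> real" where
  "F t R = R ^ (d - 1) * (density (R / t) - L * vol (R / t) - Wlam)"

lemma vn_measurable[measurable]: "0 < t \<Longrightarrow> vn N t \<in> borel_measurable borel"
  unfolding vn_def[abs_def] by measurable

lemma gn_measurable[measurable]: "0 < t \<Longrightarrow> gn N t \<in> borel_measurable borel"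
  unfolding gn_def[abs_def] kin_el_def by measurable

lemma Fn_measurable[measurable]: "0 < t \<Longrightarrow> Fn N t \<in> borel_measurable borel"
  unfolding Fn_def[abs_def] kin_el_def by measurable

lemma vol_pos: "0 < s \<Longrightarrow> 0 < vol s"
  using vol_lower[of s] H by (simp add: vol_def)

lemma power_vn:
  assumes "0 < R" shows "R ^ (d - 1) * vn N t R = dwn N t R * wn N t R ^ (d - 1)"
  using assms by (simp add: vn_def power_divide)

section \<open>Bounds on the energy density near the cavity and away from it\<close>

lemma kin_el_le:
  assumes "0 < N" "0 < t" "0 < R" and S: "dwn N t R \<le> S" "wn N t R / R \<le> S"
  shows "0 \<le> kin_el N t R" "kin_el N t R \<le> (lam * \<sigma>)\<^sup>2 + real d * S\<^sup>2"
proof -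
  show "0 \<le> kin_el N t R" by (simp add: kin_el_def)
  have 1: "(tn N t R)\<^sup>2 \<le> (lam * \<sigma>)\<^sup>2"
    using power_mono[OF tn_abs_le[OF assms(1,2), of R], of 2] by simp
  have 2: "(dwn N t R)\<^sup>2 \<le> S\<^sup>2"
    using S(1) dwn_pos[OF assms(1,2), of R] assms by (intro power_mono) auto
  have "(wn N t R / R)\<^sup>2 \<le> S\<^sup>2"
    using S(2) wn_pos[OF assms(1-3)] assms by (intro power_mono) auto
  then have "real (d - 1) * (wn N t R / R)\<^sup>2 \<le> real (d - 1) * S\<^sup>2" by (intro mult_left_mono) auto
  moreover have "S\<^sup>2 + real (d - 1) * S\<^sup>2 = real d * S\<^sup>2"
    using d by (simp add: algebra_simps of_nat_diff)
  moreover have "0 \<le> real d * S\<^sup>2" "0 \<le> (lam * \<sigma>)\<^sup>2" by simp_all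
  moreover have "1/2 * a + 1/2 * (b + c) \<le> A + B"
    if "a \<le> A" "b + c \<le> B" "0 \<le> A" "0 \<le> B" for a b c A B :: real
    using that by argo
  ultimately show "kin_el N t R \<le> (lam * \<sigma>)\<^sup>2 + real d * S\<^sup>2"
    using 1 2 unfolding kin_el_def by (metis add_mono)
qed

text \<open>For R \<le> 1/N all stretches are at most N S. As d \<ge> 3, R^(d-1) N^2 is at most 1,
  so the quadratic terms stay bounded; and R^(d-1) v is at most N S^d, so the sublinear remainder
  costs no more than \<open>\<epsilon>\<close> N. On an interval of length 1/N this integrates to
  \<open>\<epsilon>\<close>.\<close>

lemma Fn_near_bound:
  assumes t: "0 < t" and "0 < \<epsilon>"
  obtains C where "0 \<le> C"
    "\<And>N R. 1 \<le> N \<Longrightarrow> 0 < R \<Longrightarrow> R \<le> 1 / N \<Longrightarrow> \<bar>Fn N t R\<bar> \<le> C + \<epsilon> * N"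
proof -
  obtain M where M: "0 < M" "\<And>u. \<phi> u \<le> M" by (rule kernel_bounded, rule that)
  obtain v where v: "0 < v" "\<And>N R. 1 \<le> N \<Longrightarrow> 0 < R \<Longrightarrow> v \<le> vn N t R"
    using vn_lower[OF t] by blast
  define S where "S = 2 * (t * r 0) * M + lam"
  have S: "0 < S" using t M lam r_pos[of 0] by (simp add: S_def add_pos_pos)
  \<comment> \<open>The divisor \<open>S ^ d\<close> anticipates the bound N S^d for R^(d-1) times
    the volume ratio.\<close>
  obtain A where A: "0 \<le> A" "\<And>x. v \<le> x \<Longrightarrow> \<bar>h x - L * x\<bar> \<le> A + \<epsilon> / S ^ d * x"
    using sublinear_remainder_bound[OF h_cont h_lim v(1), of "\<epsilon> / S ^ d"] S \<open>0 < \<epsilon>\<close> by auto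
  define C where "C = (lam * \<sigma>)\<^sup>2 + real d * S\<^sup>2 + A + \<bar>Wlam\<bar>"
  have "\<bar>Fn N t R\<bar> \<le> C + \<epsilon> * N" if N1: "1 \<le> N" and R: "0 < R" "R \<le> 1 / N" for N R
  proof -
    have N: "0 < N" using N1 by simp
    have "2 * (t * r 0) * N * M + lam \<le> N * S"
      using N1 lam by (simp add: S_def algebra_simps)
    then have le: "dwn N t R \<le> N * S" "wn N t R / R \<le> N * S"
      using dwn_le[OF N t M(2), of R] wn_slope_le[OF N t R(1) M(2)] by linarith+
    have NR: "N * R \<le> 1" using R N by (simp add: field_simps)
    have "(R ^ (d - 1)) * N\<^sup>2 \<le> R\<^sup>2 * N\<^sup>2"
    proof (rule mult_right_mono)
      have "1 / N \<le> 1" using N1 by simp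
      then have "R \<le> 1" using R by linarith
      then show "R ^ (d - 1) \<le> R\<^sup>2" using R d by (intro power_decreasing) auto
    qed simp
    also have "R\<^sup>2 * N\<^sup>2 = (N * R)\<^sup>2" by (simp add: power_mult_distrib)
    also have "\<dots> \<le> 1" using NR N R by (intro power_le_one) auto
    finally have R2: "R ^ (d - 1) * N\<^sup>2 \<le> 1" .
    have Rp: "0 \<le> R ^ (d - 1)" using R by simp
    have "R ^ (d - 1) \<le> R ^ (d - 1) * N\<^sup>2"
      using mult_left_mono[OF one_le_power[OF N1, of 2] Rp] by simp
    then have R1: "R ^ (d - 1) \<le> 1" using R2 by linarith
    have "R ^ (d - 1) * kin_el N t R \<le> R ^ (d - 1) * ((lam * \<sigma>)\<^sup>2 + real d * (N * S)\<^sup>2)"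
      using kin_el_le(2)[OF N t R(1) le] Rp by (rule mult_left_mono)
    also have "\<dots> = R ^ (d - 1) * (lam * \<sigma>)\<^sup>2 + (R ^ (d - 1) * N\<^sup>2) * (real d * S\<^sup>2)"
      by (simp add: power_mult_distrib algebra_simps)
    also have "\<dots> \<le> 1 * (lam * \<sigma>)\<^sup>2 + 1 * (real d * S\<^sup>2)"
      by (intro add_mono mult_right_mono R1 R2) auto
    finally have 1: "R ^ (d - 1) * kin_el N t R \<le> (lam * \<sigma>)\<^sup>2 + real d * S\<^sup>2" by simp
    have nn: "0 \<le> R ^ (d - 1) * kin_el N t R" using kin_el_le(1)[OF N t R(1) le] Rp by simp
    have "wn N t R \<le> N * S * R" using le(2) R by (simp add: field_simps)
    also have "\<dots> \<le> S" using mult_right_mono[OF NR, of S] S by (simp add: mult_ac)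
    finally have wS: "wn N t R \<le> S" .
    have "R ^ (d - 1) * vn N t R \<le> (N * S) * S ^ (d - 1)"
      unfolding power_vn[OF R(1)]
      using le(1) wS wn_pos[OF N t R(1)] N S
      by (intro mult_mono power_mono) auto
    also have "\<dots> = N * S ^ d" using d by (cases d) (simp_all add: mult_ac)
    finally have vS: "R ^ (d - 1) * vn N t R \<le> N * S ^ d" .
    have "R ^ (d - 1) * \<bar>h (vn N t R) - L * vn N t R\<bar> \<le> R ^ (d - 1) * (A + \<epsilon> / S ^ d * vn N t R)"
      using A(2)[OF v(2)[OF N1 R(1)]] Rp by (rule mult_left_mono)
    also have "\<dots> = R ^ (d - 1) * A + \<epsilon> / S ^ d * (R ^ (d - 1) * vn N t R)"
      by (simp add: algebra_simps)
    also have "\<dots> \<le> 1 * A + \<epsilon> / S ^ d * (N * S ^ d)"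
      using \<open>0 < \<epsilon>\<close> S by (intro add_mono mult_right_mono mult_left_mono R1 vS A(1)) auto
    also have "\<dots> = A + \<epsilon> * N" using S by simp
    finally have 2: "R ^ (d - 1) * \<bar>h (vn N t R) - L * vn N t R\<bar> \<le> A + \<epsilon> * N" .
    have 3: "R ^ (d - 1) * \<bar>Wlam\<bar> \<le> \<bar>Wlam\<bar>"
      using mult_right_mono[OF R1, of "\<bar>Wlam\<bar>"] by simp
    have "\<bar>Fn N t R\<bar> \<le> R ^ (d - 1) * kin_el N t R + R ^ (d - 1) * \<bar>h (vn N t R) - L * vn N t R\<bar> + R ^ (d - 1) * \<bar>Wlam\<bar>"
    proof -
      have "\<bar>kin_el N t R + (h (vn N t R) - L * vn N t R) - Wlam\<bar>
        \<le> kin_el N t R + \<bar>h (vn N t R) - L * vn N t R\<bar> + \<bar>Wlam\<bar>"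
        using kin_el_le(1)[OF N t R(1) le] by linarith
      from mult_left_mono[OF this Rp] show ?thesis
        unfolding Fn_def abs_mult using Rp by (simp add: distrib_left)
    qed
    then show ?thesis using 1 2 3 unfolding C_def by linarith
  qed
  moreover have "0 \<le> C" using A(1) by (simp add: C_def)
  ultimately show ?thesis using that by blast
qed

text \<open>Beyond 1/N the jump term is gone, so the radial stretch is at most \<open>lam\<close>
  and w is bounded. The weight R^(d-1) absorbs the factor R^(-2) of the tangential stretches and
  leaves R^(d-3), which is bounded as d \<ge> 3. The constant does not depend on N and thus serves
  as a dominating function.\<close>

lemma Fn_far_bound:
  assumes t: "0 < t" and K: "0 < K"
  obtains C where "0 \<le> C"
    "\<And>N R. 1 \<le> N \<Longrightarrow> 1 / N < R \<Longrightarrow> R \<le> K \<Longrightarrow> \<bar>Fn N t R\<bar> \<le> C"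
proof -
  obtain v where v: "0 < v" "\<And>N R. 1 \<le> N \<Longrightarrow> 0 < R \<Longrightarrow> v \<le> vn N t R"
    using vn_lower[OF t] by blast
  obtain A where A: "0 \<le> A" "\<And>x. v \<le> x \<Longrightarrow> \<bar>h x - L * x\<bar> \<le> A + 1 * x"
    using sublinear_remainder_bound[OF h_cont h_lim v(1), of 1] by auto
  define S where "S = t * (lam * max \<sigma> ((K + 1) / t))"
  have S: "0 < S" using t lam sig by (simp add: S_def less_max_iff_disj)
  define C where "C = (K ^ (d - 1) * ((lam * \<sigma>)\<^sup>2 + lam\<^sup>2) + real d * K ^ (d - 3) * S\<^sup>2)
     + (K ^ (d - 1) * A + lam * S ^ (d - 1)) + K ^ (d - 1) * \<bar>Wlam\<bar>"
  have "\<bar>Fn N t R\<bar> \<le> C" if N1: "1 \<le> N" and R: "1 / N < R" "R \<le> K" for N R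
  proof -
    have N: "0 < N" using N1 by simp
    have R0: "0 < R" using R N by (meson less_trans zero_less_divide_1_iff)
    have Rp: "0 \<le> R ^ (d - 1)" using R0 by simp
    have RK: "R ^ (d - 1) \<le> K ^ (d - 1)" using R R0 by (intro power_mono) auto
    have dl: "dwn N t R \<le> lam" "0 < dwn N t R" using dwn_far_le[OF N R(1)] dwn_pos[OF N t, of R] R0 by auto
    have wl: "wn N t R \<le> S" "0 < wn N t R" using wn_le[OF N1 t _ R(2)] wn_pos[OF N t R0] R0 by (auto simp: S_def)
    have 0: "0 \<le> kin_el N t R" by (simp add: kin_el_def)
    have a: "(tn N t R)\<^sup>2 \<le> (lam * \<sigma>)\<^sup>2"
      using power_mono[OF tn_abs_le[OF N t, of R], of 2] by simp
    have b: "(dwn N t R)\<^sup>2 \<le> lam\<^sup>2" using dl by (intro power_mono) auto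
    have "d - 1 = d - 3 + 2" using d by simp
    then have "R ^ (d - 1) = R ^ (d - 3) * R\<^sup>2"
      by (simp only: power_add)
    then have "R ^ (d - 1) * (wn N t R / R)\<^sup>2 = R ^ (d - 3) * (wn N t R)\<^sup>2"
      using R0 by (simp add: power_divide)
    also have "\<dots> \<le> K ^ (d - 3) * S\<^sup>2"
      using R R0 wl K by (intro mult_mono power_mono) auto
    finally have c: "R ^ (d - 1) * (wn N t R / R)\<^sup>2 \<le> K ^ (d - 3) * S\<^sup>2" .
    have "R ^ (d - 1) * kin_el N t R \<le> R ^ (d - 1) * ((lam * \<sigma>)\<^sup>2 + lam\<^sup>2) + real d * (R ^ (d - 1) * (wn N t R / R)\<^sup>2)"
    proof -
      have "0 \<le> (wn N t R / R)\<^sup>2" by simp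
      moreover have "real (d - 1) * (wn N t R / R)\<^sup>2 \<le> real d * (wn N t R / R)\<^sup>2"
        by (intro mult_right_mono) auto
      moreover have "0 \<le> real d * (wn N t R / R)\<^sup>2" "0 \<le> (lam * \<sigma>)\<^sup>2" "0 \<le> lam\<^sup>2" by simp_all
      moreover have "1/2 * a + 1/2 * (b + c) \<le> A + B + D"
        if "a \<le> A" "b \<le> B" "c \<le> D" "0 \<le> A" "0 \<le> B" "0 \<le> D" for a b c A B D :: real
        using that by argo
      ultimately have "kin_el N t R \<le> ((lam * \<sigma>)\<^sup>2 + lam\<^sup>2) + real d * (wn N t R / R)\<^sup>2"
        using a b unfolding kin_el_def by blast
      from mult_left_mono[OF this Rp] show ?thesis by (simp add: algebra_simps)
    qed
    also have "\<dots> \<le> K ^ (d - 1) * ((lam * \<sigma>)\<^sup>2 + lam\<^sup>2) + real d * (K ^ (d - 3) * S\<^sup>2)"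
      by (intro add_mono mult_right_mono mult_left_mono RK c) auto
    finally have 1: "R ^ (d - 1) * kin_el N t R \<le> K ^ (d - 1) * ((lam * \<sigma>)\<^sup>2 + lam\<^sup>2) + real d * K ^ (d - 3) * S\<^sup>2"
      by simp
    have "R ^ (d - 1) * vn N t R \<le> lam * S ^ (d - 1)"
      unfolding power_vn[OF R0] using dl wl lam by (intro mult_mono power_mono) auto
    moreover have "R ^ (d - 1) * \<bar>h (vn N t R) - L * vn N t R\<bar> \<le> R ^ (d - 1) * (A + 1 * vn N t R)"
      using A(2)[OF v(2)[OF N1 R0]] Rp by (rule mult_left_mono)
    moreover have "R ^ (d - 1) * A \<le> K ^ (d - 1) * A" using RK A(1) by (rule mult_right_mono)
    ultimately have 2: "R ^ (d - 1) * \<bar>h (vn N t R) - L * vn N t R\<bar> \<le> K ^ (d - 1) * A + lam * S ^ (d - 1)"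
      by (simp add: algebra_simps)
    have 3: "R ^ (d - 1) * \<bar>Wlam\<bar> \<le> K ^ (d - 1) * \<bar>Wlam\<bar>"
      using RK by (rule mult_right_mono) simp
    have "\<bar>kin_el N t R + (h (vn N t R) - L * vn N t R) - Wlam\<bar>
        \<le> kin_el N t R + \<bar>h (vn N t R) - L * vn N t R\<bar> + \<bar>Wlam\<bar>"
      using 0 by linarith
    from mult_left_mono[OF this Rp]
    have "\<bar>Fn N t R\<bar> \<le> R ^ (d - 1) * kin_el N t R + R ^ (d - 1) * \<bar>h (vn N t R) - L * vn N t R\<bar> + R ^ (d - 1) * \<bar>Wlam\<bar>"
      unfolding Fn_def abs_mult using Rp by (simp add: distrib_left)
    then show ?thesis using 1 2 3 unfolding C_def by linarith
  qed
  moreover have "0 \<le> C"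
    using A(1) K S lam sig by (auto simp: C_def intro!: add_nonneg_nonneg mult_nonneg_nonneg)
  ultimately show ?thesis using that by blast
qed

text \<open>The constant grows with N; the bound serves integrability at each fixed scale.\<close>

lemma gn_bound:
  assumes t: "0 < t" and N1: "1 \<le> N"
  obtains C where "\<And>R. 0 < R \<Longrightarrow> \<bar>gn N t R\<bar> \<le> C"
proof -
  have N: "0 < N" using N1 by simp
  obtain M where M: "0 < M" "\<And>u. \<phi> u \<le> M" by (rule kernel_bounded, rule that)
  obtain v where v: "0 < v" "\<And>N R. 1 \<le> N \<Longrightarrow> 0 < R \<Longrightarrow> v \<le> vn N t R"
    using vn_lower[OF t] by blast
  obtain A where A: "0 \<le> A" "\<And>x. v \<le> x \<Longrightarrow> \<bar>h x - L * x\<bar> \<le> A + 1 * x"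
    using sublinear_remainder_bound[OF h_cont h_lim v(1), of 1] by auto
  define S where "S = 2 * (t * r 0) * N * M + lam"
  have "\<bar>gn N t R\<bar> \<le> (lam * \<sigma>)\<^sup>2 + real d * S\<^sup>2 + (A + (1 + \<bar>L\<bar>) * (S * S ^ (d - 1)))"
    if R: "0 < R" for R
  proof -
    have le: "dwn N t R \<le> S" "wn N t R / R \<le> S"
      using dwn_le[OF N t M(2), of R] wn_slope_le[OF N t R M(2)] by (auto simp: S_def)
    have vle: "vn N t R \<le> S * S ^ (d - 1)" unfolding vn_def
      using le dwn_pos[OF N t, of R] wn_pos[OF N t R] R
      by (intro mult_mono power_mono) (auto intro: order_trans[of 0 "dwn N t R"])
    have v0: "0 < vn N t R" using v(2)[OF N1 R] v(1) by linarith
    have "\<bar>h (vn N t R)\<bar> \<le> \<bar>h (vn N t R) - L * vn N t R\<bar> + \<bar>L * vn N t R\<bar>" by linarith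
    also have "\<dots> \<le> (A + 1 * vn N t R) + \<bar>L\<bar> * vn N t R"
      using A(2)[OF v(2)[OF N1 R]] v0 by (simp add: abs_mult)
    also have "\<dots> = A + (1 + \<bar>L\<bar>) * vn N t R" by (simp add: algebra_simps)
    also have "\<dots> \<le> A + (1 + \<bar>L\<bar>) * (S * S ^ (d - 1))"
      using vle by (intro add_left_mono mult_left_mono) auto
    finally show ?thesis using kin_el_le[OF N t R le] unfolding gn_def by linarith
  qed
  then show ?thesis using that by blast
qed

lemma Fn_tendsto:
  assumes t: "0 < t" and R: "0 < R" "R \<noteq> \<sigma> * t"
  shows "(\<lambda>n. Fn (real n) t R) \<longlonglongrightarrow> F t R"
proof -
  note lims = averages_tendsto[OF t R]
  have "(\<lambda>n. wn (real n) t R / R) \<longlonglongrightarrow> t * r (R / t) / R"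
    by (intro tendsto_intros lims) (use R in auto)
  then have w: "(\<lambda>n. wn (real n) t R / R) \<longlonglongrightarrow> r (R / t) / (R / t)"
    by (simp add: mult.commute)
  have v: "(\<lambda>n. vn (real n) t R) \<longlonglongrightarrow> vol (R / t)"
    unfolding vn_def vol_def by (intro tendsto_intros w lims)
  have "isCont h (vol (R / t))"
    using h_cont vol_pos[of "R / t"] R t by (simp add: continuous_on_eq_continuous_at)
  then have "(\<lambda>n. h (vn (real n) t R)) \<longlonglongrightarrow> h (vol (R / t))"
    by (rule isCont_tendsto_compose[OF _ v])
  then have "(\<lambda>n. Fn (real n) t R) \<longlonglongrightarrow>
    R ^ (d - 1) * ((1/2 * (p (R / t))\<^sup>2 + 1/2 * ((q (R / t))\<^sup>2 + real (d - 1) * (r (R / t) / (R / t))\<^sup>2))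
      + (h (vol (R / t)) - L * vol (R / t)) - Wlam)"
    unfolding Fn_def kin_el_def by (intro tendsto_intros w lims v)
  then show ?thesis by (simp add: F_def density_def algebra_simps)
qed

text \<open>The profile is controlled on the nonnegative half line only. Inserting |R| gives a
  function that is measurable on all reals and unchanged where the indicator is nonzero.\<close>

lemma F_measurable[measurable]: "0 < t \<Longrightarrow> (\<lambda>R. indicator {0<..} R * F t R) \<in> borel_measurable borel"
proof -
  assume "0 < t"
  then have "(\<lambda>R. indicator {0<..} R * F t \<bar>R\<bar>) \<in> borel_measurable borel"
    unfolding F_def density_def p_def vol_def by measurable
  moreover have "indicator {0<..} R * F t \<bar>R\<bar> = indicator {0<..} R * F t R" for R
    by (simp add: indicator_def)
  ultimately show ?thesis by simp
qed

section \<open>Limits of the radial integrals\<close>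

lemma Fn_integrable:
  assumes t: "0 < t" and K: "0 < K" and n: "1 \<le> n"
  shows "set_integrable lborel {0<..K} (Fn (real n) t)"
proof -
  obtain C where C: "0 \<le> C" "\<And>N R. 1 \<le> N \<Longrightarrow> 0 < R \<Longrightarrow> R \<le> 1 / N \<Longrightarrow> \<bar>Fn N t R\<bar> \<le> C + 1 * N"
    using Fn_near_bound[OF t, of 1] by auto
  obtain D where D: "0 \<le> D" "\<And>N R. 1 \<le> N \<Longrightarrow> 1 / N < R \<Longrightarrow> R \<le> K \<Longrightarrow> \<bar>Fn N t R\<bar> \<le> D"
    using Fn_far_bound[OF t K] by blast
  show ?thesis unfolding set_integrable_def
  proof (rule integrableI_bounded_set_indicator[where B="C + real n + D"])
    show "AE x in lborel. x \<in> {0<..K} \<longrightarrow> norm (Fn (real n) t x) \<le> C + real n + D"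
    proof (intro AE_I2 impI)
      fix x assume "x \<in> {0<..K}"
      then show "norm (Fn (real n) t x) \<le> C + real n + D"
        using C(1) C(2)[of "real n" x] D(1) D(2)[of "real n" x] n by (cases "x \<le> 1 / real n") auto
    qed
  qed (use t K in \<open>auto simp: emeasure_lborel_Ioc\<close>)
qed

text \<open>An integrand of size C + (\<open>\<epsilon>\<close>/2) n on an interval of length 1/n
  contributes at most C/n + \<open>\<epsilon>\<close>/2.\<close>

lemma near_integral_tendsto_0:
  assumes t: "0 < t" and K: "0 < K"
  shows "(\<lambda>n. LINT R:{0<..K}|lborel. indicator {..1 / real n} R * Fn (real n) t R) \<longlonglongrightarrow> 0"
proof (rule LIMSEQ_I)
  fix \<epsilon> :: real assume e: "0 < \<epsilon>"
  then obtain C where C: "0 \<le> C" "\<And>N R. 1 \<le> N \<Longrightarrow> 0 < R \<Longrightarrow> R \<le> 1 / N \<Longrightarrow> \<bar>Fn N t R\<bar> \<le> C + \<epsilon> / 2 * N"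
    using Fn_near_bound[OF t, of "\<epsilon> / 2"] by auto
  obtain n0 where n0: "2 * C / \<epsilon> < real n0" using reals_Archimedean2 by blast
  have "norm ((LINT R:{0<..K}|lborel. indicator {..1 / real n} R * Fn (real n) t R) - 0) < \<epsilon>"
    if n: "max 1 n0 \<le> n" for n
  proof -
    have n1: "1 \<le> real n" "real n0 \<le> real n" using n by auto
    have "norm (LINT R:{0<..K}|lborel. indicator {..1 / real n} R * Fn (real n) t R)
      \<le> (LINT R|lborel. (C + \<epsilon> / 2 * real n) * indicator {0<..1 / real n} R)"
      unfolding set_lebesgue_integral_def
    proof (rule Bochner_Integration.integral_norm_bound_integral)
      have "set_integrable lborel {0<..K} (Fn (real n) t)" using Fn_integrable[OF t K, of n] n by simp
      then have "integrable lborel (\<lambda>R. indicator {..1 / real n} R *\<^sub>R (indicator {0<..K} R *\<^sub>R Fn (real n) t R))"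
        unfolding set_integrable_def by (intro integrable_mult_indicator[of "{..1 / real n}"]) auto
      then show "integrable lborel (\<lambda>R. indicator {0<..K} R *\<^sub>R (indicator {..1 / real n} R * Fn (real n) t R))"
        by (simp only: real_scaleR_def mult.left_commute)
      show "integrable lborel (\<lambda>R. (C + \<epsilon> / 2 * real n) * indicator {0<..1 / real n} R)"
        by (intro integrable_mult_right integrable_real_indicator) (use K in auto)
      show "norm (indicator {0<..K} R *\<^sub>R (indicator {..1 / real n} R * Fn (real n) t R))
          \<le> (C + \<epsilon> / 2 * real n) * indicator {0<..1 / real n} R" for R
        using C(1) C(2)[OF n1(1), of R] e by (auto simp: indicator_def)
    qed
    also have "\<dots> = (C + \<epsilon> / 2 * real n) * (1 / real n)" by simp
    also have "\<dots> = C / real n + \<epsilon> / 2" using n1 by (simp add: field_simps)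
    also have "\<dots> < \<epsilon>"
    proof -
      have "2 * C / \<epsilon> < real n" using n0 n1 by linarith
      then have "C / real n < \<epsilon> / 2" using e n1 by (simp add: field_simps)
      then show ?thesis by linarith
    qed
    finally show ?thesis by simp
  qed
  then show "\<exists>no. \<forall>n\<ge>no. norm ((LINT R:{0<..K}|lborel. indicator {..1 / real n} R * Fn (real n) t R) - 0) < \<epsilon>"
    by blast
qed

lemma far_integral_tendsto:
  assumes t: "0 < t" and K: "0 < K"
  shows "set_integrable lborel {0<..K} (F t)"
    "(\<lambda>n. LINT R:{0<..K}|lborel. indicator {1 / real n<..} R * Fn (real n) t R) \<longlonglongrightarrow> (LINT R:{0<..K}|lborel. F t R)"
proof -
  obtain C where C: "0 \<le> C" "\<And>N R. 1 \<le> N \<Longrightarrow> 1 / N < R \<Longrightarrow> R \<le> K \<Longrightarrow> \<bar>Fn N t R\<bar> \<le> C"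
    using Fn_far_bound[OF t K] by blast
  let ?s = "\<lambda>n R. indicator {0<..K} R *\<^sub>R (indicator {1 / real (Suc n)<..} R * Fn (real (Suc n)) t R)"
  have m: "(\<lambda>R. indicator {0<..K} R *\<^sub>R F t R) \<in> borel_measurable lborel"
  proof -
    have "(\<lambda>R. indicator {..K} R * (indicator {0<..} R * F t R)) \<in> borel_measurable borel" using t by measurable
    moreover have "indicator {..K} R * (indicator {0<..} R * F t R) = indicator {0<..K} R *\<^sub>R F t R" for R
      by (auto simp: indicator_def)
    ultimately show ?thesis by simp
  qed
  have ms: "?s n \<in> borel_measurable lborel" for n using t by measurable
  have w: "integrable lborel (\<lambda>R. C * indicator {0<..K} R)"
    by (intro integrable_mult_right integrable_real_indicator) (use K in auto)
  have lim: "AE R in lborel. (\<lambda>n. ?s n R) \<longlonglongrightarrow> indicator {0<..K} R *\<^sub>R F t R"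
    using AE_lborel_singleton[of "\<sigma> * t"]
  proof eventually_elim
    case (elim R)
    show ?case
    proof (cases "0 < R")
      case True
      obtain k where k: "1 / R < real k" using reals_Archimedean2 by blast
      have "1 / real n < R" if "k \<le> n" for n
      proof -
        have "1 / R < real n" using k that by (meson less_le_trans of_nat_mono)
        moreover have "0 < real n" using True \<open>1 / R < real n\<close> by (meson less_trans zero_less_divide_1_iff)
        ultimately show ?thesis using True by (simp add: field_simps)
      qed
      then have ev: "\<forall>\<^sub>F n in sequentially. Fn (real n) t R = indicator {1 / real n<..} R * Fn (real n) t R"
        by (auto simp: eventually_sequentially indicator_def intro!: exI[of _ k])
      have "(\<lambda>n. indicator {1 / real n<..} R * Fn (real n) t R) \<longlonglongrightarrow> F t R"
        by (rule Lim_transform_eventually[OF Fn_tendsto[OF t True] ev]) (use elim in auto)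
      then have "(\<lambda>n. indicator {0<..K} R *\<^sub>R (indicator {1 / real n<..} R * Fn (real n) t R)) \<longlonglongrightarrow> indicator {0<..K} R *\<^sub>R F t R"
        by (intro tendsto_intros)
      then show ?thesis by (rule LIMSEQ_Suc)
    qed simp
  qed
  have bd: "AE R in lborel. norm (?s n R) \<le> C * indicator {0<..K} R" for n
    using C by (intro AE_I2) (auto simp: indicator_def)
  show "set_integrable lborel {0<..K} (F t)"
    unfolding set_integrable_def by (rule integrable_dominated_convergence[OF m ms w lim bd])
  have "(\<lambda>n. integral\<^sup>L lborel (?s n)) \<longlonglongrightarrow> (LINT R|lborel. indicator {0<..K} R *\<^sub>R F t R)"
    by (rule integral_dominated_convergence[OF m ms w lim bd])
  then show "(\<lambda>n. LINT R:{0<..K}|lborel. indicator {1 / real n<..} R * Fn (real n) t R) \<longlonglongrightarrow> (LINT R:{0<..K}|lborel. F t R)"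
    unfolding set_lebesgue_integral_def by (rule LIMSEQ_imp_Suc)
qed

text \<open>The integrand is the derivative of w^d/d. As w vanishes at the origin there is no lower
  boundary term: the image of the averaged map includes the cavity. The corresponding integral of
  the fan profile is smaller by (t r(0))^d / d, and this difference, times L, is the energy of the
  cavity.\<close>

lemma volume_integral:
  assumes t: "0 < t" and K: "0 < K" and n: "0 < N"
  shows "set_integrable lborel {0..K} (\<lambda>R. dwn N t R * wn N t R ^ (d - 1))"
    "(LINT R:{0..K}|lborel. dwn N t R * wn N t R ^ (d - 1)) = wn N t K ^ d / d"
proof -
  have d0: "0 < d" using d by simp
  have "has_bochner_integral lborel (\<lambda>R. (dwn N t R * wn N t R ^ (d - 1)) * indicator {0..K} R)
     (wn N t K ^ d / d - wn N t 0 ^ d / d)"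
  proof (rule has_bochner_integral_FTC_Icc_nonneg)
    show "((\<lambda>R. wn N t R ^ d / d) has_real_derivative dwn N t R * wn N t R ^ (d - 1)) (at R)" for R
      using DERIV_cdivide[OF DERIV_power[OF wn_deriv[OF n t], of d], of "real d"] d0 by (simp add: mult_ac)
    fix R assume "R \<in> {0..K}"
    then have "0 \<le> wn N t R" using wn_mono[OF n t, of 0 R] by (simp add: wn_0)
    then show "0 \<le> dwn N t R * wn N t R ^ (d - 1)"
      using dwn_pos[OF n t, of R] \<open>R \<in> {0..K}\<close> by simp
  qed (use K t in auto)
  then show "set_integrable lborel {0..K} (\<lambda>R. dwn N t R * wn N t R ^ (d - 1))"
    "(LINT R:{0..K}|lborel. dwn N t R * wn N t R ^ (d - 1)) = wn N t K ^ d / d"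
    unfolding set_integrable_def set_lebesgue_integral_def has_bochner_integral_iff
    using d0 by (simp_all add: wn_0 mult.commute)
qed

lemma set_Ioc_Icc: "set_integrable lborel {0<..K::real} f \<longleftrightarrow> set_integrable lborel {0..K} (\<lambda>R. if R = 0 then 0 else f R)"
    "(LINT R:{0<..K}|lborel. f R) = (LINT R:{0..K}|lborel. (if R = 0 then 0 else f R))"
  for f :: "real \<Rightarrow> real"
proof -
  have "indicator {0<..K} R *\<^sub>R f R = indicator {0..K} R *\<^sub>R (if R = 0 then 0 else f R)" for R
    by (auto simp: indicator_def)
  then show "set_integrable lborel {0<..K} f \<longleftrightarrow> set_integrable lborel {0..K} (\<lambda>R. if R = 0 then 0 else f R)"
    "(LINT R:{0<..K}|lborel. f R) = (LINT R:{0..K}|lborel. (if R = 0 then 0 else f R))"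
    unfolding set_integrable_def set_lebesgue_integral_def by simp_all
qed

text \<open>The near part of the remainder vanishes, the far part converges by domination, and the
  linear part is constant for all large n because the averaged amplitude at \<open>K\<close> is
  exactly \<open>lam * K\<close>.\<close>

lemma radial_energy_tendsto:
  assumes t: "0 < t" and K: "\<sigma> * t < K"
  shows "(\<lambda>n. LINT R:{0..K}|lborel. R ^ (d - 1) * (gn (real n) t R - Wlam)) \<longlonglongrightarrow>
    (LINT R:{0<..K}|lborel. F t R) + L * (lam * K) ^ d / d"
proof -
  have K0: "0 < K" using K mult_pos_pos[OF sig t] by simp
  obtain k where k: "1 / (K - \<sigma> * t) < real k" using reals_Archimedean2 by blast
  have eq: "(LINT R:{0..K}|lborel. R ^ (d - 1) * (gn (real n) t R - Wlam)) =
     (LINT R:{0<..K}|lborel. indicator {1 / real n<..} R * Fn (real n) t R)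
     + (LINT R:{0<..K}|lborel. indicator {..1 / real n} R * Fn (real n) t R) + L * (lam * K) ^ d / d"
    if n: "max 1 k \<le> n" for n
  proof -
    have n1: "1 \<le> n" "0 < real n" "real k \<le> real n" using n by auto
    note Fi = Fn_integrable[OF t K0 n1(1)]
    have i1: "set_integrable lborel {0<..K} (\<lambda>R. indicator A R * Fn (real n) t R)" if "A \<in> sets borel" for A
    proof -
      have "integrable lborel (\<lambda>R. indicator A R *\<^sub>R (indicator {0<..K} R *\<^sub>R Fn (real n) t R))"
        using Fi that unfolding set_integrable_def by (intro integrable_mult_indicator[of A]) auto
      then show ?thesis by (simp only: set_integrable_def real_scaleR_def mult.left_commute)
    qed
    have split: "(LINT R:{0<..K}|lborel. Fn (real n) t R) =
     (LINT R:{0<..K}|lborel. indicator {1 / real n<..} R * Fn (real n) t R)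
     + (LINT R:{0<..K}|lborel. indicator {..1 / real n} R * Fn (real n) t R)"
    proof (subst set_integral_add(2)[symmetric])
      show "set_integrable lborel {0<..K} (\<lambda>R. indicator {1 / real n<..} R * Fn (real n) t R)"
        "set_integrable lborel {0<..K} (\<lambda>R. indicator {..1 / real n} R * Fn (real n) t R)"
        by (rule i1, simp)+
    qed (auto intro!: set_lebesgue_integral_cong simp: indicator_def)
    \<comment> \<open>At R = 0 both sides vanish: on the left through the weight, on the right
      because the averaged amplitude is 0 there.\<close>
    have "R ^ (d - 1) * (gn (real n) t R - Wlam) = (if R = 0 then 0 else Fn (real n) t R) + L * (dwn (real n) t R * wn (real n) t R ^ (d - 1))"
      if "R \<in> {0..K}" for R
    proof (cases "R = 0")
      case True
      then show ?thesis using d by (simp add: wn_0 zero_power)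
    next
      case False
      then have "0 < R" using that by simp
      from power_vn[OF this, of "real n" t] show ?thesis
        using False by (simp add: Fn_def gn_def algebra_simps)
    qed
    then have "(LINT R:{0..K}|lborel. R ^ (d - 1) * (gn (real n) t R - Wlam)) =
      (LINT R:{0..K}|lborel. (if R = 0 then 0 else Fn (real n) t R) + L * (dwn (real n) t R * wn (real n) t R ^ (d - 1)))"
      by (intro set_lebesgue_integral_cong) auto
    also have "\<dots> = (LINT R:{0..K}|lborel. (if R = 0 then 0 else Fn (real n) t R))
       + (LINT R:{0..K}|lborel. L * (dwn (real n) t R * wn (real n) t R ^ (d - 1)))"
      by (intro set_integral_add(2) set_integrable_mult_right volume_integral(1)[OF t K0 n1(2)])
        (use Fi set_Ioc_Icc(1) in auto)
    also have "\<dots> = (LINT R:{0<..K}|lborel. Fn (real n) t R) + L * (wn (real n) t K ^ d / d)"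
      by (simp only: set_Ioc_Icc(2) set_integral_mult_right volume_integral(2)[OF t K0 n1(2)])
    also have "wn (real n) t K = lam * K"
    proof (rule outer(2)[OF n1(2) t])
      have "1 / (K - \<sigma> * t) < real n" using k n1 by linarith
      then have "1 / real n < K - \<sigma> * t" using K n1(2) by (simp add: field_simps)
      then show "\<sigma> * t + 1 / real n \<le> K" by simp
    qed
    finally show ?thesis using split by simp
  qed
  have "(\<lambda>n. (LINT R:{0<..K}|lborel. indicator {1 / real n<..} R * Fn (real n) t R)
     + (LINT R:{0<..K}|lborel. indicator {..1 / real n} R * Fn (real n) t R) + L * (lam * K) ^ d / d)
     \<longlonglongrightarrow> (LINT R:{0<..K}|lborel. F t R) + 0 + L * (lam * K) ^ d / d"
    by (intro tendsto_intros far_integral_tendsto near_integral_tendsto_0 t K0)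
  moreover have "\<forall>\<^sub>F n in sequentially.
     (LINT R:{0<..K}|lborel. indicator {1 / real n<..} R * Fn (real n) t R)
     + (LINT R:{0<..K}|lborel. indicator {..1 / real n} R * Fn (real n) t R) + L * (lam * K) ^ d / d
     = (LINT R:{0..K}|lborel. R ^ (d - 1) * (gn (real n) t R - Wlam))"
    by (rule eventually_sequentiallyI[of "max 1 k"]) (rule eq[symmetric])
  ultimately have "(\<lambda>n. LINT R:{0..K}|lborel. R ^ (d - 1) * (gn (real n) t R - Wlam)) \<longlonglongrightarrow>
    (LINT R:{0<..K}|lborel. F t R) + 0 + L * (lam * K) ^ d / d"
    by (rule Lim_transform_eventually)
  then show ?thesis by (simp only: add_0_right)
qed

end

section \<open>The energy of the fan\<close>

locale admissible =
  fixes h :: "real \<Rightarrow> real"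
  assumes adm: "admissible_h h"
begin

lemma h_deriv: "0 < v \<Longrightarrow> (h has_real_derivative deriv h v) (at v)"
  using adm unfolding admissible_h_def by (simp add: DERIV_deriv_iff_real_differentiable)

lemma dh_deriv: "0 < v \<Longrightarrow> (deriv h has_real_derivative deriv (deriv h) v) (at v)"
  using adm unfolding admissible_h_def by (simp add: DERIV_deriv_iff_real_differentiable)

lemma ddh_pos: "0 < v \<Longrightarrow> 0 < deriv (deriv h) v"
  using adm unfolding admissible_h_def by (simp add: numeral_2_eq_2)

lemma h_continuous: "continuous_on {0<..} h"
  by (intro continuous_at_imp_continuous_on ballI DERIV_isCont[OF h_deriv]) simp

lemma dh_strict_mono:
  assumes "0 < x" "x < y" shows "deriv h x < deriv h y"
proof (rule DERIV_pos_imp_increasing[OF assms(2)])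
  fix z assume "x \<le> z" "z \<le> y"
  then have "0 < z" using assms by simp
  then show "\<exists>D. (deriv h has_real_derivative D) (at z) \<and> 0 < D"
    using dh_deriv ddh_pos by blast
qed

lemma dh_mono: "0 < x \<Longrightarrow> x \<le> y \<Longrightarrow> deriv h x \<le> deriv h y"
  using dh_strict_mono[of x y] by (cases "x = y") auto

lemma h_increment:
  assumes "0 < x" "x < y"
  shows "deriv h x * (y - x) \<le> h y - h x" "h y - h x \<le> deriv h y * (y - x)"
proof -
  obtain z where z: "x < z" "z < y" "h y - h x = (y - x) * deriv h z"
    using MVT2[of x y h "deriv h"] assms h_deriv by (metis less_le_trans)
  have "deriv h x \<le> deriv h z" "deriv h z \<le> deriv h y"
    using z assms by (auto intro!: dh_mono)
  then show "deriv h x * (y - x) \<le> h y - h x" "h y - h x \<le> deriv h y * (y - x)"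
    using z assms mult_left_mono[of "deriv h x" "deriv h z" "y - x"]
      mult_left_mono[of "deriv h z" "deriv h y" "y - x"] by (simp_all add: mult.commute)
qed

text \<open>Growth at both ends yields an interior minimum on a compact interval, where h' vanishes;
  strict monotonicity of h' makes the zero unique, as the definite description demands.\<close>

lemma h_min_props: "0 < h_min h" "deriv h (h_min h) = 0"
proof -
  have l0: "filterlim h at_top (at_right 0)" and l1: "filterlim h at_top at_top"
    using adm unfolding admissible_h_def by auto
  obtain a where a: "0 < a" "\<And>v. 0 < v \<Longrightarrow> v < a \<Longrightarrow> h 1 < h v"
    using l0[unfolded filterlim_at_top_dense, rule_format, of "h 1"]
    by (auto simp: eventually_at_right_field)
  obtain b where b: "\<And>v. b \<le> v \<Longrightarrow> h 1 < h v"
    using l1[unfolded filterlim_at_top_dense, rule_format, of "h 1"]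
    by (auto simp: eventually_at_top_linorder)
  \<comment> \<open>Chosen so that 1 lies strictly between them while h exceeds h(1) at both; the
    minimum over the interval is then attained inside.\<close>
  define a' b' where "a' = min (a / 2) (1 / 2)" and "b' = max b 2"
  have ab: "0 < a'" "a' < a" "a' < 1" "1 < b'" "b \<le> b'" using a(1) by (auto simp: a'_def b'_def)
  have "\<exists>x\<in>{a'..b'}. \<forall>y\<in>{a'..b'}. h x \<le> h y"
    by (rule continuous_attains_inf) (use ab in \<open>auto intro: continuous_on_subset[OF h_continuous]\<close>)
  then obtain x where x: "x \<in> {a'..b'}" "\<And>y. y \<in> {a'..b'} \<Longrightarrow> h x \<le> h y" by auto
  have "h x \<le> h 1" using x(2)[of 1] ab by simp
  moreover have "h 1 < h a'" using a(2) ab by simp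
  moreover have "h 1 < h b'" using b ab by simp
  ultimately have "x \<noteq> a'" "x \<noteq> b'" by auto
  then have xi: "a' < x" "x < b'" using x(1) by auto
  then have x0: "0 < x" using ab by simp
  have d0: "deriv h x = 0"
  proof (rule DERIV_local_min[OF h_deriv[OF x0]])
    show "0 < min (x - a') (b' - x)" using xi by simp
    show "\<forall>y. \<bar>x - y\<bar> < min (x - a') (b' - x) \<longrightarrow> h x \<le> h y"
      by (auto intro!: x(2) simp: abs_if split: if_splits)
  qed
  have "h_min h = x"
    unfolding h_min_def
  proof (rule the_equality)
    show "0 < x \<and> deriv h x = 0" using x0 d0 by simp
    show "y = x" if "0 < y \<and> deriv h y = 0" for y
      using that dh_strict_mono[of x y] dh_strict_mono[of y x] x0 d0 by (cases x y rule: linorder_cases) auto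
  qed
  then show "0 < h_min h" "deriv h (h_min h) = 0" using x0 d0 by auto
qed

text \<open>The graph of h lies above its tangent at v; dividing by the argument and letting it grow
  compares the slopes.\<close>

lemma dh_le_slope_at_infinity:
  assumes lim: "((\<lambda>v. h v / v) \<longlongrightarrow> L) at_top" and v: "0 < v"
  shows "deriv h v \<le> L"
proof (rule tendsto_le[OF trivial_limit_at_top_linorder lim])
  have "((\<lambda>V. (h v - deriv h v * v) * inverse V + deriv h v) \<longlongrightarrow> (h v - deriv h v * v) * 0 + deriv h v) at_top"
    by (intro tendsto_intros tendsto_inverse_0_at_top filterlim_ident)
  then show "((\<lambda>V. (h v - deriv h v * v) * inverse V + deriv h v) \<longlongrightarrow> deriv h v) at_top" by simp
  show "\<forall>\<^sub>F V in at_top. (h v - deriv h v * v) * inverse V + deriv h v \<le> h V / V"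
    using eventually_gt_at_top[of v]
  proof eventually_elim
    case (elim V)
    have V: "0 < V" using elim v by simp
    have "(h v - deriv h v * v) + deriv h v * V \<le> h V"
      using h_increment(1)[OF v elim] by (simp add: algebra_simps)
    then have "((h v - deriv h v * v) + deriv h v * V) / V \<le> h V / V"
      using V by (intro divide_right_mono) auto
    moreover have "((h v - deriv h v * v) + deriv h v * V) / V = (h v - deriv h v * v) * inverse V + deriv h v"
      using V by (simp add: field_simps)
    ultimately show ?case by simp
  qed
qed

end

locale cavity = admissible h
  for h :: "real \<Rightarrow> real" +
  fixes d :: nat and lam \<sigma> :: real and r :: "real \<Rightarrow> real"
  assumes dim: "3 \<le> d" and stretch_pos: "0 < lam"
    and profile: "cavitating_profile d h lam \<sigma> r"
    and known: "known_properties d h lam \<sigma> r"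
begin

text \<open>The value 0 on the nonpositive axis preserves monotonicity on all reals.\<close>

definition q :: "real \<Rightarrow> real" where
  "q s = (if s \<le> 0 then 0 else if s < \<sigma> then deriv r s else lam)"

definition a :: real where "a = Lim (at_left \<sigma>) (deriv r)"

lemma sig_pos: "0 < \<sigma>" and r_cont0: "continuous_on {0..} r" and r_pos0: "0 \<le> s \<Longrightarrow> 0 < r s"
  and r_out0: "\<sigma> \<le> s \<Longrightarrow> r s = lam * s"
  using profile unfolding cavitating_profile_def by blast+

lemma r_deriv0: "0 < s \<Longrightarrow> s < \<sigma> \<Longrightarrow> (r has_real_derivative deriv r s) (at s)"
proof -
  assume s: "0 < s" "s < \<sigma>"
  have "r differentiable_on {0<..<\<sigma>}" using profile unfolding cavitating_profile_def by blast
  then show ?thesis using s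
    by (simp add: differentiable_on_eq_differentiable_at DERIV_deriv_iff_real_differentiable)
qed

lemma dr_deriv0: "0 < s \<Longrightarrow> s < \<sigma> \<Longrightarrow> (deriv r has_real_derivative deriv (deriv r) s) (at s)"
proof -
  assume s: "0 < s" "s < \<sigma>"
  have "deriv r differentiable_on {0<..<\<sigma>}" using profile unfolding cavitating_profile_def by blast
  then show ?thesis using s
    by (simp add: differentiable_on_eq_differentiable_at DERIV_deriv_iff_real_differentiable)
qed

lemma ode: "0 < s \<Longrightarrow> s < \<sigma> \<Longrightarrow> s\<^sup>2 * deriv (deriv r) s =
    deriv (stress1 d h r) s + real (d - 1) / s * (stress1 d h r s - stress2 d h r s)"
  using profile unfolding cavitating_profile_def by simp

lemma left_nontrivial: "at_left \<sigma> \<noteq> bot"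
  by simp

lemma dr_tendsto: "(deriv r \<longlongrightarrow> a) (at_left \<sigma>)"
proof -
  obtain b where "(deriv r \<longlongrightarrow> b) (at_left \<sigma>)"
    using profile unfolding cavitating_profile_def by blast
  moreover from this have "a = b" unfolding a_def by (intro tendsto_Lim) auto
  ultimately show ?thesis by simp
qed

lemma known':
  assumes "0 < s" "s < \<sigma>"
  shows "h_min h \<le> spec_vol d r s" "spec_vol d r s \<le> lam ^ d" "0 \<le> deriv r s" "deriv r s < a"
    "lam * s < r s" "s * deriv r s < lam * s"
  using known assms unfolding known_properties_def a_def by auto

lemma a_less: "a < lam"
  using known unfolding known_properties_def a_def by blast

lemma dr_mono: "strict_mono_on {0<..<\<sigma>} (deriv r)"
  using known unfolding known_properties_def by blast

lemma vol_mono: "strict_mono_on {0<..<\<sigma>} (spec_vol d r)"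
  using known unfolding known_properties_def by blast

sublocale radial_profile r q lam \<sigma> "h_min h" d
proof
  show "3 \<le> d" by (rule dim)
  show "0 < lam" "0 < \<sigma>" "0 < h_min h" by (rule stretch_pos sig_pos h_min_props)+
  show "continuous_on {0..} r" by (rule r_cont0)
  show "0 < r s" if "0 \<le> s" for s using that by (rule r_pos0)
  show "r s = lam * s" if "\<sigma> \<le> s" for s using that by (rule r_out0)
  show "q s = lam" if "\<sigma> \<le> s" for s using that sig_pos by (simp add: q_def)
  show q0: "0 \<le> q s" for s using known'(3)[of s] stretch_pos by (simp add: q_def)
  show "mono q"
  proof (rule monoI)
    fix x y :: real assume "x \<le> y"
    consider "x \<le> 0" | "\<sigma> \<le> y" "0 < x" "x < \<sigma>" | "0 < x" "\<sigma> \<le> x" | "0 < x" "y < \<sigma>"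
      by linarith
    then show "q x \<le> q y"
    proof cases
      case 1
      then show ?thesis using q0[of y] by (simp add: q_def)
    next
      case 2
      then show ?thesis using known'(4)[of x] a_less by (simp add: q_def)
    next
      case 3
      then show ?thesis using \<open>x \<le> y\<close> by (simp add: q_def)
    next
      case 4
      then have "deriv r x \<le> deriv r y"
        using strict_mono_onD[OF dr_mono, of x y] \<open>x \<le> y\<close> by (cases "x = y") auto
      then show ?thesis using 4 \<open>x \<le> y\<close> by (simp add: q_def)
    qed
  qed
  show "(r has_real_derivative q s) (at s)" if "0 < s" "s \<noteq> \<sigma>" for s
  proof (cases "s < \<sigma>")
    case True
    then show ?thesis using r_deriv0 that by (simp add: q_def)
  next
    case False
    have "((\<lambda>s. lam * s) has_real_derivative lam) (at s)" by (auto intro!: derivative_eq_intros)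
    moreover have "open {\<sigma><..}" "s \<in> {\<sigma><..}" using that False by auto
    ultimately have "(r has_real_derivative lam) (at s)"
      by (rule has_field_derivative_transform_within_open) (simp add: r_out0)
    then show ?thesis using that False by (simp add: q_def)
  qed
  show "isCont q s" if "0 < s" "s \<noteq> \<sigma>" for s
  proof (cases "s < \<sigma>")
    case True
    have "isCont (deriv r) s" using True that by (intro DERIV_isCont[OF dr_deriv0])
    moreover have "\<forall>\<^sub>F x in nhds s. q x = deriv r x"
      using eventually_nhds_in_open[of "{0<..<\<sigma>}" s] True that by (auto simp: q_def elim: eventually_mono)
    ultimately show ?thesis by (subst isCont_cong) auto
  next
    case False
    have "\<forall>\<^sub>F x in nhds s. q x = lam"
      using eventually_nhds_in_open[of "{\<sigma><..}" s] False that sig_pos by (auto simp: q_def elim: eventually_mono)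
    then show ?thesis by (subst isCont_cong) auto
  qed
  show "h_min h \<le> q s * (r s / s) ^ (d - 1)" if "0 < s" for s
  proof (cases "s < \<sigma>")
    case True
    then show ?thesis using known'(1)[of s] that by (simp add: q_def spec_vol_def)
  next
    case False
    \<comment> \<open>Any point of the fan gives the comparison of H with the outer volume ratio,
      since v lies between the two.\<close>
    have "h_min h \<le> lam ^ d"
      using known'(1,2)[of "\<sigma> / 2"] sig_pos by linarith
    moreover have "lam * lam ^ (d - 1) = lam ^ d" using dim by (cases d) auto
    ultimately show ?thesis using False that by (simp add: q_def r_out0)
  qed
  show "s * q s \<le> r s" if "0 < s" for s
  proof (cases "s < \<sigma>")
    case True
    then have "s * q s = s * deriv r s" using that by (simp add: q_def)
    then show ?thesis using known'(5,6)[OF that True] by linarith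
  qed (use that in \<open>simp add: q_def r_out0\<close>)
qed

definition e :: "real \<Rightarrow> real" where
  "e s = 1/2 * (p s)\<^sup>2 + 1/2 * ((q s)\<^sup>2 + real (d - 1) * (r s / s)\<^sup>2) + h (q s * (r s / s) ^ (d - 1))"

text \<open>In the variable $s=R/t$ conservation of energy reads $-s^d e'=(s^{d-1}(r-sr')P_1)'$, so that \<open>Q\<close> is an
  antiderivative of $d\,s^{d-1}e$.\<close>

definition Q :: "real \<Rightarrow> real" where
  "Q s = s ^ d * e s + s ^ (d - 1) * p s * stress1 d h r s"

definition Wl :: real where
  "Wl = 1/2 * (lam\<^sup>2 + real (d - 1) * lam\<^sup>2) + h (lam * lam ^ (d - 1))"

text \<open>The suffixes \<open>m\<close> and \<open>p\<close> stand for values just inside and just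
  outside the shock. By continuity r/s equals \<open>lam\<close> on both sides, so only the radial
  stretch jumps, from \<open>a\<close> to \<open>lam\<close>.\<close>

definition vm :: real where "vm = a * lam ^ (d - 1)"
definition vp :: real where "vp = lam * lam ^ (d - 1)"
definition P1m :: real where "P1m = a + lam ^ (d - 1) * deriv h vm"
definition em :: real where
  "em = 1/2 * (\<sigma> * lam - \<sigma> * a)\<^sup>2 + 1/2 * (a\<^sup>2 + real (d - 1) * lam\<^sup>2) + h vm"
definition Q1 :: real where
  "Q1 = \<sigma> ^ d * em + \<sigma> ^ (d - 1) * (\<sigma> * lam - \<sigma> * a) * P1m"

lemma Q_deriv:
  assumes s: "0 < s" "s < \<sigma>"
  shows "(Q has_real_derivative real d * s ^ (d - 1) * e s) (at s)"
proof -
  define k where "k = d - 2"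
  have k: "d = Suc (Suc k)" using dim by (simp add: k_def)
  define r1 r2 x where "r1 = deriv r s" and "r2 = deriv (deriv r) s" and "x = r s / s"
  define v where "v s = deriv r s * (r s / s) ^ Suc k" for s
  define h1 D where "h1 = deriv h (v s)" and "D = deriv (stress1 d h r) s"
  have "spec_vol d r s = v s" by (simp add: spec_vol_def v_def k)
  then have vpos: "0 < v s" using known'(1)[OF s] h_min_props(1) by linarith
  have dx: "((\<lambda>s. r s / s) has_real_derivative (r1 - x) / s) (at s)"
    using DERIV_divide[OF r_deriv0[OF s] DERIV_ident] s
    by (simp add: r1_def x_def field_simps power2_eq_square)
  have dr: "(r has_real_derivative r1) (at s)" "(deriv r has_real_derivative r2) (at s)"
    using r_deriv0[OF s] dr_deriv0[OF s] by (auto simp: r1_def r2_def)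
  have dv: "(v has_real_derivative r2 * x ^ Suc k + r1 * (real (Suc k) * x ^ k * ((r1 - x) / s))) (at s)"
    unfolding v_def[abs_def]
    by (rule DERIV_cong[OF DERIV_mult'[OF dr(2) DERIV_power[OF dx, of "Suc k"]]])
      (simp add: r1_def x_def divide_inverse algebra_simps)
  define V where "V = r2 * x ^ Suc k + r1 * (real (Suc k) * x ^ k * ((r1 - x) / s))"
  have dh: "((\<lambda>s. h (v s)) has_real_derivative h1 * V) (at s)"
    unfolding h1_def V_def by (rule DERIV_chain2[OF h_deriv[OF vpos] dv])
  have "((\<lambda>s. deriv h (v s)) has_real_derivative deriv (deriv h) (v s) * V) (at s)"
    unfolding V_def by (rule DERIV_chain2[OF dh_deriv[OF vpos] dv])
  note dP = DERIV_add[OF dr(2) DERIV_mult'[OF DERIV_power[OF dx, of "Suc k"] this]]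
  have st: "stress1 d h r = (\<lambda>s. deriv r s + (r s / s) ^ Suc k * deriv h (v s))"
    by (simp add: stress1_def spec_vol_def k v_def fun_eq_iff)
  \<comment> \<open>The equation of motion is stated with the total operator \<open>deriv\<close>;
    that the stress is differentiable has to come from its formula.\<close>
  have P: "(stress1 d h r has_real_derivative D) (at s)"
    unfolding D_def by (rule DERIV_deriv_iff_real_differentiable[THEN iffD2])
      (use dP in \<open>auto simp: st real_differentiable_def\<close>)
  \<comment> \<open>The primed versions use \<open>deriv r\<close> in place of the piecewise
    \<open>q\<close>; they can be differentiated by rules and agree with \<open>p\<close> and
    \<open>e\<close> throughout the fan.\<close>
  define p' where "p' s = r s - s * deriv r s" for s
  have dp: "(p' has_real_derivative - (s * r2)) (at s)"
    unfolding p'_def[abs_def]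
    by (rule DERIV_cong[OF DERIV_diff[OF dr(1) DERIV_mult'[OF DERIV_ident dr(2)]]]) (simp add: r1_def)
  define e' where "e' s = 1/2 * (p' s)\<^sup>2 + 1/2 * ((deriv r s)\<^sup>2 + real (Suc k) * (r s / s)\<^sup>2) + h (v s)" for s
  have de: "(e' has_real_derivative p' s * (- (s * r2)) + (r1 * r2 + real (Suc k) * (x * ((r1 - x) / s))) + h1 * V) (at s)"
    unfolding e'_def[abs_def]
  proof (rule DERIV_cong)
    have d1: "((\<lambda>s. (p' s)\<^sup>2) has_real_derivative 2 * (p' s * (- (s * r2)))) (at s)"
      by (rule DERIV_cong[OF DERIV_power[OF dp, of 2]]) simp
    have d2: "((\<lambda>s. (deriv r s)\<^sup>2) has_real_derivative 2 * (r1 * r2)) (at s)"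
      by (rule DERIV_cong[OF DERIV_power[OF dr(2), of 2]]) (simp add: r1_def)
    have d3: "((\<lambda>s. (r s / s)\<^sup>2) has_real_derivative 2 * (x * ((r1 - x) / s))) (at s)"
      by (rule DERIV_cong[OF DERIV_power[OF dx, of 2]]) (simp add: x_def)
    show "((\<lambda>s. 1/2 * (p' s)\<^sup>2 + 1/2 * ((deriv r s)\<^sup>2 + real (Suc k) * (r s / s)\<^sup>2) + h (v s)) has_real_derivative
       1/2 * (2 * (p' s * (- (s * r2)))) + 1/2 * (2 * (r1 * r2) + real (Suc k) * (2 * (x * ((r1 - x) / s)))) + h1 * V) (at s)"
      by (intro DERIV_add DERIV_cmult d1 d2 d3 dh)
  qed (simp add: distrib_left)
  have Sd: "((\<lambda>s. s ^ d) has_real_derivative real d * s ^ Suc k) (at s)"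
    using DERIV_pow[of d s] by (simp add: k)
  have Sd1: "((\<lambda>s. s ^ Suc k) has_real_derivative real (Suc k) * s ^ k) (at s)"
    using DERIV_pow[of "Suc k" s] by simp
  have dQ: "((\<lambda>s. s ^ d * e' s + s ^ Suc k * p' s * stress1 d h r s) has_real_derivative
     (s ^ d * (p' s * (- (s * r2)) + (r1 * r2 + real (Suc k) * (x * ((r1 - x) / s))) + h1 * V) + real d * s ^ Suc k * e' s)
     + ((s ^ Suc k * p' s) * D + (s ^ Suc k * (- (s * r2)) + real (Suc k) * s ^ k * p' s) * stress1 d h r s)) (at s)"
    by (intro DERIV_add DERIV_mult' Sd Sd1 de dp P)
  have rs: "r s = s * x" using s by (simp add: x_def)
  have ps: "p' s = s * (x - r1)" by (simp add: p'_def r1_def rs algebra_simps)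
  have ss: "stress1 d h r s = r1 + x ^ Suc k * h1" by (simp add: st r1_def x_def h1_def)
  have "stress2 d h r s = x + r1 * x ^ k * h1"
    by (simp add: stress2_def spec_vol_def k v_def h1_def r1_def x_def)
  then have "s\<^sup>2 * r2 = D + real (Suc k) / s * ((r1 + x ^ Suc k * h1) - (x + r1 * x ^ k * h1))"
    using ode[OF s] unfolding ss by (simp add: r2_def D_def k)
  then have D: "D = s\<^sup>2 * r2 - real (Suc k) / s * ((r1 + x ^ Suc k * h1) - (x + r1 * x ^ k * h1))" by simp
  \<comment> \<open>Once the equation of motion has replaced the derivative of the stress, local
    energy conservation is an algebraic identity in s, r/s, r', r'' and h'.\<close>
  have "s ^ d * (p' s * (- (s * r2)) + (r1 * r2 + real (Suc k) * (x * ((r1 - x) / s))) + h1 * V)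
     + ((s ^ Suc k * p' s) * D + (s ^ Suc k * (- (s * r2)) + real (Suc k) * s ^ k * p' s) * stress1 d h r s) = 0"
    unfolding ss unfolding ps D V_def k power_Suc
    using s(1) by (simp add: field_simps power2_eq_square)
  with dQ have Q': "((\<lambda>s. s ^ d * e' s + s ^ Suc k * p' s * stress1 d h r s) has_real_derivative
     real d * s ^ Suc k * e' s) (at s)"
    by (elim DERIV_cong) linarith
  have eq: "e' s = e s" "p' s = p s" if "s \<in> {0<..<\<sigma>}" for s
    using that unfolding e'_def e_def p'_def p_def q_def v_def by (simp_all add: k)
  have o: "open {0<..<\<sigma>}" "s \<in> {0<..<\<sigma>}" using s by auto
  have dk: "d - 1 = Suc k" using k by simp
  have "(Q has_real_derivative real d * s ^ Suc k * e' s) (at s)"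
    by (rule has_field_derivative_transform_within_open[OF Q' o]) (simp only: Q_def eq dk)
  then show ?thesis by (simp only: eq[OF o(2)] dk)
qed

end

section \<open>One-sided limits, the antiderivative of the fan energy and the growth
  constant\<close>

context cavity
begin

lemma power_dim: "x ^ d = x * x ^ (d - 1)" for x :: real
  using power_eq_if[of x d] dim by simp

lemma vol_tendsto_left: "((\<lambda>s. q s * (r s / s) ^ (d - 1)) \<longlongrightarrow> vm) (at_left \<sigma>)"
  and q_tendsto_left: "(q \<longlongrightarrow> a) (at_left \<sigma>)"
  and r_tendsto_left: "(r \<longlongrightarrow> \<sigma> * lam) (at_left \<sigma>)"
  and r_div_tendsto_left: "((\<lambda>s. r s / s) \<longlongrightarrow> lam) (at_left \<sigma>)"
proof -
  have ev: "\<forall>\<^sub>F s in at_left \<sigma>. s \<in> {0<..<\<sigma>}"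
    using eventually_at_left_real[OF sig_pos] .
  show q: "(q \<longlongrightarrow> a) (at_left \<sigma>)"
    by (rule Lim_transform_eventually[OF dr_tendsto eventually_mono[OF ev]]) (auto simp: q_def)
  have "isCont r \<sigma>"
    by (rule continuous_on_interior[OF r_cont0]) (use sig_pos in simp)
  then have "(r \<longlongrightarrow> r \<sigma>) (at_left \<sigma>)"
    unfolding isCont_def by (rule tendsto_within_subset) simp
  then show r: "(r \<longlongrightarrow> \<sigma> * lam) (at_left \<sigma>)"
    using r_out0[of \<sigma>] by (simp add: mult.commute)
  have "((\<lambda>s. r s / s) \<longlongrightarrow> \<sigma> * lam / \<sigma>) (at_left \<sigma>)"
    using sig_pos by (intro tendsto_intros r) auto
  then show x: "((\<lambda>s. r s / s) \<longlongrightarrow> lam) (at_left \<sigma>)" using sig_pos by simp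
  show "((\<lambda>s. q s * (r s / s) ^ (d - 1)) \<longlongrightarrow> vm) (at_left \<sigma>)"
    unfolding vm_def by (intro tendsto_intros q x)
qed

lemma near_left: "\<forall>\<^sub>F s in at_left \<sigma>. 0 < s \<and> s < \<sigma>"
  using eventually_at_left_real[OF sig_pos] by (auto elim: eventually_mono)

lemma spec_vol_eq: "0 < s \<Longrightarrow> s < \<sigma> \<Longrightarrow> spec_vol d r s = q s * (r s / s) ^ (d - 1)"
  by (simp add: q_def spec_vol_def)

lemma vm_lower: "h_min h \<le> vm"
  by (rule tendsto_lowerbound[OF vol_tendsto_left _ left_nontrivial])
    (rule eventually_mono[OF near_left], rule vol_lower, simp)

lemma vm_pos: "0 < vm"
  using vm_lower h_min_props(1) by linarith

lemma spec_vol_le_vm: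
  assumes "0 < s" "s < \<sigma>" shows "q s * (r s / s) ^ (d - 1) \<le> vm"
proof (rule tendsto_lowerbound[OF vol_tendsto_left _ left_nontrivial])
  have "\<forall>\<^sub>F x in at_left \<sigma>. s < x \<and> x < \<sigma>"
    using eventually_at_left_real[OF assms(2)] by (auto elim: eventually_mono)
  then show "\<forall>\<^sub>F x in at_left \<sigma>. q s * (r s / s) ^ (d - 1) \<le> q x * (r x / x) ^ (d - 1)"
  proof eventually_elim
    case (elim x)
    then have "spec_vol d r s < spec_vol d r x"
      using assms by (intro strict_mono_onD[OF vol_mono]) auto
    then show ?case using assms elim by (simp add: spec_vol_eq)
  qed
qed

lemma stress1_tendsto_left: "(stress1 d h r \<longlongrightarrow> P1m) (at_left \<sigma>)"
proof (rule Lim_transform_eventually)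
  show "((\<lambda>s. q s + (r s / s) ^ (d - 1) * deriv h (q s * (r s / s) ^ (d - 1))) \<longlongrightarrow> P1m) (at_left \<sigma>)"
    unfolding P1m_def
    by (intro tendsto_intros q_tendsto_left r_div_tendsto_left
        isCont_tendsto_compose[OF DERIV_isCont[OF dh_deriv[OF vm_pos]] vol_tendsto_left])
  show "\<forall>\<^sub>F s in at_left \<sigma>. q s + (r s / s) ^ (d - 1) * deriv h (q s * (r s / s) ^ (d - 1)) = stress1 d h r s"
    by (rule eventually_mono[OF near_left]) (simp add: stress1_def spec_vol_eq q_def)
qed

lemma rankine_hugoniot: "\<sigma>\<^sup>2 * (lam - a) = lam + lam ^ (d - 1) * deriv h vp - P1m"
proof -
  have "Lim (at_left \<sigma>) (stress1 d h r) = P1m"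
    by (rule tendsto_Lim[OF left_nontrivial stress1_tendsto_left])
  moreover have "vp = lam ^ d" by (simp only: vp_def power_dim[of lam])
  moreover have "\<sigma>\<^sup>2 * (lam - Lim (at_left \<sigma>) (deriv r)) =
       lam + lam ^ (d - 1) * deriv h (lam ^ d) - Lim (at_left \<sigma>) (stress1 d h r)"
    using profile unfolding cavitating_profile_def by blast
  ultimately show ?thesis by (simp add: a_def)
qed

lemma Q_tendsto_left: "(Q \<longlongrightarrow> Q1) (at_left \<sigma>)"
  unfolding Q_def Q1_def em_def e_def p_def
  by (intro tendsto_intros q_tendsto_left r_tendsto_left r_div_tendsto_left stress1_tendsto_left
      isCont_tendsto_compose[OF DERIV_isCont[OF h_deriv[OF vm_pos]] vol_tendsto_left])

text \<open>Although r/s blows up, the weighted stress s^(d-1) P_1 stays bounded and tends to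
  r(0)^(d-1) h'(H) = 0: a stress-free cavity surface does no work. The remaining terms carry a
  positive power of s, as d \<ge> 3.\<close>

lemma Q_tendsto_0: "(Q \<longlongrightarrow> 0) (at_right 0)"
proof -
  have ev: "\<forall>\<^sub>F s in at_right 0. s \<in> {0<..<\<sigma>}"
    using eventually_at_right_real[OF sig_pos] .
  have id: "((\<lambda>s::real. s) \<longlongrightarrow> 0) (at_right 0)" by (rule tendsto_ident_at)
  have "(r \<longlongrightarrow> r 0) (at 0 within {0..})"
    using r_cont0 by (simp add: continuous_on_def)
  then have r: "(r \<longlongrightarrow> r 0) (at_right 0)"
    by (rule tendsto_within_subset) auto
  have u: "((\<lambda>s. s * q s) \<longlongrightarrow> 0) (at_right 0)"
  proof (rule tendsto_sandwich[OF _ _ tendsto_const])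
    show "((\<lambda>s. s * lam) \<longlongrightarrow> 0) (at_right 0)" using tendsto_mult_left_zero[OF id] .
  qed (rule eventually_mono[OF ev], use q_nonneg q_le in \<open>auto intro: mult_left_mono\<close>)+
  have "(spec_vol d r \<longlongrightarrow> h_min h) (at_right 0)"
    using profile unfolding cavitating_profile_def by blast
  then have v: "((\<lambda>s. q s * (r s / s) ^ (d - 1)) \<longlongrightarrow> h_min h) (at_right 0)"
    by (rule Lim_transform_eventually) (rule eventually_mono[OF ev], simp add: spec_vol_eq)
  note hv = isCont_tendsto_compose[OF DERIV_isCont[OF h_deriv[OF h_min_props(1)]] v]
  note dhv = isCont_tendsto_compose[OF DERIV_isCont[OF dh_deriv[OF h_min_props(1)]] v]
  define k where "k = d - 3"
  have k: "d = Suc (Suc (Suc k))" using dim by (simp add: k_def)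
  let ?v = "\<lambda>s. q s * (r s / s) ^ (d - 1)"
  \<comment> \<open>This is \<open>Q\<close> with all negative powers of s cleared;
    \<open>s * q s\<close> is kept as one factor because its limit 0 follows from boundedness of
    \<open>q\<close>.\<close>
  let ?X = "\<lambda>s. 1/2 * (s ^ d * (r s - s * q s)\<^sup>2) + 1/2 * (s ^ Suc k * (s * q s)\<^sup>2 + real (d - 1) * (s ^ Suc k * (r s)\<^sup>2))
     + s ^ d * h (?v s) + (r s - s * q s) * (s ^ Suc k * (s * q s) + r s ^ (d - 1) * deriv h (?v s))"
  have "(?X \<longlongrightarrow> 1/2 * (0 ^ d * (r 0 - 0)\<^sup>2) + 1/2 * (0 ^ Suc k * 0\<^sup>2 + real (d - 1) * (0 ^ Suc k * (r 0)\<^sup>2))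
     + 0 ^ d * h (h_min h) + (r 0 - 0) * (0 ^ Suc k * 0 + r 0 ^ (d - 1) * deriv h (h_min h))) (at_right 0)"
    by (intro tendsto_intros id r u hv dhv)
  then have "(?X \<longlongrightarrow> 0) (at_right 0)" using h_min_props(2) by (simp add: k)
  moreover have "\<forall>\<^sub>F s in at_right 0. ?X s = Q s"
    using ev
  proof eventually_elim
    case (elim s)
    then have s: "0 < s" "s < \<sigma>" by auto
    define x where "x = r s / s"
    have rx: "r s = s * x" using s by (simp add: x_def)
    have st: "stress1 d h r s = q s + x ^ (d - 1) * deriv h (?v s)"
      using s by (simp add: stress1_def spec_vol_eq q_def x_def)
    show ?case
      unfolding Q_def e_def p_def st x_def[symmetric] unfolding rx
      by (simp add: k power2_eq_square power_mult_distrib algebra_simps)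
  qed
  ultimately show ?thesis by (rule Lim_transform_eventually)
qed

text \<open>\<open>Q\<close> completed by its limits: 0 at the cavity and, beyond the shock, the
  constant left limit \<open>Q1\<close>, since the excess density \<open>e - Wl\<close> vanishes
  there.\<close>

definition A :: "real \<Rightarrow> real" where
  "A s = (if s \<le> 0 then 0 else if s < \<sigma> then Q s else Q1)"

lemma A_continuous: "continuous_on {0..} A"
  unfolding continuous_on_def
proof
  fix s :: real assume s: "s \<in> {0..}"
  consider "s = 0" | "0 < s" "s < \<sigma>" | "s = \<sigma>" | "\<sigma> < s" using s by fastforce
  then show "(A \<longlongrightarrow> A s) (at s within {0..})"
  proof cases
    case 1
    have "(A \<longlongrightarrow> 0) (at_right 0)"
      by (rule Lim_transform_eventually[OF Q_tendsto_0])
        (rule eventually_mono[OF eventually_at_right_real[OF sig_pos]], simp add: A_def)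
    then show ?thesis using 1 by (simp add: A_def at_within_Ici_at_right)
  next
    case 2
    have "isCont Q s" using Q_deriv[OF 2] by (rule DERIV_isCont)
    moreover have "\<forall>\<^sub>F x in nhds s. A x = Q x"
      using eventually_nhds_in_open[of "{0<..<\<sigma>}" s] 2 by (auto simp: A_def elim: eventually_mono)
    ultimately have "isCont A s" by (subst isCont_cong) auto
    then show ?thesis unfolding isCont_def by (rule tendsto_within_subset) simp
  next
    case 3
    have "(A \<longlongrightarrow> Q1) (at_left \<sigma>)"
      by (rule Lim_transform_eventually[OF Q_tendsto_left])
        (rule eventually_mono[OF near_left], simp add: A_def)
    moreover have "(A \<longlongrightarrow> Q1) (at_right \<sigma>)"
      by (rule Lim_transform_eventually[OF tendsto_const])
        (use sig_pos in \<open>auto simp: A_def eventually_at_filter\<close>)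
    ultimately have "(A \<longlongrightarrow> Q1) (at \<sigma>)" by (rule filterlim_split_at)
    moreover have "A s = Q1" using 3 sig_pos by (simp add: A_def)
    ultimately show ?thesis unfolding 3 by (auto intro: tendsto_within_subset)
  next
    case 4
    have "\<forall>\<^sub>F x in nhds s. A x = Q1"
      using eventually_nhds_in_open[of "{\<sigma><..}" s] 4 sig_pos by (auto simp: A_def elim: eventually_mono)
    then have "isCont A s" by (subst isCont_cong) auto
    then show ?thesis unfolding isCont_def by (rule tendsto_within_subset) simp
  qed
qed

text \<open>An antiderivative, across the shock, of s^(d-1) times the excess density minus L v. The
  term with r^d integrates the volume ratio, and the minimum stops the contribution of
  \<open>Wl\<close> at the shock.\<close>

definition G :: "real \<Rightarrow> real \<Rightarrow> real" where
  "G L s = (A s - Wl * (min s \<sigma>) ^ d - L * r s ^ d) / d"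

lemma G_continuous: "continuous_on {0..} (G L)"
  unfolding G_def using dim by (intro continuous_intros A_continuous r_cont0) auto

lemma e_outer: "\<sigma> \<le> s \<Longrightarrow> e s = Wl"
  using sig_pos by (simp add: e_def Wl_def p_outer q_outer r_out0)

lemma G_deriv:
  assumes s: "0 < s" "s \<noteq> \<sigma>"
  shows "(G L has_real_derivative s ^ (d - 1) * (e s - L * (q s * (r s / s) ^ (d - 1)) - Wl)) (at s)"
proof -
  have d0: "real d \<noteq> 0" using dim by simp
  have rd: "((\<lambda>s. L * r s ^ d) has_real_derivative real d * s ^ (d - 1) * (L * (q s * (r s / s) ^ (d - 1)))) (at s)"
    by (rule DERIV_cong[OF DERIV_cmult[OF DERIV_power[OF r_deriv[OF s], of d]]])
      (use s in \<open>simp add: power_divide\<close>)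
  have AW: "((\<lambda>s. A s - Wl * (min s \<sigma>) ^ d) has_real_derivative real d * s ^ (d - 1) * (e s - Wl)) (at s)"
  proof (cases "s < \<sigma>")
    case True
    have "((\<lambda>s. Q s - Wl * s ^ d) has_real_derivative real d * s ^ (d - 1) * e s - Wl * (real d * s ^ (d - 1))) (at s)"
      using DERIV_diff[OF Q_deriv[OF s(1) True] DERIV_cmult[OF DERIV_pow[of d s]]] by simp
    moreover have "open {0<..<\<sigma>}" "s \<in> {0<..<\<sigma>}" using s True by auto
    ultimately have "((\<lambda>s. A s - Wl * (min s \<sigma>) ^ d) has_real_derivative
        real d * s ^ (d - 1) * e s - Wl * (real d * s ^ (d - 1))) (at s)"
      by (rule has_field_derivative_transform_within_open) (simp add: A_def)
    then show ?thesis by (rule DERIV_cong) (simp add: right_diff_distrib)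
  next
    case False
    have "((\<lambda>s. Q1 - Wl * \<sigma> ^ d) has_real_derivative 0) (at s)" by simp
    moreover have "open {\<sigma><..}" "s \<in> {\<sigma><..}" using s False by auto
    ultimately have "((\<lambda>s. A s - Wl * (min s \<sigma>) ^ d) has_real_derivative 0) (at s)"
      by (rule has_field_derivative_transform_within_open) (use sig_pos in \<open>auto simp: A_def\<close>)
    then show ?thesis using False e_outer[of s] by simp
  qed
  show ?thesis
    unfolding G_def[abs_def]
    by (rule DERIV_cong[OF DERIV_cdivide[OF DERIV_diff[OF AW rd]]])
      (use d0 in \<open>simp add: field_simps\<close>)
qed

text \<open>This is C/d for the constant C of the overview, with the jump at the shock not yet
  rewritten by the Rankine-Hugoniot condition.\<close>

definition growth :: "real \<Rightarrow> real" where
  "growth L = (Q1 - Wl * \<sigma> ^ d + L * r 0 ^ d) / d"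

text \<open>The substitution s = R/t exposes the factor t^d. The boundary term at \<open>K\<close>
  does not depend on t; it is the negative of the contribution of the linear part of the averaged
  energy, so it cancels in the total.\<close>

lemma fan_integral:
  assumes t: "0 < t" and K: "\<sigma> * t \<le> K"
  shows "((\<lambda>R. R ^ (d - 1) * (e (R / t) - L * (q (R / t) * (r (R / t) / (R / t)) ^ (d - 1)) - Wl))
    has_integral t ^ d * growth L - L * (lam * K) ^ d / d) {0..K}"
proof -
  have st: "0 < \<sigma> * t" using sig_pos t by simp
  then have K0: "0 < K" using K by linarith
  have dd: "t ^ d = t ^ (d - 1) * t" by (simp only: power_dim[of t] mult.commute)
  let ?f = "\<lambda>s. s ^ (d - 1) * (e s - L * (q s * (r s / s) ^ (d - 1)) - Wl)"
  have "((\<lambda>R. t ^ (d - 1) * ?f (R / t)) has_integral t ^ d * G L (K / t) - t ^ d * G L (0 / t)) {0..K}"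
  proof (rule fundamental_theorem_of_calculus_interior_strong[of "{\<sigma> * t}"])
    show "continuous_on {0..K} (\<lambda>R. t ^ d * G L (R / t))"
      by (intro continuous_intros continuous_on_compose2[OF G_continuous]) (use t in auto)
    fix R assume "R \<in> {0<..<K} - {\<sigma> * t}"
    then have s: "0 < R / t" "R / t \<noteq> \<sigma>" using t by auto
    have "((\<lambda>R. G L (R / t)) has_real_derivative ?f (R / t) * (1 / t)) (at R)"
      by (rule DERIV_chain2[where g="\<lambda>R. R / t", OF G_deriv[OF s] DERIV_cdivide[OF DERIV_ident]])
    then have "((\<lambda>R. t ^ d * G L (R / t)) has_real_derivative t ^ d * (?f (R / t) * (1 / t))) (at R)"
      by (rule DERIV_cmult)
    moreover have "t ^ d * (?f (R / t) * (1 / t)) = t ^ (d - 1) * ?f (R / t)"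
      using t unfolding dd by simp
    ultimately show "((\<lambda>R. t ^ d * G L (R / t)) has_vector_derivative t ^ (d - 1) * ?f (R / t)) (at R)"
      by (simp add: has_real_derivative_iff_has_vector_derivative)
  qed (use K0 in auto)
  moreover have "t ^ (d - 1) * ?f (R / t) = R ^ (d - 1) * (e (R / t) - L * (q (R / t) * (r (R / t) / (R / t)) ^ (d - 1)) - Wl)" for R
  proof -
    have "t ^ (d - 1) * (R / t) ^ (d - 1) = R ^ (d - 1)" using t by (simp flip: power_mult_distrib)
    then show ?thesis by (simp only: mult.assoc[symmetric])
  qed
  moreover have "t ^ d * G L (K / t) - t ^ d * G L (0 / t) = t ^ d * growth L - L * (lam * K) ^ d / d"
  proof -
    have sk: "\<sigma> \<le> K / t" using K t by (simp add: field_simps)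
    have g1: "G L (K / t) = (Q1 - Wl * \<sigma> ^ d - L * (lam * (K / t)) ^ d) / d"
      using sk sig_pos by (simp add: G_def A_def r_out0 min_absorb2)
    have g2: "G L (0 / t) = - L * r 0 ^ d / d"
      using sig_pos dim by (simp add: G_def A_def zero_power)
    have "t ^ d * (lam * (K / t)) ^ d = (lam * K) ^ d"
      using t by (simp flip: power_mult_distrib)
    then have g3: "t ^ d * ((Q1 - Wl * \<sigma> ^ d - L * (lam * (K / t)) ^ d) / d) = (t ^ d * (Q1 - Wl * \<sigma> ^ d) - L * (lam * K) ^ d) / d"
      by (simp add: right_diff_distrib diff_divide_distrib mult.left_commute)
    show ?thesis
      unfolding g1 g2 g3 growth_def
      by (simp add: algebra_simps add_divide_distrib diff_divide_distrib)
  qed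
  ultimately show ?thesis by (simp only:)
qed

text \<open>The cavity has at least the volume gained across the shock, since $\frac{d}{ds}r^d = d\,s^{d-1}v\le d\,s^{d-1}v(\sigma-)$.\<close>

lemma cavity_volume: "\<sigma> ^ d * (vp - vm) \<le> r 0 ^ d"
proof -
  have d0: "0 < d" using dim by simp
  have c: "continuous_on {0..\<sigma>} (\<lambda>s. r s ^ d - vm * s ^ d)"
    by (intro continuous_intros continuous_on_subset[OF r_cont0]) auto
  let ?f' = "\<lambda>s. real d * s ^ (d - 1) * (q s * (r s / s) ^ (d - 1) - vm)"
  have D: "((\<lambda>s. r s ^ d - vm * s ^ d) has_real_derivative ?f' s) (at s)" if "s \<in> {0<..<\<sigma>} - {}" for s
    using that r_deriv[of s]
    by (intro DERIV_cong[OF DERIV_diff[OF DERIV_power DERIV_cmult[OF DERIV_pow]]])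
      (auto simp: power_divide right_diff_distrib)
  have up: "?f' s \<le> 0" if "s \<in> {0<..<\<sigma>} - {}" for s
    using that spec_vol_le_vm[of s] by (auto intro!: mult_nonneg_nonpos)
  have low: "- (real d * \<sigma> ^ (d - 1) * vm) \<le> ?f' s" if "s \<in> {0<..<\<sigma>} - {}" for s
  proof -
    have "0 < s" using that by simp
    then have "- vm \<le> q s * (r s / s) ^ (d - 1) - vm"
      using vol_lower[of s] h_min_props(1) by linarith
    then have "real d * s ^ (d - 1) * (- vm) \<le> ?f' s" using \<open>0 < s\<close> by (intro mult_left_mono) auto
    moreover have "real d * s ^ (d - 1) * vm \<le> real d * \<sigma> ^ (d - 1) * vm"
      using that vm_pos by (intro mult_right_mono mult_left_mono power_mono) auto
    ultimately show ?thesis by simp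
  qed
  have "(r \<sigma> ^ d - vm * \<sigma> ^ d) - (r 0 ^ d - vm * 0 ^ d) \<le> 0 * (\<sigma> - 0)"
    using piecewise_mvt_bounds(2)[OF _ c finite.emptyI D low up] sig_pos by simp
  moreover have "r \<sigma> ^ d = \<sigma> ^ d * vp"
    by (simp only: r_out0[OF order_refl] power_mult_distrib vp_def power_dim[of lam] mult.commute)
  ultimately show ?thesis using d0 by (simp add: zero_power algebra_simps)
qed

lemma growth_pos:
  assumes L: "((\<lambda>v. h v / v) \<longlongrightarrow> L) at_top"
  shows "0 < growth L"
proof -
  define ell where "ell = lam ^ (d - 1)"
  have l0: "0 < ell" using stretch_pos by (simp add: ell_def)
  define hp hm where "hp = deriv h vp" and "hm = deriv h vm"
  have D: "vp - vm = ell * (lam - a)" by (simp add: vp_def vm_def ell_def algebra_simps)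
  have Dp: "0 < vp - vm" unfolding D using l0 a_less by simp
  \<comment> \<open>The inner volume ratio is at least H and h' is increasing; the sign allows the
    term with h'(v_-) to be dropped below.\<close>
  have hm: "0 \<le> hm" using dh_mono[OF h_min_props(1) vm_lower] h_min_props(2) by (simp add: hm_def)
  have hmp: "hm < hp" unfolding hm_def hp_def using Dp vm_pos by (intro dh_strict_mono) auto
  have Lp: "hp \<le> L" unfolding hp_def using dh_le_slope_at_infinity[OF L] Dp vm_pos by simp
  have inc: "h vp - h vm \<le> hp * (vp - vm)" unfolding hp_def using h_increment(2)[of vm vp] Dp vm_pos by simp
  have sd: "\<sigma> ^ d = \<sigma> ^ (d - 1) * \<sigma>" by (simp only: power_dim[of \<sigma>] mult.commute)
  have RH: "\<sigma>\<^sup>2 * (lam - a) = lam + ell * hp - (a + ell * hm)"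
    using rankine_hugoniot by (simp add: P1m_def ell_def hp_def hm_def)
  have "Q1 - Wl * \<sigma> ^ d = \<sigma> ^ d * (em - Wl + (lam - a) * (a + ell * hm))"
    unfolding Q1_def P1m_def sd ell_def hm_def by (simp add: algebra_simps)
  also have "em - Wl + (lam - a) * (a + ell * hm) = 1/2 * (vp - vm) * (hp + hm) - (h vp - h vm)"
  proof -
    \<comment> \<open>The Rankine-Hugoniot condition trades one factor \<open>\<sigma>\<close>
      squared times (lam - a) of the kinetic energy for the stress jump, after which the quadratic
      terms cancel and only h and h' remain.\<close>
    have "(\<sigma> * lam - \<sigma> * a)\<^sup>2 = (lam - a) * (\<sigma>\<^sup>2 * (lam - a))"
      by (simp add: power2_eq_square algebra_simps)
    also have "\<dots> = (lam - a) * (lam + ell * hp - (a + ell * hm))" by (simp only: RH)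
    finally have sq: "(\<sigma> * lam - \<sigma> * a)\<^sup>2 = (lam - a) * (lam + ell * hp - (a + ell * hm))" .
    show ?thesis
      unfolding em_def Wl_def sq D vp_def[symmetric]
      by (simp add: power2_eq_square field_simps)
  qed
  finally have Qeq: "Q1 - Wl * \<sigma> ^ d = \<sigma> ^ d * (1/2 * (vp - vm) * (hp + hm) - (h vp - h vm))" .
  have "- (1/2 * hp * (vp - vm)) \<le> 1/2 * (vp - vm) * (hp + hm) - (h vp - h vm)"
  proof -
    have "0 \<le> (vp - vm) * hm" using Dp hm by simp
    moreover have "1/2 * (vp - vm) * (hp + hm) = hp * (vp - vm) / 2 + (vp - vm) * hm / 2"
      by (simp add: field_simps)
    moreover have "1/2 * hp * (vp - vm) = hp * (vp - vm) / 2" by simp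
    ultimately show ?thesis using inc by linarith
  qed
  then have "\<sigma> ^ d * (- (1/2 * hp * (vp - vm))) \<le> Q1 - Wl * \<sigma> ^ d"
    unfolding Qeq using sig_pos by (intro mult_left_mono) auto
  moreover have "hp * (\<sigma> ^ d * (vp - vm)) \<le> L * r 0 ^ d"
    using cavity_volume Lp hm hmp Dp sig_pos by (intro mult_mono) auto
  moreover have "\<sigma> ^ d * (- (1/2 * hp * (vp - vm))) + hp * (\<sigma> ^ d * (vp - vm)) = 1/2 * hp * (\<sigma> ^ d * (vp - vm))"
    by (simp add: algebra_simps)
  moreover have "0 < 1/2 * hp * (\<sigma> ^ d * (vp - vm))"
    using hm hmp Dp sig_pos by simp
  ultimately have "0 < Q1 - Wl * \<sigma> ^ d + L * r 0 ^ d" by linarith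
  then show ?thesis using dim by (simp add: growth_def)
qed

end

section \<open>The half-line averages as convolutions\<close>

context averaged_profile
begin

text \<open>The substitutions v = N (R - x) and v = N (R + x) turn the two halves of the kernel into
  integrals over the positive and the negative axis; the minus sign is that of the odd extension.
  Nothing is assumed about \<open>u\<close> at 0, where an amplitude is unspecified.\<close>

lemma averaged_amplitude_eq_wn:
  assumes n: "1 \<le> n" and t: "0 < t" and u: "\<And>x. 0 < x \<Longrightarrow> u x t = t * r (x / t)"
  shows "averaged_amplitude \<phi> n u R t = wn (real n) t R"
proof -
  define N where "N = real n"
  have N: "0 < N" using n by (simp add: N_def)
  define g where "g x = t * r (\<bar>x\<bar> / t)" for x
  have [measurable]: "g \<in> borel_measurable borel" unfolding g_def using t by measurable
  have gW: "\<bar>indicator S x * g x\<bar> \<le> \<bar>W t x\<bar>" if "0 \<notin> S" for S x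
    using that by (cases "x = 0") (auto simp: W_def g_def abs_mult indicator_def sgn_real_def)
  have int: "integrable lborel (\<lambda>v. \<phi> v * (indicator S (R - v / N) * g (R - v / N)))"
    if [measurable]: "S \<in> sets borel" and S: "0 \<notin> S" for S
  proof (rule integrable_kernel_times)
    fix v :: real assume v: "\<bar>v\<bar> \<le> 1"
    show "\<bar>indicator S (R - v / N) * g (R - v / N)\<bar> \<le> t * (lam * max \<sigma> ((\<bar>R\<bar> + 1 / N) / t))"
      using gW[OF S] W_abs_le[OF t shift_near[OF N v]] by (rule order_trans)
  qed measurable
  let ?f1 = "\<lambda>v. \<phi> v * (indicator {0<..} (R - v / N) * g (R - v / N))"
  let ?f2 = "\<lambda>v. \<phi> v * (indicator {..<0} (R - v / N) * g (R - v / N))"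
  let ?g1 = "\<lambda>x. \<phi> (N * (R - x)) * (indicator {0<..} x * g x)"
  let ?g2 = "\<lambda>x. \<phi> (N * (R + x)) * (indicator {0<..} x * g x)"
  have i1: "integrable lborel ?f1" and i2: "integrable lborel ?f2"
    by (rule int; simp)+
  have e1: "?f1 (N * R + (- N) * x) = ?g1 x" for x
  proof -
    have "R - (N * R + (- N) * x) / N = x" "N * R + (- N) * x = N * (R - x)" using N by (simp_all add: field_simps)
    then show ?thesis by simp
  qed
  have e2: "?f2 (N * R + N * x) = ?g2 x" for x
  proof -
    have "R - (N * R + N * x) / N = - x" "N * R + N * x = N * (R + x)" using N by (simp_all add: field_simps)
    then show ?thesis by (simp add: g_def indicator_def)
  qed
  have j1: "integrable lborel ?g1" and j2: "integrable lborel ?g2"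
    using lborel_integrable_real_affine[OF i1, of "- N" "N * R"] lborel_integrable_real_affine[OF i2, of N "N * R"] N
    unfolding e1 e2 by auto
  have s1: "integral\<^sup>L lborel ?f1 = N * integral\<^sup>L lborel ?g1"
    using lborel_integral_real_affine[of "- N" ?f1 "N * R"] N unfolding e1 by simp
  have s2: "integral\<^sup>L lborel ?f2 = N * integral\<^sup>L lborel ?g2"
    using lborel_integral_real_affine[of N ?f2 "N * R"] N unfolding e2 by simp
  have "averaged_amplitude \<phi> n u R t = (LINT x|lborel. N * ?g1 x - N * ?g2 x)"
    unfolding averaged_amplitude_def set_lebesgue_integral_def
  proof (rule integral_cong_AE)
    have eq: "indicator {0..} x *\<^sub>R ((scaled_kernel \<phi> n (R - x) - scaled_kernel \<phi> n (R + x)) * u x t)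
      = N * ?g1 x - N * ?g2 x" if "x \<noteq> 0" for x
      using that u[of x] by (auto simp: indicator_def scaled_kernel_def N_def g_def algebra_simps)
    show "AE x in lborel. indicator {0..} x *\<^sub>R ((scaled_kernel \<phi> n (R - x) - scaled_kernel \<phi> n (R + x)) * u x t)
      = N * ?g1 x - N * ?g2 x"
      by (rule AE_mp[OF AE_lborel_singleton[of 0] AE_I2]) (use eq in blast)
    show "(\<lambda>x. N * ?g1 x - N * ?g2 x) \<in> borel_measurable lborel" by measurable
    \<comment> \<open>With \<open>u\<close> arbitrary at 0, the integrand is rewritten at all other
      points and keeps its own value at that single one, which does not affect
      measurability.\<close>
    then have m: "(\<lambda>x. if x = 0 then indicator {0..} x *\<^sub>R ((scaled_kernel \<phi> n (R - x) - scaled_kernel \<phi> n (R + x)) * u 0 t)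
       else N * ?g1 x - N * ?g2 x) \<in> borel_measurable lborel"
      unfolding scaled_kernel_def by measurable
    show "(\<lambda>x. indicator {0..} x *\<^sub>R ((scaled_kernel \<phi> n (R - x) - scaled_kernel \<phi> n (R + x)) * u x t)) \<in> borel_measurable lborel"
      by (rule measurable_cong[THEN iffD1, OF _ m]) (use eq in auto)
  qed
  also have "\<dots> = N * integral\<^sup>L lborel ?g1 - N * integral\<^sup>L lborel ?g2"
    using j1 j2 by simp
  also have "\<dots> = integral\<^sup>L lborel ?f1 - integral\<^sup>L lborel ?f2" by (simp only: s1 s2)
  also have "\<dots> = (LINT v|lborel. ?f1 v - ?f2 v)" using i1 i2 by simp
  also have "\<dots> = wn (real n) t R"
    unfolding wn_def avg_def N_def[symmetric]
    by (intro Bochner_Integration.integral_cong refl) (simp add: W_def g_def indicator_def sgn_real_def)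
  finally show ?thesis .
qed

end

section \<open>The energy of the averaged motions\<close>

lemma amplitude_radial_motion:
  assumes "0 < R"
  shows "amplitude (radial_motion w :: real^'d \<Rightarrow> real \<Rightarrow> real^'d) R t = w R t"
  unfolding amplitude_def radial_motion_def
proof (rule the_equality)
  fix a assume a: "\<forall>x::real^'d. norm x = R \<longrightarrow> w (norm x) t *\<^sub>R sgn x = a *\<^sub>R sgn x"
  obtain x :: "real^'d" where x: "norm x = R" using vector_choose_size assms by (metis less_imp_le)
  then have "sgn x \<noteq> 0" using assms by (auto simp: sgn_zero_iff)
  moreover have "w R t *\<^sub>R sgn x = a *\<^sub>R sgn x" using a x by blast
  ultimately show "a = w R t" by simp
qed simp

text \<open>\<open>h0\<close> agrees with the stored energy on the half line and is measurable on all reals.\<close>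

locale cavity_averages = averaged_energy \<phi> r q lam \<sigma> H "CARD('d)" \<delta> m h0 L
  for \<phi> r q lam \<sigma> H \<delta> m h0 L and dim_type :: "'d::finite itself" +
  fixes h :: "real \<Rightarrow> real" and y :: "real^'d \<Rightarrow> real \<Rightarrow> real^'d"
  assumes h0: "\<And>v. 0 < v \<Longrightarrow> h0 v = h v"
    and y: "y = cavitating_motion lam r"
begin

lemma averaged_motion_eq:
  assumes "1 \<le> n" "0 < t"
  shows "averaged_motion \<phi> n y x t = wn (real n) t (norm x) *\<^sub>R sgn x"
  unfolding averaged_motion_def radial_motion_def[of "averaged_amplitude \<phi> n (amplitude y)"]
  using assms by (subst averaged_amplitude_eq_wn)
    (auto simp: y cavitating_motion_def amplitude_radial_motion)

lemma averaged_motion_velocity: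
  assumes n: "1 \<le> n" and t: "0 < t"
  shows "vector_derivative (averaged_motion \<phi> n y x) (at t) = tn (real n) t (norm x) *\<^sub>R sgn x"
proof (rule vector_derivative_at)
  have "((\<lambda>s. wn (real n) s (norm x)) has_vector_derivative tn (real n) t (norm x)) (at t)"
    using wn_time_deriv[of "real n" t "norm x"] n t
    by (simp add: has_real_derivative_iff_has_vector_derivative)
  from has_vector_derivative_scaleR[OF this[folded has_real_derivative_iff_has_vector_derivative] has_vector_derivative_const[of "sgn x"]]
  have "((\<lambda>s. wn (real n) s (norm x) *\<^sub>R sgn x) has_vector_derivative tn (real n) t (norm x) *\<^sub>R sgn x) (at t)"
    by simp
  moreover have "open {0::real<..}" "t \<in> {0<..}" using t by auto
  ultimately show "(averaged_motion \<phi> n y x has_vector_derivative tn (real n) t (norm x) *\<^sub>R sgn x) (at t)"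
    by (rule has_vector_derivative_transform_within_open) (simp add: averaged_motion_eq[OF n])
qed

lemma energy_density_averaged:
  assumes n: "1 \<le> n" and t: "0 < t" and x: "x \<noteq> 0"
  shows "energy_density h (averaged_motion \<phi> n y) t x = gn (real n) t (norm x)"
proof -
  have N: "0 < real n" and R: "0 < norm x" using n x by auto
  have vp: "0 < vn (real n) t (norm x)"
  proof -
    obtain v where "0 < v" "\<And>N R. 1 \<le> N \<Longrightarrow> 0 < R \<Longrightarrow> v \<le> vn N t R" using vn_lower[OF t] by blast
    moreover have "1 \<le> real n" using n by simp
    ultimately show ?thesis using R by (meson less_le_trans)
  qed
  have "stored_energy h (jacobian (\<lambda>z. averaged_motion \<phi> n y z t) (at x)) =
    1/2 * ((dwn (real n) t (norm x))\<^sup>2 + real (CARD('d) - 1) * (wn (real n) t (norm x) / norm x)\<^sup>2) + h (vn (real n) t (norm x))"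
    unfolding averaged_motion_eq[OF n t] vn_def
    by (rule stored_energy_radial) (use d x wn_deriv[OF N t] dwn_pos[OF N t] wn_pos[OF N t R] in auto)
  moreover have "(norm (tn (real n) t (norm x) *\<^sub>R sgn x))\<^sup>2 = (tn (real n) t (norm x))\<^sup>2"
    using x by (simp add: norm_sgn)
  ultimately show ?thesis
    unfolding energy_density_def averaged_motion_velocity[OF n t] gn_def kin_el_def h0[OF vp] by simp
qed

text \<open>Isolating the unknown value at the origin makes the density visibly measurable.\<close>

lemma energy_density_averaged_if:
  assumes "1 \<le> n" "0 < t"
  shows "energy_density h (averaged_motion \<phi> n y) t =
    (\<lambda>x. if x = 0 then energy_density h (averaged_motion \<phi> n y) t 0 else gn (real n) t (norm x))"
  using energy_density_averaged[OF assms] by auto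

lemma gn_ball_integrable:
  assumes n: "1 \<le> n" and t: "0 < t"
  shows "set_integrable lborel (ball (c::real^'d) \<rho>) (\<lambda>x. gn (real n) t (norm x))"
proof -
  obtain C where C: "\<And>R. 0 < R \<Longrightarrow> \<bar>gn (real n) t R\<bar> \<le> C"
    using gn_bound[OF t, of "real n"] n by auto
  show ?thesis
    unfolding set_integrable_def
  proof (rule integrableI_bounded_set_indicator[where B="max C \<bar>gn (real n) t 0\<bar>"])
    show "(\<lambda>x::real^'d. gn (real n) t (norm x)) \<in> borel_measurable lborel" using t by measurable
    show "emeasure lborel (ball c \<rho>) < \<infinity>"
      using emeasure_bounded_finite[OF bounded_ball] by auto
    show "AE x in lborel. x \<in> ball c \<rho> \<longrightarrow> norm (gn (real n) t (norm x)) \<le> max C \<bar>gn (real n) t 0\<bar>"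
    proof (intro AE_I2 impI)
      fix x :: "real^'d"
      show "norm (gn (real n) t (norm x)) \<le> max C \<bar>gn (real n) t 0\<bar>"
        using C[of "norm x"] by (cases "x = 0") auto
    qed
  qed auto
qed

lemma energy_density_AE:
  assumes n: "1 \<le> n" and t: "0 < t"
  shows "(\<lambda>x. energy_density h (averaged_motion \<phi> n y) t x) \<in> borel_measurable borel"
    "AE x in lborel. energy_density h (averaged_motion \<phi> n y) t x = gn (real n) t (norm x)"
proof -
  show "(\<lambda>x. energy_density h (averaged_motion \<phi> n y) t x) \<in> borel_measurable borel"
    by (subst energy_density_averaged_if[OF n t]) (use t in measurable)
  show "AE x in lborel. energy_density h (averaged_motion \<phi> n y) t x = gn (real n) t (norm x)"
    using AE_lborel_singleton[of 0] energy_density_averaged[OF n t] by (auto elim: eventually_mono)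
qed

lemma approx_energy_integrable:
  assumes n: "1 \<le> n" and t: "0 < t"
  shows "set_integrable lborel (ball c \<rho>) (energy_density h (averaged_motion \<phi> n y) t)"
    "approx_energy h \<phi> y (ball c \<rho>) t n = (LINT x:ball c \<rho>|lborel. gn (real n) t (norm x))"
proof -
  have ae: "AE x in lborel. indicator (ball c \<rho>) x *\<^sub>R energy_density h (averaged_motion \<phi> n y) t x
     = indicator (ball c \<rho>) x *\<^sub>R gn (real n) t (norm x)"
    using energy_density_AE(2)[OF n t] by eventually_elim simp
  have m: "(\<lambda>x. indicator (ball c \<rho>) x *\<^sub>R energy_density h (averaged_motion \<phi> n y) t x) \<in> borel_measurable lborel"
    using energy_density_AE(1)[OF n t]
    by (intro borel_measurable_scaleR borel_measurable_indicator) auto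
  have m': "(\<lambda>x::real^'d. indicator (ball c \<rho>) x *\<^sub>R gn (real n) t (norm x)) \<in> borel_measurable lborel"
  proof (intro borel_measurable_scaleR borel_measurable_indicator)
    show "(\<lambda>x::real^'d. gn (real n) t (norm x)) \<in> borel_measurable lborel" using t by measurable
  qed auto
  show "set_integrable lborel (ball c \<rho>) (energy_density h (averaged_motion \<phi> n y) t)"
    using gn_ball_integrable[OF n t, of c \<rho>] unfolding set_integrable_def
    by (subst integrable_cong_AE[OF m m' ae])
  show "approx_energy h \<phi> y (ball c \<rho>) t n = (LINT x:ball c \<rho>|lborel. gn (real n) t (norm x))"
    unfolding approx_energy_def set_lebesgue_integral_def by (rule integral_cong_AE[OF m m' ae])
qed

lemma gn_outer: "0 < N \<Longrightarrow> 0 < t \<Longrightarrow> \<sigma> * t + 1 / N \<le> R \<Longrightarrow> gn N t R = Wlam"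
proof -
  assume a: "0 < N" "0 < t" "\<sigma> * t + 1 / N \<le> R"
  have "0 < \<sigma> * t" "0 < 1 / N" using sig a by simp_all
  then have "0 < R" using a(3) by linarith
  then show ?thesis by (simp add: gn_def kin_el_def vn_def Wlam_def outer[OF a] field_simps)
qed

text \<open>The excess over the outer density vanishes beyond radius \<open>K\<close>, so
  integrating it over the possibly off-centre ball is the same as over \<open>cball 0 K\<close>,
  where polar coordinates apply.\<close>

lemma approx_energy_polar:
  assumes n: "1 \<le> n" and t: "0 < t" and K: "\<sigma> * t + 1 / real n \<le> K" "cball 0 K \<subseteq> ball c \<rho>"
  shows "approx_energy h \<phi> y (ball c \<rho>) t n = measure lborel (ball c \<rho>) * Wlam +
    real CARD('d) * unit_ball_vol CARD('d) * (LINT R:{0..K}|lborel. R ^ (CARD('d) - 1) * (gn (real n) t R - Wlam))"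
proof -
  have N: "0 < real n" using n by simp
  have "0 < \<sigma> * t" "0 < 1 / real n" using sig t N by simp_all
  then have K0: "0 \<le> K" using K(1) by linarith
  have fin: "emeasure lborel (ball c \<rho>) < \<infinity>"
    using emeasure_bounded_finite[OF bounded_ball] by auto
  have ci: "set_integrable lborel (ball c \<rho>) (\<lambda>x. Wlam)"
    unfolding set_integrable_def using fin by simp
  have "(LINT x:ball c \<rho>|lborel. gn (real n) t (norm x) - Wlam) =
     (LINT x:ball c \<rho>|lborel. gn (real n) t (norm x)) - (LINT x:ball c \<rho>|lborel. Wlam)"
    by (rule set_integral_diff(2)[OF gn_ball_integrable[OF n t] ci])
  moreover have "(LINT x:ball c \<rho>|lborel. Wlam) = measure lborel (ball c \<rho>) * Wlam"
    unfolding set_lebesgue_integral_def using fin by simp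
  moreover have "(LINT x:ball c \<rho>|lborel. gn (real n) t (norm x) - Wlam) =
     (LINT x:cball (0::real^'d) K|lborel. gn (real n) t (norm x) - Wlam)"
    unfolding set_lebesgue_integral_def
  proof (rule Bochner_Integration.integral_cong[OF refl])
    fix x :: "real^'d"
    show "indicator (ball c \<rho>) x *\<^sub>R (gn (real n) t (norm x) - Wlam) = indicator (cball 0 K) x *\<^sub>R (gn (real n) t (norm x) - Wlam)"
    proof (cases "norm x \<le> K")
      case True
      then have "x \<in> cball 0 K" by simp
      then show ?thesis using K(2) by (auto simp: indicator_def)
    next
      case False
      then have "gn (real n) t (norm x) = Wlam" using K(1) by (intro gn_outer[OF N t]) linarith
      then show ?thesis by simp
    qed
  qed
  moreover have "(LINT x:cball (0::real^'d) K|lborel. gn (real n) t (norm x) - Wlam) =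
    DIM(real^'d) * unit_ball_vol DIM(real^'d) * (LINT R:{0..K}|lborel. R ^ (DIM(real^'d) - 1) * (gn (real n) t R - Wlam))"
    by (rule integral_polar) (use t K0 in measurable)
  ultimately show ?thesis
    unfolding approx_energy_integrable(2)[OF n t] by simp
qed

lemma approx_energy_tendsto:
  assumes t: "0 < t" and K: "\<sigma> * t < K" "cball 0 K \<subseteq> ball c \<rho>"
  shows "(\<lambda>n. approx_energy h \<phi> y (ball c \<rho>) t n) \<longlonglongrightarrow> measure lborel (ball c \<rho>) * Wlam +
    real CARD('d) * unit_ball_vol CARD('d) * ((LINT R:{0<..K}|lborel. F t R) + L * (lam * K) ^ CARD('d) / CARD('d))"
proof (rule Lim_transform_eventually)
  show "(\<lambda>n. measure lborel (ball c \<rho>) * Wlam +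
    real CARD('d) * unit_ball_vol CARD('d) * (LINT R:{0..K}|lborel. R ^ (CARD('d) - 1) * (gn (real n) t R - Wlam)))
   \<longlonglongrightarrow> measure lborel (ball c \<rho>) * Wlam +
    real CARD('d) * unit_ball_vol CARD('d) * ((LINT R:{0<..K}|lborel. F t R) + L * (lam * K) ^ CARD('d) / CARD('d))"
    by (intro tendsto_intros radial_energy_tendsto t K)
  obtain k where k: "1 / (K - \<sigma> * t) < real k" using reals_Archimedean2 by blast
  show "\<forall>\<^sub>F n in sequentially. measure lborel (ball c \<rho>) * Wlam +
    real CARD('d) * unit_ball_vol CARD('d) * (LINT R:{0..K}|lborel. R ^ (CARD('d) - 1) * (gn (real n) t R - Wlam))
    = approx_energy h \<phi> y (ball c \<rho>) t n"
  proof (rule eventually_sequentiallyI[of "max 1 k"])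
    fix n assume n: "max 1 k \<le> n"
    then have n1: "1 \<le> n" "0 < real n" "real k \<le> real n" by auto
    have "1 / (K - \<sigma> * t) < real n" using k n1 by linarith
    then have "1 / real n < K - \<sigma> * t" using K n1(2) by (simp add: field_simps)
    then show "measure lborel (ball c \<rho>) * Wlam +
    real CARD('d) * unit_ball_vol CARD('d) * (LINT R:{0..K}|lborel. R ^ (CARD('d) - 1) * (gn (real n) t R - Wlam))
    = approx_energy h \<phi> y (ball c \<rho>) t n"
      by (intro approx_energy_polar[symmetric] n1 t K(2)) simp
  qed
qed

end

theorem proposition3p11:
  fixes h \<phi> r :: "real \<Rightarrow> real" and lam \<sigma> t \<rho> :: real and c :: "real^'d"
    and y :: "real^'d \<Rightarrow> real \<Rightarrow> real^'d" and B :: "(real^'d) set"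
  assumes "CARD('d) \<ge> 3"
    and "admissible_h h"
    and "lam > 0"
    and "\<exists>L. ((\<lambda>v. h v / v) \<longlongrightarrow> L) at_top"
    and "cavitating_profile CARD('d) h lam \<sigma> r"
    and "known_properties CARD('d) h lam \<sigma> r"
    and "y = cavitating_motion lam r"
    and "averaging_kernel \<phi>"
    and "t > 0"
    and "B = ball c \<rho>"
    and "{x. norm x \<le> \<sigma> * t} \<subseteq> B"
  shows "(\<forall>\<^sub>F s in nhds t. energy_exists h \<phi> y B s)
       \<and> energy h \<phi> y B differentiable (at t)
       \<and> deriv (energy h \<phi> y B) t > 0"
proof -
  obtain L where L: "((\<lambda>v. h v / v) \<longlongrightarrow> L) at_top" using assms(4) by blast
  interpret cavity h "CARD('d)" lam \<sigma> r
    by unfold_locales (use assms in auto)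
  interpret mollifier \<phi> by unfold_locales fact
  obtain \<delta> m where dm: "0 < \<delta>" "\<delta> \<le> 1/2" "\<And>u. \<bar>u\<bar> \<le> 2 * \<delta> \<Longrightarrow> \<phi> 0 / 2 \<le> \<phi> u"
    "0 < m" "m \<le> 1" "m = (LINT u|lborel. \<phi> u * indicator {..-\<delta>} u)"
    by (rule kernel_mass, rule that)
  define h0 where "h0 v = (if v \<in> {0<..} then h v else 0)" for v
  have h0m: "h0 \<in> borel_measurable borel"
    unfolding h0_def[abs_def]
    by (rule borel_measurable_continuous_on_if) (auto intro: h_continuous)
  have h0c: "continuous_on {0<..} h0"
    using h_continuous by (rule continuous_on_eq) (simp add: h0_def)
  have h0L: "((\<lambda>v. h0 v / v) \<longlongrightarrow> L) at_top"
    by (rule Lim_transform_eventually[OF L])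
      (rule eventually_mono[OF eventually_gt_at_top[of 0]], simp add: h0_def)
  interpret E: cavity_averages \<phi> r q lam \<sigma> "h_min h" \<delta> m h0 L "TYPE('d)" h y
    by unfold_locales (use dm h0m h0c h0L assms(7) in \<open>auto simp: h0_def\<close>)
  have F: "E.F s R = R ^ (CARD('d) - 1) * (e (R / s) - L * (q (R / s) * (r (R / s) / (R / s)) ^ (CARD('d) - 1)) - Wl)"
    if "0 < s" "0 < R" for s R
  proof -
    have "0 < E.vol (R / s)" using that by (intro E.vol_pos) simp
    moreover have "0 < lam * lam ^ (CARD('d) - 1)" using stretch_pos by simp
    ultimately show ?thesis
      unfolding E.F_def E.density_def E.Wlam_def e_def Wl_def E.vol_def by (simp add: h0_def)
  qed
  define V where "V = real CARD('d) * unit_ball_vol CARD('d)"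
  have V: "0 < V" by (simp add: V_def)
  have ct: "norm c + \<sigma> * t < \<rho>"
  proof -
    have "{x. norm x \<le> \<sigma> * t} = cball (0::real^'d) (\<sigma> * t)" by auto
    then have "cball 0 (\<sigma> * t) \<subseteq> ball c \<rho>" using assms(10,11) by simp
    moreover have "0 < \<sigma> * t" using sig_pos assms(9) by simp
    ultimately show ?thesis by (simp add: cball_subset_ball_iff)
  qed
  \<comment> \<open>Halfway between the fan radius and the largest centred radius that fits into the
    ball. The same \<open>K\<close> then works for all times near t, with room for the averaging
    width.\<close>
  define K where "K = (\<sigma> * t + (\<rho> - norm c)) / 2"
  have K: "\<sigma> * t < K" "norm c + K < \<rho>" using ct by (simp_all add: K_def field_simps)
  have sub: "cball 0 K \<subseteq> ball c \<rho>" using K by (simp add: cball_subset_ball_iff)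
  have lim: "(\<lambda>n. approx_energy h \<phi> y B s n) \<longlonglongrightarrow> measure lborel (ball c \<rho>) * E.Wlam + V * (s ^ CARD('d) * growth L)"
    if s: "0 < s" "\<sigma> * s < K" for s
  proof -
    have K0: "0 < K" using s mult_pos_pos[OF sig_pos s(1)] by linarith
    have si: "set_integrable lborel {0<..K} (E.F s)" by (rule E.far_integral_tendsto(1)[OF s(1) K0])
    \<comment> \<open>The Lebesgue integral is evaluated as a gauge integral; the two forms of the
      integrand are identified at positive radii, and the origin is negligible.\<close>
    have "(E.F s has_integral s ^ CARD('d) * growth L - L * (lam * K) ^ CARD('d) / CARD('d)) {0<..K}"
    proof (rule has_integral_eq)
      show "((\<lambda>R. R ^ (CARD('d) - 1) * (e (R / s) - L * (q (R / s) * (r (R / s) / (R / s)) ^ (CARD('d) - 1)) - Wl))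
        has_integral s ^ CARD('d) * growth L - L * (lam * K) ^ CARD('d) / CARD('d)) {0<..K}"
      proof (rule has_integral_spike_set_eq[THEN iffD1, OF _ _ fan_integral[OF s(1) less_imp_le[OF s(2)]]])
        have "negligible {0::real}" by simp
        then show "negligible {x \<in> {0..K} - {0<..K}. x ^ (CARD('d) - 1) * (e (x / s) - L * (q (x / s) * (r (x / s) / (x / s)) ^ (CARD('d) - 1)) - Wl) \<noteq> 0}"
          by (rule negligible_subset) auto
        show "negligible {x \<in> {0<..K} - {0..K}. x ^ (CARD('d) - 1) * (e (x / s) - L * (q (x / s) * (r (x / s) / (x / s)) ^ (CARD('d) - 1)) - Wl) \<noteq> 0}"
          by (rule negligible_subset[OF negligible_empty]) auto
      qed
    qed (simp add: F[OF s(1)])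
    then have "(LINT R:{0<..K}|lborel. E.F s R) = s ^ CARD('d) * growth L - L * (lam * K) ^ CARD('d) / CARD('d)"
      using set_borel_integral_eq_integral(2)[OF si] by (simp add: integral_unique)
    then show ?thesis
      using E.approx_energy_tendsto[OF s sub] by (simp add: assms(10) V_def)
  qed
  \<comment> \<open>An open set of times at which the fan stays inside radius \<open>K\<close>. On
    it the energy is a constant plus a multiple of s^d, so the derivative can be read off.\<close>
  define U where "U = {0<..<K / \<sigma>}"
  have U: "open U" "t \<in> U" "\<And>s. s \<in> U \<Longrightarrow> 0 < s \<and> \<sigma> * s < K"
    using K assms(9) sig_pos by (auto simp: U_def field_simps)
  have ex: "energy_exists h \<phi> y B s" if "s \<in> U" for s
    unfolding energy_exists_def
    using lim[of s] U(3)[OF that] E.approx_energy_integrable(1)[of _ s c \<rho>] by (auto simp: convergent_def assms(10))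
  have en: "energy h \<phi> y B s = measure lborel (ball c \<rho>) * E.Wlam + V * (s ^ CARD('d) * growth L)" if "s \<in> U" for s
    unfolding energy_def using U(3)[OF that] by (intro limI lim) auto
  have "((\<lambda>s. measure lborel (ball c \<rho>) * E.Wlam + V * (s ^ CARD('d) * growth L)) has_real_derivative
     V * (real CARD('d) * t ^ (CARD('d) - 1) * growth L)) (at t)"
    by (auto intro!: derivative_eq_intros)
  then have D: "(energy h \<phi> y B has_real_derivative V * (real CARD('d) * t ^ (CARD('d) - 1) * growth L)) (at t)"
    by (rule has_field_derivative_transform_within_open[OF _ U(1,2)]) (simp add: en)
  have "0 < V * (real CARD('d) * t ^ (CARD('d) - 1) * growth L)"
    using V assms(9) growth_pos[OF L] by simp
  then show ?thesis
    using D DERIV_imp_deriv[OF D] ex eventually_nhds_in_open[OF U(1,2)]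
    by (auto simp: real_differentiable_def elim: eventually_mono)
qed

end
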